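(* Let $(\mathcal{P},\omega)$ be a symplectic manifold, $H\in\mathcal{C}^\infty(\mathcal{P})$, $V$ a real vector space of dimension $m$, and $\mathsf{J}\colon\mathcal{P}\to V^*$ a smooth map having $0$ as a regular value, and let $\mathcal{M}=\mathsf{J}^{-1}(0)$. Suppose that $\mathcal{M}$ is a coisotropic submanifold of $\mathcal{P}$ and that the nondegeneracy assumption holds: for every $z\in\mathcal{M}$, the critical points of the restriction of $H$ to the fibre $[z]$ are nondegenerate. Consider a (smooth) method $\varphi_h$ consistent with $\dot z=X_H(z)$. Then for $h$ small enough and for $z\in\mathcal{M}$ in a neighbourhood of the hidden constraint set $\mathcal{M}^H$, the equation $$\mathsf{J}\big(\varphi_h(z^+)\big)=0,\qquad z^+\in[z],$$ has a unique solution.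
   Context: $X_H$ is the Hamiltonian vector field of $H$, $\omega(X_H,\cdot)=\mathrm{d}H$. Let $\nu$ be the pull-back of $\omega$ to $\mathcal{M}$. $\mathcal{M}$ is coisotropic if $T\mathcal{M}^{\perp}\subset T\mathcal{M}$, where $T_x\mathcal{M}^\perp=\{u\in T_x\mathcal{P}:\omega(u,v)=0\ \forall v\in T_x\mathcal{M}\}$. The distribution $\ker\nu$ (of constant dimension) is integrable; the fibre $[x]$ is the leaf through $x$ of the corresponding foliation of $\mathcal{M}$. The hidden constraint set is $\mathcal{M}^H=\{z\in\mathcal{M}:\mathrm{d}(H|_{\mathcal{M}})(z)\in\nu(T_z\mathcal{M})\}$, with $\nu(T_z\mathcal{M})=\{\nu_z(u,\cdot):u\in T_z\mathcal{M}\}$. A critical point is nondegenerate if its Hessian is nonsingular. A smooth method consistent with $\dot z=X_H(z)$ is a family of maps $\varphi_h\colon\mathcal{P}\to\mathcal{P}$ depending smoothly on the time step $h$ and on the point, with $\varphi_0=\mathrm{id}$ and $\frac{\partial}{\partial h}\varphi_h(z)\big|_{h=0}=X_H(z)$.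
   Formalization: Uniqueness is proved for nonzero h in the connected piece of [z] near z, with the bound on h depending on the point of the hidden constraint set; uniqueness in all of [z] fails (J=q, H=p^4-p^2 has three solutions), as do h=0 and a uniform bound when the set is noncompact. *)

theory Defs
  imports "HOL-Analysis.Analysis"
begin

section \<open>Smooth functions between vector spaces\<close>

text \<open>
  Both predicates are meant for an open set \<open>S\<close> in a finite-dimensional space; there the iterated
  directional derivatives are the iterated partial derivatives.
\<close>

primrec Ck_on ::
  "nat \<Rightarrow> 'a::real_normed_vector set \<Rightarrow> ('a \<Rightarrow> 'b::real_normed_vector) \<Rightarrow> bool" where
  "Ck_on 0 S f \<longleftrightarrow> continuous_on S f"
| "Ck_on (Suc k) S f \<longleftrightarrow>
     (\<forall>x\<in>S. f differentiable (at x)) \<and> (\<forall>v. Ck_on k S (\<lambda>x. frechet_derivative f (at x) v))"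

definition smooth_on ::
  "'a::real_normed_vector set \<Rightarrow> ('a \<Rightarrow> 'b::real_normed_vector) \<Rightarrow> bool" where
  "smooth_on S f \<longleftrightarrow> (\<forall>k. Ck_on k S f)"


section \<open>Smooth manifolds\<close>

text \<open>
  The manifold is a whole type \<open>'p\<close> (Hausdorff and second countable, by type class, in the
  theorem); a chart is a domain together with a coordinate map into the model space \<open>'e\<close>.
  A coordinate map is only relevant on its domain \<open>U\<close>, and \<open>inv_into U \<psi>\<close> is its inverse.
\<close>

type_synonym ('p, 'e) chart = "'p set \<times> ('p \<Rightarrow> 'e)"

definition is_chart :: "('p::topological_space, 'e::euclidean_space) chart \<Rightarrow> bool" where
  "is_chart c \<longleftrightarrow> (case c of (U, \<psi>) \<Rightarrow>
     open U \<and> open (\<psi> ` U) \<and> homeomorphism U (\<psi> ` U) \<psi> (inv_into U \<psi>))"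

definition smooth_atlas :: "('p::topological_space, 'e::euclidean_space) chart set \<Rightarrow> bool" where
  "smooth_atlas A \<longleftrightarrow>
     (\<forall>c\<in>A. is_chart c) \<and> (\<Union>c\<in>A. fst c) = UNIV \<and>
     (\<forall>(U, \<psi>)\<in>A. \<forall>(W, \<eta>)\<in>A. smooth_on (\<psi> ` (U \<inter> W)) (\<eta> \<circ> inv_into U \<psi>))"

definition compatible_chart ::
  "('p::topological_space, 'e::euclidean_space) chart set \<Rightarrow> ('p, 'e) chart \<Rightarrow> bool" where
  "compatible_chart A c \<longleftrightarrow> smooth_atlas (insert c A)"

definition euclidean_atlas :: "('e::euclidean_space, 'e) chart set" where
  "euclidean_atlas = {(UNIV, \<lambda>x. x)}"

definition prod_atlas ::
  "('p, 'e) chart set \<Rightarrow> ('q, 'f) chart set \<Rightarrow> ('p \<times> 'q, 'e \<times> 'f) chart set" where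
  "prod_atlas A B = {(U \<times> W, map_prod \<psi> \<eta>) | U \<psi> W \<eta>. (U, \<psi>) \<in> A \<and> (W, \<eta>) \<in> B}"

text \<open>Smoothness of a map on an open subset \<open>S\<close> of a manifold.\<close>

definition smooth_map ::
  "('p::topological_space, 'e::euclidean_space) chart set \<Rightarrow>
   ('q::topological_space, 'f::euclidean_space) chart set \<Rightarrow> 'p set \<Rightarrow> ('p \<Rightarrow> 'q) \<Rightarrow> bool" where
  "smooth_map A B S f \<longleftrightarrow>
     continuous_on S f \<and>
     (\<forall>(U, \<psi>)\<in>A. \<forall>(W, \<eta>)\<in>B. smooth_on (\<psi> ` (U \<inter> S \<inter> f -` W)) (\<eta> \<circ> f \<circ> inv_into U \<psi>))"

text \<open>
  The tangent space at \<open>x\<close> is the model space \<open>'e\<close>, a tangent vector being represented by its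
  components in one chart around \<open>x\<close>, chosen once and for all. In \<open>euclidean_atlas\<close> the chosen
  chart is the identity, so there tangent vectors and derivatives are the usual ones.
\<close>

definition chart_at :: "('p, 'e) chart set \<Rightarrow> 'p \<Rightarrow> ('p, 'e) chart" where
  "chart_at A x = (SOME c. c \<in> A \<and> x \<in> fst c)"

definition tangent_map ::
  "('p, 'e::euclidean_space) chart set \<Rightarrow> ('q, 'f::euclidean_space) chart set \<Rightarrow>
   ('p \<Rightarrow> 'q) \<Rightarrow> 'p \<Rightarrow> 'e \<Rightarrow> 'f" where
  "tangent_map A B f x =
     (case chart_at A x of (U, \<psi>) \<Rightarrow> case chart_at B (f x) of (W, \<eta>) \<Rightarrow>
        frechet_derivative (\<eta> \<circ> f \<circ> inv_into U \<psi>) (at (\<psi> x)))"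

abbreviation differential ::
  "('p, 'e::euclidean_space) chart set \<Rightarrow> ('p \<Rightarrow> real) \<Rightarrow> 'p \<Rightarrow> 'e \<Rightarrow> real" where
  "differential A f \<equiv> tangent_map A euclidean_atlas f"

text \<open>The velocity at time 0 of a curve.\<close>

abbreviation velocity :: "('p, 'e::euclidean_space) chart set \<Rightarrow> (real \<Rightarrow> 'p) \<Rightarrow> 'e" where
  "velocity A \<gamma> \<equiv> tangent_map euclidean_atlas A \<gamma> 0 1"


section \<open>Submanifolds, integral manifolds and leaves\<close>

definition embedded_submanifold ::
  "('p::topological_space, 'e::euclidean_space) chart set \<Rightarrow> 'p set \<Rightarrow> bool" where
  "embedded_submanifold A N \<longleftrightarrow>
     (\<forall>x\<in>N. \<exists>U \<psi> E. compatible_chart A (U, \<psi>) \<and> x \<in> U \<and> subspace E \<and> U \<inter> N = {y \<in> U. \<psi> y \<in> E})"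

text \<open>Tangent vectors of a submanifold \<open>N\<close>, as vectors tangent to the ambient manifold.\<close>

definition tangent_space ::
  "('p::topological_space, 'e::euclidean_space) chart set \<Rightarrow> 'p set \<Rightarrow> 'p \<Rightarrow> 'e set" where
  "tangent_space A N x =
     {velocity A \<gamma> | \<gamma>. \<exists>\<epsilon>>0. smooth_map euclidean_atlas A {-\<epsilon><..<\<epsilon>} \<gamma> \<and>
        \<gamma> 0 = x \<and> (\<forall>t\<in>{-\<epsilon><..<\<epsilon>}. \<gamma> t \<in> N)}"

text \<open>
  In what follows \<open>D\<close> is a distribution on the submanifold \<open>M\<close>. The leaf topology on \<open>M\<close> has the
  embedded integral manifolds of \<open>D\<close> (the plaques) as a subbasis of open sets. If \<open>D\<close> is
  integrable, a connected immersed integral manifold is a union of plaques that is connected in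
  the leaf topology, so the maximal one through \<open>x\<close>, the leaf, is the component of \<open>x\<close>.
\<close>

definition integral_manifold ::
  "('p::topological_space, 'e::euclidean_space) chart set \<Rightarrow> 'p set \<Rightarrow> ('p \<Rightarrow> 'e set) \<Rightarrow>
   'p set \<Rightarrow> bool" where
  "integral_manifold A M D N \<longleftrightarrow>
     N \<subseteq> M \<and> embedded_submanifold A N \<and> (\<forall>x\<in>N. tangent_space A N x = D x)"

definition leaf_topology ::
  "('p::topological_space, 'e::euclidean_space) chart set \<Rightarrow> 'p set \<Rightarrow> ('p \<Rightarrow> 'e set) \<Rightarrow>
   'p topology" where
  "leaf_topology A M D = topology_generated_by {N. integral_manifold A M D N}"

definition leaf ::
  "('p::topological_space, 'e::euclidean_space) chart set \<Rightarrow> 'p set \<Rightarrow> ('p \<Rightarrow> 'e set) \<Rightarrow>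
   'p \<Rightarrow> 'p set" where
  "leaf A M D x = connected_component_of_set (leaf_topology A M D) x"

text \<open>
  The component containing \<open>x\<close> of the part of the leaf through \<open>x\<close> that lies in \<open>U\<close>, where
  connectedness refers to the leaf topology (a leaf may return to \<open>U\<close> infinitely often). For
  open \<open>U\<close> it is the leaf through \<open>x\<close> of the foliation restricted to \<open>M \<inter> U\<close>.
\<close>

definition local_leaf ::
  "('p::topological_space, 'e::euclidean_space) chart set \<Rightarrow> 'p set \<Rightarrow> ('p \<Rightarrow> 'e set) \<Rightarrow>
   'p set \<Rightarrow> 'p \<Rightarrow> 'p set" where
  "local_leaf A M D U x =
     connected_component_of_set (subtopology (leaf_topology A M D) (leaf A M D x \<inter> U)) x"

text \<open>
  A chart \<open>(U, \<psi>)\<close> around \<open>c\<close> in which the linear subspace \<open>E\<close> describes an integral manifold: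
  restricted to that integral manifold, \<open>\<psi>\<close> is a chart of the leaf through \<open>c\<close> with values in \<open>E\<close>.
\<close>

definition leaf_chart ::
  "('p::topological_space, 'e::euclidean_space) chart set \<Rightarrow> 'p set \<Rightarrow> ('p \<Rightarrow> 'e set) \<Rightarrow>
   'p \<Rightarrow> 'p set \<Rightarrow> ('p \<Rightarrow> 'e) \<Rightarrow> 'e set \<Rightarrow> bool" where
  "leaf_chart A M D c U \<psi> E \<longleftrightarrow>
     compatible_chart A (U, \<psi>) \<and> subspace E \<and> c \<in> U \<and> \<psi> c \<in> E \<and>
     integral_manifold A M D {x \<in> U. \<psi> x \<in> E}"

text \<open>
  Critical points of the restriction of \<open>H\<close> to the leaf through \<open>x\<close>. Being critical, and the
  Hessian at a critical point being nonsingular, do not depend on the leaf chart.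
\<close>

definition leaf_critical_point ::
  "('p::topological_space, 'e::euclidean_space) chart set \<Rightarrow> 'p set \<Rightarrow> ('p \<Rightarrow> 'e set) \<Rightarrow>
   ('p \<Rightarrow> real) \<Rightarrow> 'p \<Rightarrow> 'p \<Rightarrow> bool" where
  "leaf_critical_point A M D H x c \<longleftrightarrow>
     c \<in> leaf A M D x \<and>
     (\<exists>U \<psi> E. leaf_chart A M D c U \<psi> E \<and>
        (\<forall>v\<in>E. frechet_derivative (H \<circ> inv_into U \<psi>) (at (\<psi> c)) v = 0))"

definition hessian ::
  "('e::euclidean_space \<Rightarrow> real) \<Rightarrow> 'e \<Rightarrow> 'e \<Rightarrow> 'e \<Rightarrow> real" where
  "hessian f y u v = frechet_derivative (\<lambda>w. frechet_derivative f (at w) v) (at y) u"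

definition leaf_hessian_nonsingular ::
  "('p::topological_space, 'e::euclidean_space) chart set \<Rightarrow> 'p set \<Rightarrow> ('p \<Rightarrow> 'e set) \<Rightarrow>
   ('p \<Rightarrow> real) \<Rightarrow> 'p \<Rightarrow> bool" where
  "leaf_hessian_nonsingular A M D H c \<longleftrightarrow>
     (\<forall>U \<psi> E. leaf_chart A M D c U \<psi> E \<longrightarrow>
        (\<forall>u\<in>E. (\<forall>v\<in>E. hessian (H \<circ> inv_into U \<psi>) (\<psi> c) u v = 0) \<longrightarrow> u = 0))"


section \<open>Symplectic geometry\<close>

text \<open>The components of a two-form in the chart \<open>(U, \<psi>)\<close>: its pull-back by the inverse of \<open>\<psi>\<close>.\<close>

definition chart_form ::
  "('p, 'e::euclidean_space) chart set \<Rightarrow> ('p \<Rightarrow> 'e \<Rightarrow> 'e \<Rightarrow> real) \<Rightarrow> 'p set \<Rightarrow> ('p \<Rightarrow> 'e) \<Rightarrow>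
   'e \<Rightarrow> 'e \<Rightarrow> 'e \<Rightarrow> real" where
  "chart_form A \<omega> U \<psi> y u v =
     \<omega> (inv_into U \<psi> y)
       (tangent_map euclidean_atlas A (inv_into U \<psi>) y u)
       (tangent_map euclidean_atlas A (inv_into U \<psi>) y v)"

definition smooth_two_form ::
  "('p, 'e::euclidean_space) chart set \<Rightarrow> ('p \<Rightarrow> 'e \<Rightarrow> 'e \<Rightarrow> real) \<Rightarrow> bool" where
  "smooth_two_form A \<omega> \<longleftrightarrow>
     (\<forall>x. bilinear (\<omega> x) \<and> (\<forall>u. \<omega> x u u = 0)) \<and>
     (\<forall>(U, \<psi>)\<in>A. \<forall>u v. smooth_on (\<psi> ` U) (\<lambda>y. chart_form A \<omega> U \<psi> y u v))"

text \<open>The exterior derivative evaluated on three constant vector fields of the chart.\<close>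

definition closed_two_form ::
  "('p, 'e::euclidean_space) chart set \<Rightarrow> ('p \<Rightarrow> 'e \<Rightarrow> 'e \<Rightarrow> real) \<Rightarrow> bool" where
  "closed_two_form A \<omega> \<longleftrightarrow>
     (\<forall>(U, \<psi>)\<in>A. \<forall>y\<in>\<psi> ` U. \<forall>u v w.
        frechet_derivative (\<lambda>y. chart_form A \<omega> U \<psi> y v w) (at y) u +
        frechet_derivative (\<lambda>y. chart_form A \<omega> U \<psi> y w u) (at y) v +
        frechet_derivative (\<lambda>y. chart_form A \<omega> U \<psi> y u v) (at y) w = 0)"

definition symplectic_manifold ::
  "('p::topological_space, 'e::euclidean_space) chart set \<Rightarrow> ('p \<Rightarrow> 'e \<Rightarrow> 'e \<Rightarrow> real) \<Rightarrow> bool"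
  where
  "symplectic_manifold A \<omega> \<longleftrightarrow>
     smooth_atlas A \<and> smooth_two_form A \<omega> \<and> closed_two_form A \<omega> \<and>
     (\<forall>x u. (\<forall>v. \<omega> x u v = 0) \<longrightarrow> u = 0)"

definition hamiltonian_vector_field ::
  "('p, 'e::euclidean_space) chart set \<Rightarrow> ('p \<Rightarrow> 'e \<Rightarrow> 'e \<Rightarrow> real) \<Rightarrow> ('p \<Rightarrow> real) \<Rightarrow> 'p \<Rightarrow> 'e" where
  "hamiltonian_vector_field A \<omega> H z = (THE X. \<forall>v. \<omega> z X v = differential A H z v)"

definition symplectic_complement ::
  "('p \<Rightarrow> 'e \<Rightarrow> 'e \<Rightarrow> real) \<Rightarrow> 'p \<Rightarrow> 'e set \<Rightarrow> 'e set" where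
  "symplectic_complement \<omega> x S = {u. \<forall>v\<in>S. \<omega> x u v = 0}"

definition coisotropic_submanifold ::
  "('p::topological_space, 'e::euclidean_space) chart set \<Rightarrow> ('p \<Rightarrow> 'e \<Rightarrow> 'e \<Rightarrow> real) \<Rightarrow>
   'p set \<Rightarrow> bool" where
  "coisotropic_submanifold A \<omega> M \<longleftrightarrow>
     embedded_submanifold A M \<and>
     (\<forall>x\<in>M. symplectic_complement \<omega> x (tangent_space A M x) \<subseteq> tangent_space A M x)"

text \<open>
  The pull-back \<open>\<nu>\<close> of \<open>\<omega>\<close> to \<open>M\<close> is the restriction of \<open>\<omega> x\<close> to tangent vectors of \<open>M\<close>, and
  \<open>d(H|M)\<close> is the restriction of \<open>dH\<close> to them.
\<close>

definition ker_pullback ::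
  "('p::topological_space, 'e::euclidean_space) chart set \<Rightarrow> ('p \<Rightarrow> 'e \<Rightarrow> 'e \<Rightarrow> real) \<Rightarrow>
   'p set \<Rightarrow> 'p \<Rightarrow> 'e set" where
  "ker_pullback A \<omega> M x =
     {u \<in> tangent_space A M x. \<forall>v\<in>tangent_space A M x. \<omega> x u v = 0}"

definition hidden_constraint_set ::
  "('p::topological_space, 'e::euclidean_space) chart set \<Rightarrow> ('p \<Rightarrow> 'e \<Rightarrow> 'e \<Rightarrow> real) \<Rightarrow>
   'p set \<Rightarrow> ('p \<Rightarrow> real) \<Rightarrow> 'p set" where
  "hidden_constraint_set A \<omega> M H =
     {z \<in> M. \<exists>u\<in>tangent_space A M z. \<forall>v\<in>tangent_space A M z. differential A H z v = \<omega> z u v}"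

text \<open>The fibre \<open>[z]\<close> and its local version.\<close>

abbreviation fibre ::
  "('p::topological_space, 'e::euclidean_space) chart set \<Rightarrow> ('p \<Rightarrow> 'e \<Rightarrow> 'e \<Rightarrow> real) \<Rightarrow>
   'p set \<Rightarrow> 'p \<Rightarrow> 'p set" where
  "fibre A \<omega> M z \<equiv> leaf A M (ker_pullback A \<omega> M) z"

abbreviation local_fibre ::
  "('p::topological_space, 'e::euclidean_space) chart set \<Rightarrow> ('p \<Rightarrow> 'e \<Rightarrow> 'e \<Rightarrow> real) \<Rightarrow>
   'p set \<Rightarrow> 'p set \<Rightarrow> 'p \<Rightarrow> 'p set" where
  "local_fibre A \<omega> M U z \<equiv> local_leaf A M (ker_pullback A \<omega> M) U z"

definition nondegeneracy_assumption ::
  "('p::topological_space, 'e::euclidean_space) chart set \<Rightarrow> ('p \<Rightarrow> 'e \<Rightarrow> 'e \<Rightarrow> real) \<Rightarrow>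
   'p set \<Rightarrow> ('p \<Rightarrow> real) \<Rightarrow> bool" where
  "nondegeneracy_assumption A \<omega> M H \<longleftrightarrow>
     (\<forall>z\<in>M. \<forall>c. leaf_critical_point A M (ker_pullback A \<omega> M) H z c \<longrightarrow>
        leaf_hessian_nonsingular A M (ker_pullback A \<omega> M) H c)"


section \<open>Maps into a dual space, and methods\<close>

text \<open>
  \<open>V\<^sup>*\<close> is the set of linear functionals on the type \<open>'v\<close>. For finite-dimensional \<open>'v\<close>, a map into
  \<open>V\<^sup>*\<close> is smooth iff its evaluation at each vector is, and derivatives are evaluated likewise.
\<close>

definition smooth_dual_map ::
  "('p::topological_space, 'e::euclidean_space) chart set \<Rightarrow> ('p \<Rightarrow> 'v::real_vector \<Rightarrow> real) \<Rightarrow>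
   bool" where
  "smooth_dual_map A J \<longleftrightarrow>
     (\<forall>z. linear (J z)) \<and> (\<forall>v. smooth_map A euclidean_atlas UNIV (\<lambda>z. J z v))"

definition regular_value_dual ::
  "('p, 'e::euclidean_space) chart set \<Rightarrow> ('p \<Rightarrow> 'v::real_vector \<Rightarrow> real) \<Rightarrow>
   ('v \<Rightarrow> real) \<Rightarrow> bool" where
  "regular_value_dual A J \<beta> \<longleftrightarrow>
     (\<forall>z. J z = \<beta> \<longrightarrow> (\<forall>\<alpha>. linear \<alpha> \<longrightarrow> (\<exists>u. \<forall>v. differential A (\<lambda>y. J y v) z u = \<alpha> v)))"

text \<open>The time step of the method ranges over an open set \<open>I\<close> around 0, possibly all of the reals.\<close>

definition consistent_method ::
  "('p::topological_space, 'e::euclidean_space) chart set \<Rightarrow> ('p \<Rightarrow> 'e) \<Rightarrow> real set \<Rightarrow>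
   (real \<Rightarrow> 'p \<Rightarrow> 'p) \<Rightarrow> bool" where
  "consistent_method A X I \<phi> \<longleftrightarrow>
     open I \<and> 0 \<in> I \<and>
     smooth_map (prod_atlas euclidean_atlas A) A (I \<times> UNIV) (\<lambda>(h, z). \<phi> h z) \<and>
     (\<forall>z. \<phi> 0 z = z) \<and>
     (\<forall>z. velocity A (\<lambda>h. \<phi> h z) = X z)"

end

theory Submission
  imports Defs
begin

text \<open>
  Near a point of the hidden constraint set, slice coordinates make \<open>M\<close> linear, and closedness of the
  symplectic form makes the characteristic distribution \<open>ker \<nu>\<close> spanned by a frame with commuting
  fields. Solving \<open>z' = F(z) d\<close> up to time 1 parametrises the plaques by \<open>d\<close>; the solution depends
  continuously on its initial point, and commutativity gives its derivative in \<open>d\<close>. The plaques are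
  open in the leaf topology and connected, so in a box saturated by plaques they are the local fibres.

  Since \<open>J\<close> vanishes on \<open>M\<close>, the equation \<open>J(\<phi>\<^sub>h(z)) = 0\<close> on a plaque may be divided by \<open>h\<close>. In the limit
  \<open>h \<rightarrow> 0\<close> it becomes \<open>dJ(X\<^sub>H) = 0\<close>, that is, \<open>dH\<close> vanishes on the Hamiltonian vector fields of the
  components of \<open>J\<close>. These span \<open>ker \<nu>\<close>, so the limit equation says that \<open>z\<close> is critical for \<open>H\<close>
  on the fibre, and its linearisation is the Hessian of \<open>H\<close> along the fibre. As this is nonsingular, the
  contraction principle yields exactly one solution on every nearby plaque for small \<open>h \<noteq> 0\<close>. Mean value
  arguments, first in \<open>h\<close> and then along the plaque, give the contraction estimate.
\<close>

section \<open>Calculus of smooth functions\<close>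

text \<open>At \<open>h = 0\<close> the equation holds identically on \<open>M\<close>, so no
  implicit function argument applies to it as it stands; hence the quotient by \<open>h\<close>,
  with step sizes of both signs. The quotient is a square system: regularity of the value 0 makes
  the Hamiltonian vector fields of the components of \<open>J\<close> a basis of
  \<open>ker \<nu>\<close>, so there are as many equations as plaque parameters. One bound on the
  step size has to serve all nearby plaques. All constants are therefore fixed at the given point,
  and the estimates on neighbouring plaques differentiate in the plaque parameter \<open>d\<close>;
  the initial point enters through Lipschitz dependence, never through a derivative. The frame
  \<open>F\<close> is normalised by \<open>P (F p v) = P v\<close> with a fixed projection
  \<open>P\<close>. Thus \<open>P\<close> advances by a known amount along every solution, it serves
  as plaque coordinate, and the charts that straighten plaques have an explicit inverse. Reaching
  time 1 with small \<open>d\<close> keeps the Lipschitz constant at most 1/2: the Picard map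
  contracts on the whole interval and a factor 2 replaces exponential growth bounds.\<close>

lemma Ck_on_subset: "Ck_on k S f \<Longrightarrow> T \<subseteq> S \<Longrightarrow> Ck_on k T f"
  by (induction k arbitrary: f) (auto intro: continuous_on_subset)

lemma Ck_on_cong:
  assumes "open S" "\<And>x. x \<in> S \<Longrightarrow> f x = g x" "Ck_on k S f"
  shows "Ck_on k S g"
  using assms(2,3)
proof (induction k arbitrary: f g)
  case 0
  then show ?case using continuous_on_cong by (metis Ck_on.simps(1))
next
  case (Suc k)
  have d: "f differentiable (at x)" if "x \<in> S" for x using Suc.prems that by auto
  have g: "g differentiable (at x)" if "x \<in> S" for x
    using d[OF that] that Suc.prems(1) assms(1)
    by (metis differentiable_def has_derivative_transform_within_open)
  have eq: "frechet_derivative f (at x) = frechet_derivative g (at x)" if "x \<in> S" for x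
    using frechet_derivative_transform_within_open[OF d[OF that] assms(1) that] Suc.prems(1) by auto
  have "Ck_on k S (\<lambda>x. frechet_derivative g (at x) v)" for v
  proof (rule Suc.IH)
    show "Ck_on k S (\<lambda>x. frechet_derivative f (at x) v)" using Suc.prems(2) by simp
  qed (simp add: eq)
  with g show ?case by simp
qed

text \<open>Chart expressions are smooth only where chart domains overlap. Regularity near every
  point is glued here by induction on the order, since the derivative is again a local
  notion.\<close>

lemma Ck_on_local:
  assumes "\<And>x. x \<in> S \<Longrightarrow> \<exists>T. open T \<and> x \<in> T \<and> Ck_on k T f"
  shows "Ck_on k S f"
  using assms
proof (induction k arbitrary: f)
  case 0
  have "continuous (at x) f" if "x \<in> S" for x
    using 0[OF that] by (auto simp: continuous_on_eq_continuous_at)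
  then show ?case by (auto simp: continuous_at_imp_continuous_on)
next
  case (Suc k)
  have "f differentiable (at x)" if "x \<in> S" for x
    using Suc.prems[OF that] by auto
  moreover have "Ck_on k S (\<lambda>x. frechet_derivative f (at x) v)" for v
    by (rule Suc.IH) (use Suc.prems in force)
  ultimately show ?case by simp
qed

lemma Ck_on_Suc_imp: "Ck_on (Suc k) S f \<Longrightarrow> Ck_on k S f"
proof (induction k arbitrary: f)
  case 0
  then show ?case
    by (auto intro!: continuous_at_imp_continuous_on differentiable_imp_continuous_within)
next
  case (Suc k)
  then show ?case by (metis Ck_on.simps(2))
qed

text \<open>Any explicit formula may serve as derivative: uniqueness identifies it with
  \<open>frechet_derivative\<close> on the open set, and \<open>Ck_on_cong\<close> carries the
  regularity over.\<close>

lemma Ck_on_SucI: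
  assumes "open S"
    and "\<And>x. x \<in> S \<Longrightarrow> (f has_derivative f' x) (at x)"
    and "\<And>v. Ck_on k S (\<lambda>x. f' x v)"
  shows "Ck_on (Suc k) S f"
proof -
  have "frechet_derivative f (at x) = f' x" if "x \<in> S" for x
    using assms(2)[OF that] frechet_derivative_at by metis
  then show ?thesis using assms
    by (auto simp: differentiable_def intro!: Ck_on_cong[OF assms(1) _ assms(3)])
qed

lemma Ck_on_SucD:
  assumes "Ck_on (Suc k) S f" "x \<in> S"
  shows "(f has_derivative frechet_derivative f (at x)) (at x)"
  using assms frechet_derivative_works by auto

lemma Ck_on_const: "open S \<Longrightarrow> Ck_on k S (\<lambda>x. c)"
  by (induction k arbitrary: c) (auto simp: differentiable_def)

lemma Ck_on_bounded_linear_comp: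
  assumes "open S" "bounded_linear L" "Ck_on k S f"
  shows "Ck_on k S (\<lambda>x. L (f x))"
  using assms(3)
proof (induction k arbitrary: f)
  case 0
  then show ?case using bounded_linear.continuous_on[OF assms(2)] by auto
next
  case (Suc k)
  show ?case
  proof (rule Ck_on_SucI[OF assms(1)])
    show "((\<lambda>x. L (f x)) has_derivative (\<lambda>v. L (frechet_derivative f (at x) v))) (at x)"
      if "x \<in> S" for x
      using bounded_linear.has_derivative[OF assms(2) Ck_on_SucD[OF Suc.prems that]] .
    show "Ck_on k S (\<lambda>x. L (frechet_derivative f (at x) v))" for v
      using Suc by auto
  qed
qed

lemma Ck_on_ident: "open S \<Longrightarrow> Ck_on k S (\<lambda>x. x)"
  by (cases k) (auto intro: Ck_on_const)

lemma Ck_on_bounded_linear: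
  assumes "open S" "bounded_linear L"
  shows "Ck_on k S L"
  using Ck_on_bounded_linear_comp[OF assms Ck_on_ident[OF assms(1)]] .

lemma Ck_on_add:
  assumes "open S" "Ck_on k S f" "Ck_on k S g"
  shows "Ck_on k S (\<lambda>x. f x + g x)"
  using assms(2,3)
proof (induction k arbitrary: f g)
  case 0
  then show ?case by (auto intro: continuous_intros)
next
  case (Suc k)
  show ?case
    by (rule Ck_on_SucI[OF assms(1) has_derivative_add[OF Ck_on_SucD[OF Suc.prems(1)] Ck_on_SucD[OF Suc.prems(2)]]])
      (use Suc in auto)
qed

lemma Ck_on_sum:
  assumes "open S" "\<And>i. i \<in> I \<Longrightarrow> Ck_on k S (f i)"
  shows "Ck_on k S (\<lambda>x. \<Sum>i\<in>I. f i x)"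
  using assms(2)
  by (induction I rule: infinite_finite_induct) (auto intro: Ck_on_const Ck_on_add assms(1))

lemma Ck_on_bounded_bilinear:
  assumes "open S" "bounded_bilinear B" "Ck_on k S f" "Ck_on k S g"
  shows "Ck_on k S (\<lambda>x. B (f x) (g x))"
  using assms(3,4)
proof (induction k arbitrary: f g)
  case 0
  then show ?case using bounded_bilinear.continuous_on[OF assms(2)] by auto
next
  case (Suc k)
  show ?case
  proof (rule Ck_on_SucI[OF assms(1)])
    show "((\<lambda>x. B (f x) (g x)) has_derivative
       (\<lambda>v. B (f x) (frechet_derivative g (at x) v) + B (frechet_derivative f (at x) v) (g x))) (at x)"
      if "x \<in> S" for x
      using bounded_bilinear.FDERIV[OF assms(2) Ck_on_SucD[OF Suc.prems(1) that] Ck_on_SucD[OF Suc.prems(2) that]] .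
    show "Ck_on k S (\<lambda>x. B (f x) (frechet_derivative g (at x) v) + B (frechet_derivative f (at x) v) (g x))" for v
      by (intro Ck_on_add[OF assms(1)] Suc.IH)
        (use Suc.prems Ck_on_Suc_imp[OF Suc.prems(1)] Ck_on_Suc_imp[OF Suc.prems(2)] in auto)
  qed
qed

lemma frechet_derivative_basis_expansion:
  fixes f :: "'a::euclidean_space \<Rightarrow> 'b::real_normed_vector"
  assumes "f differentiable (at x)"
  shows "frechet_derivative f (at x) v = (\<Sum>b\<in>Basis. (v \<bullet> b) *\<^sub>R frechet_derivative f (at x) b)"
proof -
  interpret linear "frechet_derivative f (at x)" by (rule linear_frechet_derivative[OF assms])
  show ?thesis by (metis (no_types, lifting) euclidean_representation scale sum sum.cong)
qed

text \<open>In the chain rule the direction in which \<open>g\<close> is differentiated moves with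
  the point. Expanding it in an orthonormal basis gives a sum of products of components of the
  derivative of \<open>f\<close> with partial derivatives of \<open>g\<close> composed with
  \<open>f\<close>, to which the induction over \<open>g\<close> applies.\<close>

lemma Ck_on_compose:
  fixes f :: "'a::real_normed_vector \<Rightarrow> 'b::euclidean_space" and g :: "'b \<Rightarrow> 'c::real_normed_vector"
  assumes "open S" "open T" "Ck_on k S f" "Ck_on k T g" "f ` S \<subseteq> T"
  shows "Ck_on k S (\<lambda>x. g (f x))"
  using assms(3,4)
proof (induction k arbitrary: g)
  case 0
  then show ?case using assms(5) by (auto intro: continuous_on_compose2)
next
  case (Suc k)
  have dg: "g differentiable (at (f x))" if "x \<in> S" for x using that Suc.prems assms(5) by auto
  show ?case
  proof (rule Ck_on_SucI[OF assms(1)])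
    show "((\<lambda>x. g (f x)) has_derivative (\<lambda>v. frechet_derivative g (at (f x)) (frechet_derivative f (at x) v))) (at x)"
      if "x \<in> S" for x
      using has_derivative_compose[OF Ck_on_SucD[OF Suc.prems(1) that]] dg[OF that] frechet_derivative_works by blast
    show "Ck_on k S (\<lambda>x. frechet_derivative g (at (f x)) (frechet_derivative f (at x) v))" for v
    proof (rule Ck_on_cong[OF assms(1)])
      show "(\<Sum>b\<in>Basis. (frechet_derivative f (at x) v \<bullet> b) *\<^sub>R frechet_derivative g (at (f x)) b)
        = frechet_derivative g (at (f x)) (frechet_derivative f (at x) v)" if "x \<in> S" for x
        using frechet_derivative_basis_expansion[OF dg[OF that]] by metis
      show "Ck_on k S (\<lambda>x. \<Sum>b\<in>Basis. (frechet_derivative f (at x) v \<bullet> b) *\<^sub>R frechet_derivative g (at (f x)) b)"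
        by (intro Ck_on_sum[OF assms(1)] Ck_on_bounded_bilinear[OF assms(1) bounded_bilinear_scaleR]
             Ck_on_bounded_linear_comp[OF assms(1) bounded_linear_inner_left] Suc.IH)
          (use Suc.prems Ck_on_Suc_imp[OF Suc.prems(1)] in auto)
    qed
  qed
qed

section \<open>Closure rules for smooth maps\<close>

lemma smooth_on_subset: "smooth_on S f \<Longrightarrow> T \<subseteq> S \<Longrightarrow> smooth_on T f"
  unfolding smooth_on_def using Ck_on_subset by blast

lemma smooth_on_cong: "open S \<Longrightarrow> (\<And>x. x \<in> S \<Longrightarrow> f x = g x) \<Longrightarrow> smooth_on S f \<Longrightarrow> smooth_on S g"
  unfolding smooth_on_def using Ck_on_cong by blast

lemma smooth_on_local:
  "(\<And>x. x \<in> S \<Longrightarrow> \<exists>T. open T \<and> x \<in> T \<and> smooth_on T f) \<Longrightarrow> smooth_on S f"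
  unfolding smooth_on_def by (meson Ck_on_local)

lemma smooth_on_ident: "open S \<Longrightarrow> smooth_on S (\<lambda>x. x)"
  unfolding smooth_on_def using Ck_on_ident by blast

lemma smooth_on_const: "open S \<Longrightarrow> smooth_on S (\<lambda>x. c)"
  unfolding smooth_on_def using Ck_on_const by blast

lemma smooth_on_add: "open S \<Longrightarrow> smooth_on S f \<Longrightarrow> smooth_on S g \<Longrightarrow> smooth_on S (\<lambda>x. f x + g x)"
  unfolding smooth_on_def using Ck_on_add by blast

lemma smooth_on_bounded_linear_comp:
  "open S \<Longrightarrow> bounded_linear L \<Longrightarrow> smooth_on S f \<Longrightarrow> smooth_on S (\<lambda>x. L (f x))"
  unfolding smooth_on_def using Ck_on_bounded_linear_comp by blast

lemma smooth_on_bounded_linear: "open S \<Longrightarrow> bounded_linear L \<Longrightarrow> smooth_on S L"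
  unfolding smooth_on_def using Ck_on_bounded_linear by blast

lemma smooth_on_diff:
  "open S \<Longrightarrow> smooth_on S f \<Longrightarrow> smooth_on S g \<Longrightarrow> smooth_on S (\<lambda>x. f x - g x)"
  using smooth_on_add[of S f "\<lambda>x. - g x"]
    smooth_on_bounded_linear_comp[OF _ bounded_linear_minus[OF bounded_linear_ident], of S g] by simp

lemma smooth_on_sum:
  "open S \<Longrightarrow> (\<And>i. i \<in> I \<Longrightarrow> smooth_on S (f i)) \<Longrightarrow> smooth_on S (\<lambda>x. \<Sum>i\<in>I. f i x)"
  unfolding smooth_on_def by (simp add: Ck_on_sum)

lemma smooth_on_bounded_bilinear:
  "open S \<Longrightarrow> bounded_bilinear B \<Longrightarrow> smooth_on S f \<Longrightarrow> smooth_on S g \<Longrightarrow> smooth_on S (\<lambda>x. B (f x) (g x))"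
  unfolding smooth_on_def by (simp add: Ck_on_bounded_bilinear)

lemma smooth_on_compose:
  fixes f :: "'a::real_normed_vector \<Rightarrow> 'b::euclidean_space" and g :: "'b \<Rightarrow> 'c::real_normed_vector"
  shows "open S \<Longrightarrow> open T \<Longrightarrow> smooth_on S f \<Longrightarrow> smooth_on T g \<Longrightarrow> f ` S \<subseteq> T \<Longrightarrow> smooth_on S (\<lambda>x. g (f x))"
  unfolding smooth_on_def using Ck_on_compose by blast

lemma smooth_on_has_derivative:
  "smooth_on S f \<Longrightarrow> x \<in> S \<Longrightarrow> (f has_derivative frechet_derivative f (at x)) (at x)"
  unfolding smooth_on_def using Ck_on_SucD by blast

lemma smooth_on_differentiable: "smooth_on S f \<Longrightarrow> x \<in> S \<Longrightarrow> f differentiable (at x)"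
  using smooth_on_has_derivative differentiable_def by blast

lemma smooth_on_continuous_on: "smooth_on S f \<Longrightarrow> continuous_on S f"
  unfolding smooth_on_def by (metis Ck_on.simps(1))

lemma smooth_on_frechet_derivative:
  "smooth_on S f \<Longrightarrow> smooth_on S (\<lambda>x. frechet_derivative f (at x) v)"
  unfolding smooth_on_def by (metis Ck_on.simps(2))

lemma smooth_on_frechet_derivative_field:
  fixes f :: "'a::euclidean_space \<Rightarrow> 'b::real_normed_vector"
  assumes "open S" "smooth_on S f" "smooth_on S X"
  shows "smooth_on S (\<lambda>x. frechet_derivative f (at x) (X x))"
proof (rule smooth_on_cong[OF assms(1)])
  show "(\<Sum>b\<in>Basis. (X x \<bullet> b) *\<^sub>R frechet_derivative f (at x) b) = frechet_derivative f (at x) (X x)"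
    if "x \<in> S" for x
    using frechet_derivative_basis_expansion[OF smooth_on_differentiable[OF assms(2) that]] by metis
  show "smooth_on S (\<lambda>x. \<Sum>b\<in>Basis. (X x \<bullet> b) *\<^sub>R frechet_derivative f (at x) b)"
    by (intro smooth_on_sum assms smooth_on_bounded_bilinear[OF _ bounded_bilinear_scaleR]
        smooth_on_bounded_linear_comp[OF _ bounded_linear_inner_left] smooth_on_frechet_derivative)
qed

text \<open>Second differences over small parallelograms compute both mixed derivatives.\<close>

lemma add_mem_ball_iff: "x + w \<in> ball x e \<longleftrightarrow> norm w < e" for x w :: "'a::real_normed_vector"
  by (simp add: dist_norm)

lemma second_difference:
  fixes f :: "'a::real_normed_vector \<Rightarrow> real"
  assumes S: "open S" "ball x e \<subseteq> S" and f: "Ck_on (Suc (Suc 0)) S f"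
    and t: "0 < t" "t * (norm u + norm v) < e"
  shows "\<exists>\<xi>. norm (\<xi> - x) \<le> t * (norm u + norm v) \<and>
     f (x + t *\<^sub>R u + t *\<^sub>R v) - f (x + t *\<^sub>R u) - f (x + t *\<^sub>R v) + f x =
       t * t * frechet_derivative (\<lambda>w. frechet_derivative f (at w) u) (at \<xi>) v"
proof -
  have inS: "x + r *\<^sub>R u + s *\<^sub>R v \<in> S" if "0 \<le> r" "r \<le> t" "0 \<le> s" "s \<le> t" for r s
  proof -
    have "norm (r *\<^sub>R u + s *\<^sub>R v) \<le> r * norm u + s * norm v"
      using that by (metis abs_of_nonneg norm_scaleR norm_triangle_ineq)
    also have "\<dots> \<le> t * (norm u + norm v)"
      using that by (simp add: distrib_left add_mono mult_right_mono)
    also have "\<dots> < e" by (rule t(2))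
    finally have "x + (r *\<^sub>R u + s *\<^sub>R v) \<in> ball x e" by (simp only: add_mem_ball_iff)
    then show ?thesis using S(2) by (auto simp: add.assoc)
  qed
  \<comment> \<open>\<open>g\<close> is the increment of \<open>f\<close> along \<open>t v\<close>
    as a function of the displacement \<open>r u\<close>. The mean value theorem in \<open>r\<close>
    yields a difference of derivatives in direction \<open>u\<close>; a second application to that
    difference, in the displacement \<open>s v\<close>, yields the mixed derivative at one
    point.\<close>
  define g where "g r = f (x + r *\<^sub>R u + t *\<^sub>R v) - f (x + r *\<^sub>R u)" for r
  define g' where "g' r = (\<lambda>h::real. frechet_derivative f (at (x + r *\<^sub>R u + t *\<^sub>R v)) (h *\<^sub>R u)
       - frechet_derivative f (at (x + r *\<^sub>R u)) (h *\<^sub>R u))" for r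
  have fd: "(f has_derivative frechet_derivative f (at w)) (at w)" if "w \<in> S" for w
    using Ck_on_SucD[OF f that] .
  have "(g has_derivative g' r) (at r within {0..t})" if "0 \<le> r" "r \<le> t" for r
    unfolding g_def g'_def
    by (rule has_derivative_diff; rule has_derivative_compose[OF _ fd];
        (use inS[of r t] inS[of r 0] that t in simp)?) (auto intro!: derivative_eq_intros)
  from mvt_simple[OF t(1) this] obtain r where r: "0 < r" "r < t" "g t - g 0 = g' r t" by auto
  define k where "k s = frechet_derivative f (at (x + r *\<^sub>R u + s *\<^sub>R v)) u" for s
  define f2 where "f2 w = frechet_derivative (\<lambda>w. frechet_derivative f (at w) u) (at w)" for w
  have f2: "((\<lambda>w. frechet_derivative f (at w) u) has_derivative f2 w) (at w)" if "w \<in> S" for w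
    unfolding f2_def by (rule Ck_on_SucD[of 0, OF _ that]) (use f in auto)
  have "(k has_derivative (\<lambda>h. f2 (x + r *\<^sub>R u + s *\<^sub>R v) (h *\<^sub>R v))) (at s within {0..t})"
    if "0 \<le> s" "s \<le> t" for s
    unfolding k_def
    by (rule has_derivative_compose[OF _ f2]; (use inS[of r s] that t r in simp)?)
      (auto intro!: derivative_eq_intros)
  from mvt_simple[OF t(1) this] obtain s where
    s: "0 < s" "s < t" "k t - k 0 = f2 (x + r *\<^sub>R u + s *\<^sub>R v) (t *\<^sub>R v)" by auto
  define \<xi> where "\<xi> = x + r *\<^sub>R u + s *\<^sub>R v"
  have lin1: "linear (frechet_derivative f (at w))" if "w \<in> S" for w
    using fd[OF that] has_derivative_linear by blast
  have lin2: "linear (f2 w)" if "w \<in> S" for w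
    using f2[OF that] has_derivative_linear by blast
  have "g' r t = t * (k t - k 0)"
    using linear_scale[OF lin1] inS[of r t] inS[of r 0] r t
    by (simp add: g'_def k_def right_diff_distrib)
  then have "g t - g 0 = t * t * f2 \<xi> v"
    using r s linear_scale[OF lin2[OF inS[of r s]]] by (simp add: \<xi>_def)
  moreover have "norm (\<xi> - x) \<le> t * (norm u + norm v)"
  proof -
    have "norm (\<xi> - x) \<le> r * norm u + s * norm v"
      using r s norm_triangle_ineq[of "r *\<^sub>R u" "s *\<^sub>R v"] by (simp add: \<xi>_def)
    also have "\<dots> \<le> t * (norm u + norm v)"
      using r s by (simp add: distrib_left add_mono mult_right_mono)
    finally show ?thesis .
  qed
  ultimately show ?thesis unfolding g_def f2_def by (intro exI[of _ \<xi>]) (simp add: add_ac)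
qed

lemma symmetric_second_derivative_real:
  fixes f :: "'a::real_normed_vector \<Rightarrow> real"
  assumes S: "open S" "x \<in> S" and f: "Ck_on (Suc (Suc 0)) S f"
  shows "frechet_derivative (\<lambda>w. frechet_derivative f (at w) u) (at x) v =
         frechet_derivative (\<lambda>w. frechet_derivative f (at w) v) (at x) u" (is "?l x = ?r x")
proof (rule ccontr)
  assume ne: "?l x \<noteq> ?r x"
  obtain e where e: "e > 0" "ball x e \<subseteq> S" using S openE by blast
  have cl: "continuous (at x) ?l" and cr: "continuous (at x) ?r"
    using f S by (auto simp: continuous_on_eq_continuous_at)
  \<comment> \<open>Half of the supposed gap. Near \<open>x\<close> each mixed derivative stays
    within \<open>d\<close> of its value at \<open>x\<close>, while the second difference, being
    symmetric in \<open>u\<close> and \<open>v\<close>, forces \<open>?l\<close> at one nearby point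
    to equal \<open>?r\<close> at another.\<close>
  define d where "d = \<bar>?l x - ?r x\<bar> / 2"
  have d: "d > 0" using ne by (simp add: d_def)
  obtain e1 where e1: "e1 > 0" "\<And>y. norm (y - x) < e1 \<Longrightarrow> \<bar>?l y - ?l x\<bar> < d"
    using cl d unfolding continuous_at_eps_delta by (metis dist_norm real_norm_def)
  obtain e2 where e2: "e2 > 0" "\<And>y. norm (y - x) < e2 \<Longrightarrow> \<bar>?r y - ?r x\<bar> < d"
    using cr d unfolding continuous_at_eps_delta by (metis dist_norm real_norm_def)
  define a where "a = Min {e, e1, e2}"
  have a: "a > 0" "a \<le> e" "a \<le> e1" "a \<le> e2" using e e1 e2 by (auto simp: a_def)
  define t where "t = a / (2 * (norm u + norm v + 1))"
  have p: "norm u + norm v + 1 > 0" by (smt (verit) norm_ge_zero)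
  have t0: "t > 0" using a p by (simp add: t_def)
  have "t * (norm u + norm v) < t * (2 * (norm u + norm v + 1))"
    using t0 p by (intro mult_strict_left_mono) auto
  also have "\<dots> = a" using p by (simp add: t_def)
  finally have ta: "t * (norm u + norm v) < a" .
  obtain \<xi> where \<xi>: "norm (\<xi> - x) < a"
    "f (x + t *\<^sub>R u + t *\<^sub>R v) - f (x + t *\<^sub>R u) - f (x + t *\<^sub>R v) + f x = t * t * ?l \<xi>"
    using second_difference[OF S(1) e(2) f t0 less_le_trans[OF ta a(2)]] ta le_less_trans by blast
  obtain \<eta> where \<eta>: "norm (\<eta> - x) < a"
    "f (x + t *\<^sub>R v + t *\<^sub>R u) - f (x + t *\<^sub>R v) - f (x + t *\<^sub>R u) + f x = t * t * ?r \<eta>"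
    using second_difference[OF S(1) e(2) f t0, of v u] less_le_trans[OF ta a(2)] ta le_less_trans
    unfolding add.commute[of "norm v"] by blast
  have "t * t * ?l \<xi> = t * t * ?r \<eta>" using \<xi>(2) \<eta>(2) by (simp add: algebra_simps)
  then have "?l \<xi> = ?r \<eta>" using t0 by simp
  moreover have "\<bar>?l \<xi> - ?l x\<bar> < d" using e1(2) \<xi>(1) a by auto
  moreover have "\<bar>?r \<eta> - ?r x\<bar> < d" using e2(2) \<eta>(1) a by auto
  ultimately show False unfolding d_def by (simp add: abs_if split: if_splits)
qed

lemma frechet_derivative_inner:
  fixes f :: "'a::real_normed_vector \<Rightarrow> 'b::euclidean_space"
  assumes "f differentiable (at x)"
  shows "frechet_derivative (\<lambda>w. f w \<bullet> b) (at x) v = frechet_derivative f (at x) v \<bullet> b"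
proof -
  have "((\<lambda>w. f w \<bullet> b) has_derivative (\<lambda>v. frechet_derivative f (at x) v \<bullet> b)) (at x)"
    using assms by (intro has_derivative_inner_left) (simp add: frechet_derivative_works)
  then show ?thesis using frechet_derivative_at by metis
qed

lemma symmetric_second_derivative:
  fixes f :: "'a::real_normed_vector \<Rightarrow> 'b::euclidean_space"
  assumes S: "open S" "x \<in> S" and f: "smooth_on S f"
  shows "frechet_derivative (\<lambda>w. frechet_derivative f (at w) u) (at x) v =
         frechet_derivative (\<lambda>w. frechet_derivative f (at w) v) (at x) u"
proof (rule euclidean_eqI)
  fix b :: 'b assume "b \<in> Basis"
  have g: "smooth_on S (\<lambda>w. f w \<bullet> b)"
    by (intro smooth_on_bounded_linear_comp[OF S(1) bounded_linear_inner_left f])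
  have *: "frechet_derivative (\<lambda>w. frechet_derivative (\<lambda>w. f w \<bullet> b) (at w) u) (at x) v =
      frechet_derivative (\<lambda>w. frechet_derivative f (at w) u) (at x) v \<bullet> b" for u v
  proof -
    have "frechet_derivative (\<lambda>w. frechet_derivative (\<lambda>w. f w \<bullet> b) (at w) u) (at x) =
        frechet_derivative (\<lambda>w. frechet_derivative f (at w) u \<bullet> b) (at x)"
      by (rule frechet_derivative_transform_within_open[OF _ S])
        (auto intro!: smooth_on_differentiable[OF smooth_on_frechet_derivative[OF g] S(2)]
           frechet_derivative_inner smooth_on_differentiable[OF f])
    then show ?thesis
      using frechet_derivative_inner[OF smooth_on_differentiable[OF smooth_on_frechet_derivative[OF f] S(2)]]
      by metis
  qed
  show "frechet_derivative (\<lambda>w. frechet_derivative f (at w) u) (at x) v \<bullet> b =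
    frechet_derivative (\<lambda>w. frechet_derivative f (at w) v) (at x) u \<bullet> b"
    using symmetric_second_derivative_real[OF S, of "\<lambda>w. f w \<bullet> b" u v] g
    unfolding * smooth_on_def by blast
qed

section \<open>Operator norms and Lipschitz constants\<close>

lemma onorm_le_sum_Basis:
  fixes L :: "'a::euclidean_space \<Rightarrow> 'b::real_normed_vector"
  assumes "linear L"
  shows "onorm L \<le> (\<Sum>b\<in>Basis. norm (L b))"
proof (rule onorm_le)
  fix x
  have "L x = (\<Sum>b\<in>Basis. (x \<bullet> b) *\<^sub>R L b)"
    by (metis (no_types, lifting) assms euclidean_representation linear_scale linear_sum sum.cong)
  then have "norm (L x) \<le> (\<Sum>b\<in>Basis. \<bar>x \<bullet> b\<bar> * norm (L b))"
    by (simp add: order_trans[OF norm_sum])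
  also have "\<dots> \<le> (\<Sum>b\<in>Basis. norm x * norm (L b))"
    by (intro sum_mono mult_right_mono) (auto simp: Basis_le_norm)
  finally show "norm (L x) \<le> (\<Sum>b\<in>Basis. norm (L b)) * norm x"
    by (simp add: sum_distrib_left mult.commute)
qed

text \<open>The sum of the norms of the partial derivatives is continuous and dominates the operator
  norm, so compactness bounds it, and convexity permits the mean value inequality.\<close>

lemma Ck_on_Lipschitz:
  fixes f :: "'a::euclidean_space \<Rightarrow> 'b::real_normed_vector"
  assumes "Ck_on (Suc 0) S f" "compact T" "convex T" "T \<subseteq> S"
  obtains C where "C \<ge> 0" "\<And>x y. x \<in> T \<Longrightarrow> y \<in> T \<Longrightarrow> norm (f x - f y) \<le> C * norm (x - y)"
proof -
  define g where "g x = (\<Sum>b\<in>Basis. norm (frechet_derivative f (at x) b))" for x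
  have "continuous_on T g" unfolding g_def using assms
    by (intro continuous_intros) (auto intro: continuous_on_subset)
  then have "bounded (g ` T)" using assms(2) compact_continuous_image compact_imp_bounded by blast
  then obtain C where C: "C > 0" "\<And>x. x \<in> T \<Longrightarrow> g x \<le> C"
    unfolding bounded_pos by (metis image_eqI real_norm_def abs_le_D1)
  have "norm (f x - f y) \<le> C * norm (x - y)" if "x \<in> T" "y \<in> T" for x y
  proof (rule differentiable_bound[OF assms(3) _ _ that])
    fix z assume z: "z \<in> T"
    have d: "(f has_derivative frechet_derivative f (at z)) (at z)"
      using Ck_on_SucD[OF assms(1)] z assms(4) by blast
    then show "(f has_derivative frechet_derivative f (at z)) (at z within T)"
      using has_derivative_at_withinI by blast
    show "onorm (frechet_derivative f (at z)) \<le> C"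
      using onorm_le_sum_Basis[OF has_derivative_linear[OF d]] C(2)[OF z] by (simp add: g_def)
  qed
  then show thesis using that C(1) by (metis less_imp_le)
qed

section \<open>Ordinary differential equations with a small Lipschitz constant\<close>

text \<open>At a point \<open>s\<close> where the norm of \<open>r\<close> is largest, the mean
  value inequality over an interval of length at most 1 reads
  \<open>norm (r s) \<le> norm (r 0) + norm (r s) / 2 + c\<close>, and half of the left side absorbs
  the middle term on the right.\<close>

lemma small_gronwall:
  fixes r :: "real \<Rightarrow> 'a::real_normed_vector"
  assumes d: "\<And>t. t \<in> {0..1} \<Longrightarrow> (r has_vector_derivative r' t) (at t within {0..1})"
    and b: "\<And>t. t \<in> {0..1} \<Longrightarrow> norm (r' t) \<le> norm (r t) / 2 + c"
    and t: "t \<in> {0..1}"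
  shows "norm (r t) \<le> 2 * (norm (r 0) + c)"
proof -
  have "continuous_on {0..1} (\<lambda>t. norm (r t))"
    using d by (intro continuous_on_norm continuous_on_vector_derivative)
  then obtain s where s: "s \<in> {0..1}" "\<And>t. t \<in> {0..1} \<Longrightarrow> norm (r t) \<le> norm (r s)"
    using continuous_attains_sup[of "{0..1::real}" "\<lambda>t. norm (r t)"] by auto
  define B where "B = norm (r s) / 2 + c"
  have "norm (r' 0) \<le> B" using b[of 0] s(2)[of 0] by (auto simp: B_def)
  then have B: "B \<ge> 0" using norm_ge_zero order_trans by blast
  have "norm (r s - r 0) \<le> B * norm (s - 0)"
  proof (rule differentiable_bound[of "{0..1}" r "\<lambda>t h. h *\<^sub>R r' t"])
    fix x :: real assume x: "x \<in> {0..1}"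
    show "(r has_derivative (\<lambda>h. h *\<^sub>R r' x)) (at x within {0..1})"
      using d[OF x] by (simp add: has_vector_derivative_def)
    have "norm (r' x) \<le> B" using b[OF x] s(2)[OF x] by (simp add: B_def)
    then show "onorm (\<lambda>h. h *\<^sub>R r' x) \<le> B"
      by (intro onorm_le) (simp add: mult.commute[of B] mult_left_mono)
  qed (use s in auto)
  also have "\<dots> \<le> B" using s(1) B by (simp add: mult_left_le)
  finally have "norm (r s) \<le> norm (r 0) + B"
    using norm_triangle_sub[of "r s" "r 0"] by simp
  then show ?thesis using s(2)[OF t] by (simp add: B_def)
qed

text \<open>With Lipschitz constant 1/2 the integral operator contracts the sup norm over the unit
  interval by the factor 1/2, so a single application of the fixed point theorem reaches time
  1.\<close>

lemma picard:
  fixes f :: "'a::euclidean_space \<Rightarrow> 'a"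
  assumes lip: "\<And>x y. norm (f x - f y) \<le> norm (x - y) / 2"
  shows "\<exists>z. z 0 = a \<and> (\<forall>t\<in>{0..1}. (z has_vector_derivative f (z t)) (at t within {0..1}))"
proof -
  have cf: "continuous_on S f" for S
  proof (rule continuous_on_subset[OF _ subset_UNIV], unfold continuous_on_iff, intro ballI allI impI)
    fix x :: 'a and e :: real assume "e > 0"
    then show "\<exists>d>0. \<forall>x'\<in>UNIV. dist x' x < d \<longrightarrow> dist (f x') (f x) < e"
      using lip by (intro exI[of _ e]) (smt (verit) dist_norm norm_ge_zero field_sum_of_halves)
  qed
  \<comment> \<open>Clamping time to the unit interval lets the operator act on bounded continuous
    functions on the whole line, a complete metric space; its fixed point solves the equation on
    \<open>{0..1}\<close>.\<close>
  define cl where "cl t = max 0 (min 1 t)" for t :: real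
  have cl: "cl t \<in> {0..1}" "t \<in> {0..1} \<Longrightarrow> cl t = t" for t by (auto simp: cl_def)
  define T0 where "T0 z t = a + integral {0..cl t} (\<lambda>s. f (apply_bcontfun z s))" for z t
  define T where "T z = Bcontfun (T0 z)" for z
  have cfz: "continuous_on S (\<lambda>s. f (apply_bcontfun z s))" for S z
    by (rule continuous_on_compose2[OF cf[of UNIV]]) auto
  have ci: "continuous_on {0..1} (\<lambda>u. integral {0..u} (\<lambda>s. f (apply_bcontfun z s)))"
    for z :: "real \<Rightarrow>\<^sub>C 'a"
    using indefinite_integral_continuous_1[OF integrable_continuous_real[OF cfz]] by blast
  have T: "apply_bcontfun (T z) = T0 z" for z
  proof -
    have ct: "continuous_on UNIV (T0 z)"
      unfolding T0_def
      by (intro continuous_on_add continuous_on_const continuous_on_compose2[OF ci])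
         (use cl in \<open>auto simp: cl_def intro!: continuous_intros\<close>)
    have "bounded ((\<lambda>u. integral {0..u} (\<lambda>s. f (apply_bcontfun z s))) ` {0..1})"
      using ci compact_continuous_image compact_imp_bounded compact_Icc by blast
    then obtain B where B: "\<And>u. u \<in> {0..1} \<Longrightarrow> norm (integral {0..u} (\<lambda>s. f (apply_bcontfun z s))) \<le> B"
      unfolding bounded_iff by (metis imageI)
    have "norm (T0 z t) \<le> norm a + B" for t
      using B[OF cl(1)[of t]] unfolding T0_def by (metis add_left_mono norm_triangle_mono order_refl)
    then have "T0 z \<in> bcontfun" using ct bcontfun_normI by blast
    then show ?thesis by (simp add: T_def Bcontfun_inverse)
  qed
  have "dist (T z) (T w) \<le> 1/2 * dist z w" for z w
  proof (rule dist_bound)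
    fix t
    have "T0 z t - T0 w t = integral {0..cl t} (\<lambda>s. f (apply_bcontfun z s) - f (apply_bcontfun w s))"
      unfolding T0_def by (simp add: integral_diff integrable_continuous_real cfz)
    moreover have "norm \<dots> \<le> (dist z w / 2) * (cl t - 0)"
    proof (rule integral_bound)
      show "norm (f (apply_bcontfun z s) - f (apply_bcontfun w s)) \<le> dist z w / 2" for s
        using lip[of "apply_bcontfun z s" "apply_bcontfun w s"] dist_bounded[of z s w]
        by (simp add: dist_norm)
    qed (use cl in \<open>auto intro!: continuous_on_diff cfz\<close>)
    moreover have "(dist z w / 2) * (cl t - 0) \<le> 1/2 * dist z w"
      using cl(1)[of t] by (simp add: mult_left_le)
    ultimately show "dist (apply_bcontfun (T z) t) (apply_bcontfun (T w) t) \<le> 1/2 * dist z w"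
      by (simp add: T dist_norm)
  qed
  then obtain z where z: "T z = z"
    using banach_fix_type[of "1/2" T] by auto
  have zt: "apply_bcontfun z t = T0 z t" for t by (metis T z)
  have "(apply_bcontfun z has_vector_derivative f (apply_bcontfun z t)) (at t within {0..1})"
    if t: "t \<in> {0..1}" for t
  proof (rule has_vector_derivative_transform[OF t])
    show "apply_bcontfun z s = a + integral {0..s} (\<lambda>s. f (apply_bcontfun z s))" if "s \<in> {0..1}" for s
      using zt[of s] cl(2)[OF that] by (simp add: T0_def)
    show "((\<lambda>s. a + integral {0..s} (\<lambda>s. f (apply_bcontfun z s))) has_vector_derivative
        f (apply_bcontfun z t)) (at t within {0..1})"
      using has_vector_derivative_add[OF has_vector_derivative_const integral_has_vector_derivative[OF cfz t]]
      by simp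
  qed
  moreover have "apply_bcontfun z 0 = a" using zt[of 0] by (simp add: T0_def cl_def)
  ultimately show ?thesis by blast
qed

lemma has_derivative_at_quadratic:
  fixes f :: "'a::real_normed_vector \<Rightarrow> 'b::real_normed_vector"
  assumes "bounded_linear f'" "\<delta> > 0" "C \<ge> 0"
    and "\<And>e. norm e < \<delta> \<Longrightarrow> norm (f (x + e) - f x - f' e) \<le> C * (norm e)\<^sup>2"
  shows "(f has_derivative f') (at x)"
  unfolding has_derivative_at_alt
proof (intro conjI assms(1) allI impI)
  fix \<epsilon> :: real assume \<epsilon>: "\<epsilon> > 0"
  \<comment> \<open>The remainder is at most \<open>(C * norm (y - x)) * norm (y - x)\<close>, and
    the first factor has to fall below \<open>\<epsilon>\<close>; dividing by \<open>C + 1\<close>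
    covers the case \<open>C = 0\<close>.\<close>
  define \<rho> where "\<rho> = min \<delta> (\<epsilon> / (C + 1))"
  have \<rho>: "\<rho> > 0" using assms \<epsilon> by (simp add: \<rho>_def)
  show "\<exists>d>0. \<forall>y. norm (y - x) < d \<longrightarrow> norm (f y - f x - f' (y - x)) \<le> \<epsilon> * norm (y - x)"
  proof (intro exI[of _ \<rho>] conjI \<rho> allI impI)
    fix y assume y: "norm (y - x) < \<rho>"
    have "norm (f y - f x - f' (y - x)) \<le> C * (norm (y - x))\<^sup>2"
      using assms(4)[of "y - x"] y by (simp add: \<rho>_def)
    also have "\<dots> = (C * norm (y - x)) * norm (y - x)" by (simp add: power2_eq_square)
    also have "\<dots> \<le> \<epsilon> * norm (y - x)"
    proof (rule mult_right_mono)
      have "C * norm (y - x) \<le> (C + 1) * (\<epsilon> / (C + 1))"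
        using y assms(3) by (intro mult_mono) (auto simp: \<rho>_def)
      then show "C * norm (y - x) \<le> \<epsilon>" using assms(3) by simp
    qed auto
    finally show "norm (f y - f x - f' (y - x)) \<le> \<epsilon> * norm (y - x)" .
  qed
qed

section \<open>Integral manifolds of a commuting frame\<close>

text \<open>\<open>K\<close> bounds the frame, and the single constant \<open>L\<close> bounds its
  variation, its first derivatives and its quadratic Taylor remainder, always linearly in the
  parameter \<open>v\<close>. The assumption \<open>comm\<close> says that two fields of the frame
  have zero Lie bracket. Parameters range over the whole space, so distinct parameters may give the
  same field.\<close>

locale commuting_frame =
  fixes F :: "'e::euclidean_space \<Rightarrow> 'e \<Rightarrow> 'e" and S :: "'e set" and p0 :: 'e and R K L :: real
  assumes S: "open S" "cball p0 R \<subseteq> S" and pos: "R > 0" "K \<ge> 0" "L \<ge> 0"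
    and linF: "\<And>p. p \<in> S \<Longrightarrow> linear (F p)"
    and smoothF: "\<And>v. smooth_on S (\<lambda>p. F p v)"
    and boundF: "\<And>p v. p \<in> cball p0 R \<Longrightarrow> norm (F p v) \<le> K * norm v"
    and lipF: "\<And>p q v. p \<in> cball p0 R \<Longrightarrow> q \<in> cball p0 R \<Longrightarrow>
        norm (F p v - F q v) \<le> L * norm (p - q) * norm v"
    and quadF: "\<And>p q v. p \<in> cball p0 R \<Longrightarrow> q \<in> cball p0 R \<Longrightarrow>
        norm (F q v - F p v - frechet_derivative (\<lambda>p. F p v) (at p) (q - p)) \<le> L * (norm (q - p))\<^sup>2 * norm v"
    and boundF': "\<And>p v w. p \<in> cball p0 R \<Longrightarrow>
        norm (frechet_derivative (\<lambda>p. F p v) (at p) w) \<le> L * norm w * norm v"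
    and comm: "\<And>p v w. p \<in> cball p0 R \<Longrightarrow>
       frechet_derivative (\<lambda>p. F p w) (at p) (F p v) = frechet_derivative (\<lambda>p. F p v) (at p) (F p w)"
begin

text \<open>The first condition makes the field with parameter \<open>d\<close> Lipschitz with
  constant 1/2, the second keeps a curve of speed at most \<open>K * norm d\<close> inside the
  closed ball up to time 1.\<close>

definition admissible :: "'e \<Rightarrow> 'e \<Rightarrow> bool" where
  "admissible a d \<longleftrightarrow> L * norm d \<le> 1/2 \<and> norm (a - p0) + K * norm d \<le> R"

text \<open>An arbitrary solution is selected; that it is the only one follows from
  \<open>solutions_close\<close> with equal data.\<close>

definition sol :: "'e \<Rightarrow> 'e \<Rightarrow> real \<Rightarrow> 'e" where
  "sol a d = (SOME z. z 0 = a \<and> (\<forall>t\<in>{0..1}. z t \<in> cball p0 R \<and>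
      norm (z t - a) \<le> K * norm d \<and>
      (z has_vector_derivative F (z t) d) (at t within {0..1})))"

definition plaque_map :: "'e \<Rightarrow> 'e \<Rightarrow> 'e" where "plaque_map a d = sol a d 1"

text \<open>Composition with the nearest-point retraction onto the ball, which does not increase
  distances, gives a field that is Lipschitz on the whole space. Its solution moves at speed at most
  \<open>K * norm d\<close>, so it never leaves the ball and solves the original equation.\<close>

lemma sol_exists:
  assumes "admissible a d"
  shows "\<exists>z. z 0 = a \<and> (\<forall>t\<in>{0..1}. z t \<in> cball p0 R \<and> norm (z t - a) \<le> K * norm d \<and>
      (z has_vector_derivative F (z t) d) (at t within {0..1}))"
proof -
  define cp where "cp = closest_point (cball p0 R)"
  have cb: "cp x \<in> cball p0 R" for x
    unfolding cp_def using pos by (intro closest_point_in_set) auto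
  have "norm (F (cp x) d - F (cp y) d) \<le> norm (x - y) / 2" for x y
  proof -
    have "norm (F (cp x) d - F (cp y) d) \<le> (L * norm d) * norm (cp x - cp y)"
      using lipF[OF cb[of x] cb[of y], of d] by (simp add: mult_ac)
    also have "\<dots> \<le> 1/2 * norm (cp x - cp y)"
      using assms by (intro mult_right_mono) (auto simp: admissible_def)
    also have "norm (cp x - cp y) \<le> norm (x - y)"
      using closest_point_lipschitz[of "cball p0 R" x y] pos by (simp add: cp_def dist_norm)
    finally show ?thesis by simp
  qed
  from picard[of "\<lambda>x. F (cp x) d", OF this, of a] obtain z where z: "z 0 = a"
    "\<And>t. t \<in> {0..1} \<Longrightarrow> (z has_vector_derivative F (cp (z t)) d) (at t within {0..1})" by auto
  have za: "norm (z t - a) \<le> K * norm d" if t: "t \<in> {0..1}" for t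
  proof -
    have "norm (z t - z 0) \<le> K * norm d * norm (t - 0)"
    proof (rule differentiable_bound[of "{0..1}" z "\<lambda>t h. h *\<^sub>R F (cp (z t)) d"])
      fix x :: real assume x: "x \<in> {0..1}"
      show "(z has_derivative (\<lambda>h. h *\<^sub>R F (cp (z x)) d)) (at x within {0..1})"
        using z(2)[OF x] by (simp add: has_vector_derivative_def)
      show "onorm (\<lambda>h. h *\<^sub>R F (cp (z x)) d) \<le> K * norm d"
        using boundF[OF cb[of "z x"], of d]
        by (intro onorm_le) (simp add: mult.commute[of "K * norm d"] mult_left_mono)
    qed (use t in auto)
    also have "\<dots> \<le> K * norm d" using t pos by (simp add: mult_left_le)
    finally show ?thesis using z by simp
  qed
  have zc: "z t \<in> cball p0 R" if "t \<in> {0..1}" for t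
  proof -
    have "norm (z t - p0) \<le> norm (z t - a) + norm (a - p0)"
      using norm_triangle_ineq[of "z t - a" "a - p0"] by simp
    then show ?thesis using za[OF that] assms by (simp add: admissible_def dist_norm norm_minus_commute)
  qed
  then have "cp (z t) = z t" if "t \<in> {0..1}" for t
    unfolding cp_def using that closest_point_self by blast
  then show ?thesis using z za zc by (intro exI[of _ z]) auto
qed

lemma sol:
  assumes "admissible a d"
  shows "sol a d 0 = a" "t \<in> {0..1} \<Longrightarrow> sol a d t \<in> cball p0 R"
    "t \<in> {0..1} \<Longrightarrow> norm (sol a d t - a) \<le> K * norm d"
    "t \<in> {0..1} \<Longrightarrow> (sol a d has_vector_derivative F (sol a d t) d) (at t within {0..1})"
  using someI_ex[OF sol_exists[OF assms]] unfolding sol_def[symmetric] by blast+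

lemma cball_S: "p \<in> cball p0 R \<Longrightarrow> p \<in> S" using S by auto

text \<open>The difference of the velocities splits into a change of point at the parameter
  \<open>d\<close>, of size at most half the distance, and a change of parameter at one point, which
  becomes the constant in \<open>small_gronwall\<close>. Uniqueness and Lipschitz dependence on
  initial point and parameter are instances.\<close>

lemma solutions_close:
  assumes "L * norm d \<le> 1/2"
    and z: "\<And>t. t \<in> {0..1} \<Longrightarrow> (z has_vector_derivative F (z t) d) (at t within {0..1})"
      "\<And>t. t \<in> {0..1} \<Longrightarrow> z t \<in> cball p0 R"
    and w: "\<And>t. t \<in> {0..1} \<Longrightarrow> (w has_vector_derivative F (w t) e) (at t within {0..1})"
      "\<And>t. t \<in> {0..1} \<Longrightarrow> w t \<in> cball p0 R"
    and t: "t \<in> {0..1}"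
  shows "norm (z t - w t) \<le> 2 * (norm (z 0 - w 0) + K * norm (d - e))"
proof (rule small_gronwall[OF _ _ t, of "\<lambda>t. z t - w t"])
  fix t :: real assume t: "t \<in> {0..1}"
  show "((\<lambda>t. z t - w t) has_vector_derivative F (z t) d - F (w t) e) (at t within {0..1})"
    using z w t by (intro has_vector_derivative_diff) auto
  have eq: "F (z t) d - F (w t) e = (F (z t) d - F (w t) d) + F (w t) (d - e)"
    using linear_diff[OF linF[OF cball_S[OF w(2)[OF t]]]] by simp
  have "norm (F (z t) d - F (w t) d) \<le> L * norm (z t - w t) * norm d"
    using lipF z w t by blast
  moreover have "L * norm (z t - w t) * norm d \<le> norm (z t - w t) / 2"
    using mult_right_mono[OF assms(1) norm_ge_zero[of "z t - w t"]] by (simp add: mult_ac)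
  ultimately show "norm (F (z t) d - F (w t) e) \<le> norm (z t - w t) / 2 + K * norm (d - e)"
    using boundF[OF w(2)[OF t], of "d - e"] norm_triangle_ineq[of "F (z t) d - F (w t) d" "F (w t) (d - e)"]
    unfolding eq by linarith
qed

lemma plaque_map_in_cball: "admissible a d \<Longrightarrow> plaque_map a d \<in> cball p0 R"
  and plaque_map_near: "admissible a d \<Longrightarrow> norm (plaque_map a d - a) \<le> K * norm d"
  using sol(2)[of a d 1] sol(3)[of a d 1] by (auto simp: plaque_map_def)

lemma plaque_map_0: "admissible a 0 \<Longrightarrow> plaque_map a 0 = a"
  using plaque_map_near[of a 0] by simp

lemma plaque_map_Lipschitz:
  assumes "admissible a d" "admissible b e"
  shows "norm (plaque_map a d - plaque_map b e) \<le> 2 * (norm (a - b) + K * norm (d - e))"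
  using solutions_close[of d "sol a d" "sol b e" e 1] assms sol[OF assms(1)] sol[OF assms(2)]
  by (auto simp: plaque_map_def admissible_def)

text \<open>The time-reversed curve solves the equation with parameter \<open>- d\<close>, and two
  solutions with the same initial point and parameter agree.\<close>

lemma plaque_map_reverse:
  assumes "admissible a d" "admissible (plaque_map a d) (- d)"
  shows "plaque_map (plaque_map a d) (- d) = a"
proof -
  define w where "w t = sol a d (1 - t)" for t
  have "(w has_vector_derivative F (w t) (- d)) (at t within {0..1})" if t: "t \<in> {0..1}" for t
  proof -
    have "((sol a d \<circ> (\<lambda>t. 1 - t)) has_vector_derivative (- 1) *\<^sub>R F (sol a d (1 - t)) d) (at t within {0..1})"
    proof (rule vector_diff_chain_within)
      show "((\<lambda>t::real. 1 - t) has_vector_derivative - 1) (at t within {0..1})"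
        by (auto intro!: derivative_eq_intros)
      have "(\<lambda>t::real. 1 - t) ` {0..1} \<subseteq> {0..1}" by auto
      then show "(sol a d has_vector_derivative F (sol a d (1 - t)) d) (at (1 - t) within (\<lambda>t. 1 - t) ` {0..1})"
        using sol(4)[OF assms(1), of "1 - t"] t has_vector_derivative_within_subset by auto
    qed
    moreover have "(- 1) *\<^sub>R F (sol a d (1 - t)) d = F (w t) (- d)"
      using linear_neg[OF linF[OF cball_S]] sol(2)[OF assms(1), of "1 - t"] t by (simp add: w_def)
    moreover have "sol a d \<circ> (\<lambda>t. 1 - t) = w" by (auto simp: w_def)
    ultimately show ?thesis by simp
  qed
  moreover have "w t \<in> cball p0 R" if "t \<in> {0..1}" for t
    using sol(2)[OF assms(1), of "1 - t"] that by (simp add: w_def)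
  moreover have "L * norm (- d) \<le> 1/2" using assms by (simp add: admissible_def)
  moreover have "w 0 = plaque_map a d" "w 1 = a"
    using sol(1)[OF assms(1)] by (auto simp: w_def plaque_map_def)
  ultimately show ?thesis
    using solutions_close[of "- d" w "sol (plaque_map a d) (- d)" "- d" 1] sol[OF assms(2)]
    by (auto simp: plaque_map_def)
qed

text \<open>\<open>Q\<close> changes at the constant rate \<open>q\<close> along the solution. Two
  cases matter: \<open>Q = P\<close>, where the rate is the \<open>P\<close>-part of the parameter,
  and the projection transversal to a subspace that contains all frame vectors, where the rate is
  zero.\<close>

lemma plaque_map_linear_invariant:
  fixes Q :: "'e \<Rightarrow> 'b::real_normed_vector"
  assumes "admissible a d" "linear Q" "\<And>p. p \<in> cball p0 R \<Longrightarrow> Q (F p d) = q"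
  shows "Q (plaque_map a d) = Q a + q"
proof -
  define r where "r t = Q (sol a d t) - Q a - t *\<^sub>R q" for t
  have bl: "bounded_linear Q" using assms(2) by (simp add: linear_conv_bounded_linear)
  have "norm (r 1) \<le> 2 * (norm (r 0) + 0)"
  proof (rule small_gronwall[where r' = "\<lambda>t. 0"])
    fix t :: real assume t: "t \<in> {0..1}"
    have "(r has_vector_derivative Q (F (sol a d t) d) - 0 - q) (at t within {0..1})"
      unfolding r_def
      by (intro has_vector_derivative_diff has_vector_derivative_const
          bounded_linear.has_vector_derivative[OF bl sol(4)[OF assms(1) t]])
         (auto intro!: derivative_eq_intros)
    then show "(r has_vector_derivative 0) (at t within {0..1})"
      using assms(3)[OF sol(2)[OF assms(1) t]] by simp
  qed auto
  then show ?thesis using sol(1)[OF assms(1)] by (simp add: r_def plaque_map_def diff_eq_eq add.commute)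
qed

text \<open>Commutativity makes \<open>t F(z(t)) e\<close> a first-order solution of the equation of variation.\<close>

lemma plaque_map_expansion:
  assumes d: "admissible a d" and de: "admissible a (d + e)"
  shows "norm (plaque_map a (d + e) - plaque_map a d - F (plaque_map a d) e)
    \<le> 2 * ((4 * L * K\<^sup>2 * norm d + 2 * L * K) * (norm e)\<^sup>2)"
proof -
  define z where "z = sol a d"
  define y where "y = sol a (d + e)"
  define DF where "DF p v w = frechet_derivative (\<lambda>p. F p w) (at p) v" for p v w
  note z = sol[OF d, folded z_def] and y = sol[OF de, folded y_def]
  have DF: "((\<lambda>p. F p w) has_derivative (\<lambda>v. DF p v w)) (at p)" if "p \<in> cball p0 R" for p w
    unfolding DF_def using smooth_on_has_derivative[OF smoothF cball_S[OF that]] .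
  have yz: "norm (y t - z t) \<le> 2 * K * norm e" if "t \<in> {0..1}" for t
    using solutions_close[of "d + e" y z d t] y z that de by (simp add: admissible_def)
  define c where "c = (4 * L * K\<^sup>2 * norm d + 2 * L * K) * (norm e)\<^sup>2"
  define r where "r t = y t - z t - t *\<^sub>R F (z t) e" for t
  define r' where "r' t = F (y t) (d + e) - F (z t) d - (t *\<^sub>R DF (z t) (F (z t) d) e + F (z t) e)" for t
  have "norm (r 1) \<le> 2 * (norm (r 0) + c)"
  proof (rule small_gronwall[where r' = r'])
    fix t :: real assume t: "t \<in> {0..1}"
    have zt: "z t \<in> cball p0 R" and yt: "y t \<in> cball p0 R" using z y t by auto
    interpret Fz: linear "F (z t)" by (rule linF[OF cball_S[OF zt]])
    interpret Fy: linear "F (y t)" by (rule linF[OF cball_S[OF yt]])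
    interpret D: linear "\<lambda>v. DF (z t) v d" by (rule has_derivative_linear[OF DF[OF zt]])
    interpret De: linear "\<lambda>v. DF (z t) v e" by (rule has_derivative_linear[OF DF[OF zt]])
    have "((\<lambda>t. F (z t) e) has_vector_derivative DF (z t) (F (z t) d) e) (at t within {0..1})"
      unfolding has_vector_derivative_def
      using has_derivative_compose[OF z(4)[OF t, unfolded has_vector_derivative_def] DF[OF zt, of e]]
      by (simp add: De.scale)
    then show "(r has_vector_derivative r' t) (at t within {0..1})"
      unfolding r_def r'_def
      by (intro has_vector_derivative_diff z y t)
        (auto intro!: derivative_eq_intros)
    \<comment> \<open>After the swap, \<open>t\<close> times this vector is the part by which
      \<open>DF (z t) (y t - z t) d\<close> differs from \<open>DF (z t) (r t) d\<close>. So the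
      derivative of \<open>r\<close> consists of a quadratic Taylor remainder, a term of size at
      most half of \<open>r\<close>, and a difference of second order in \<open>e\<close>.\<close>
    have swap: "DF (z t) (F (z t) d) e = DF (z t) (F (z t) e) d"
      using comm[OF zt] by (simp add: DF_def)
    have split: "r' t = (F (y t) d - F (z t) d - DF (z t) (y t - z t) d) + DF (z t) (r t) d + (F (y t) e - F (z t) e)"
      unfolding r'_def r_def swap by (simp add: Fy.add D.diff D.scale)
    have "norm (F (y t) d - F (z t) d - DF (z t) (y t - z t) d) \<le> L * (norm (y t - z t))\<^sup>2 * norm d"
      using quadF[OF zt yt] by (simp add: DF_def)
    also have "\<dots> \<le> L * (2 * K * norm e)\<^sup>2 * norm d"
      using yz[OF t] pos by (intro mult_right_mono mult_left_mono power_mono) auto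
    finally have 1: "norm (F (y t) d - F (z t) d - DF (z t) (y t - z t) d) \<le> L * (2 * K * norm e)\<^sup>2 * norm d" .
    have "norm (DF (z t) (r t) d) \<le> (L * norm d) * norm (r t)"
      using boundF'[OF zt, of d "r t"] by (simp add: DF_def mult_ac)
    also have "\<dots> \<le> 1/2 * norm (r t)"
      using d by (intro mult_right_mono) (auto simp: admissible_def)
    finally have 2: "norm (DF (z t) (r t) d) \<le> norm (r t) / 2" by simp
    have "norm (F (y t) e - F (z t) e) \<le> L * norm (y t - z t) * norm e"
      using lipF[OF yt zt] .
    also have "\<dots> \<le> L * (2 * K * norm e) * norm e"
      using yz[OF t] pos by (intro mult_right_mono mult_left_mono) auto
    finally have 3: "norm (F (y t) e - F (z t) e) \<le> L * (2 * K * norm e) * norm e" .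
    have "norm (r' t) \<le> L * (2 * K * norm e)\<^sup>2 * norm d + norm (r t) / 2 + L * (2 * K * norm e) * norm e"
      unfolding split by (intro norm_triangle_mono 1 2 3)
    then show "norm (r' t) \<le> norm (r t) / 2 + c"
      by (simp add: c_def power2_eq_square algebra_simps)
  qed auto
  moreover have "r 0 = 0" "r 1 = plaque_map a (d + e) - plaque_map a d - F (plaque_map a d) e"
    using z(1) y(1) by (simp_all add: r_def plaque_map_def z_def y_def)
  ultimately show ?thesis unfolding c_def by simp
qed

text \<open>Strict inequalities give an open set of parameters, on which differentiation in
  \<open>d\<close> makes sense.\<close>

definition strictly_admissible :: "'e \<Rightarrow> 'e \<Rightarrow> bool" where
  "strictly_admissible a d \<longleftrightarrow> L * norm d < 1/2 \<and> norm (a - p0) + K * norm d < R"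

lemma strictly_admissible_imp: "strictly_admissible a d \<Longrightarrow> admissible a d"
  by (simp add: strictly_admissible_def admissible_def)

lemma open_strictly_admissible: "open {d. strictly_admissible a d}"
  unfolding strictly_admissible_def by (intro open_Collect_conj open_Collect_less continuous_intros)

lemma plaque_map_has_derivative:
  assumes "strictly_admissible a d"
  shows "(plaque_map a has_derivative F (plaque_map a d)) (at d)"
proof -
  obtain \<delta> where \<delta>: "\<delta> > 0" "ball d \<delta> \<subseteq> {d. strictly_admissible a d}"
    using open_strictly_admissible assms openE by blast
  have ad: "admissible a d" using assms strictly_admissible_imp by blast
  show ?thesis
  proof (rule has_derivative_at_quadratic[OF _ \<delta>(1)])
    show "bounded_linear (F (plaque_map a d))"
      using linF[OF cball_S[OF plaque_map_in_cball[OF ad]]] linear_conv_bounded_linear by blast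
    fix e :: 'e assume "norm e < \<delta>"
    then have "d + e \<in> {d. strictly_admissible a d}" using \<delta>(2) add_mem_ball_iff by blast
    then show "norm (plaque_map a (d + e) - plaque_map a d - F (plaque_map a d) e)
       \<le> (2 * (4 * L * K\<^sup>2 * norm d + 2 * L * K)) * (norm e)\<^sup>2"
      using plaque_map_expansion[OF ad strictly_admissible_imp, of e] by (simp only: mem_Collect_eq mult.assoc)
  qed (use pos in auto)
qed

text \<open>The derivative in \<open>d\<close> is the smooth frame evaluated at
  \<open>plaque_map a d\<close>, so regularity of order \<open>k\<close> improves to order
  \<open>k + 1\<close>.\<close>

lemma plaque_map_smooth: "smooth_on {d. strictly_admissible a d} (plaque_map a)"
proof -
  have "Ck_on k {d. strictly_admissible a d} (plaque_map a)" for k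
  proof (induction k)
    case 0
    show ?case
      by (auto intro!: continuous_at_imp_continuous_on has_derivative_continuous plaque_map_has_derivative)
  next
    case (Suc k)
    show ?case
    proof (rule Ck_on_SucI[OF open_strictly_admissible])
      show "Ck_on k {d. strictly_admissible a d} (\<lambda>x. F (plaque_map a x) v)" for v
        by (rule Ck_on_compose[OF open_strictly_admissible S(1) Suc])
          (use smoothF smooth_on_def cball_S[OF plaque_map_in_cball[OF strictly_admissible_imp]] in auto)
    qed (use plaque_map_has_derivative in auto)
  qed
  then show ?thesis by (simp add: smooth_on_def)
qed

end

section \<open>Smooth families of linear maps\<close>

lemma linear_Basis_expansion:
  fixes L :: "'a::euclidean_space \<Rightarrow> 'b::real_vector"
  assumes "linear L"
  shows "L x = (\<Sum>b\<in>Basis. (x \<bullet> b) *\<^sub>R L b)"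
  by (metis (no_types, lifting) assms euclidean_representation linear_scale linear_sum sum.cong)

text \<open>Where \<open>c\<close> vanishes, the change of \<open>a\<close> contributes a small
  factor times a factor of first order, so continuity of \<open>a\<close> suffices and its
  derivative does not appear. This serves for coefficients of which only continuity is at
  hand.\<close>

lemma has_derivative_scaleR_vanishing:
  fixes a :: "'a::real_normed_vector \<Rightarrow> real" and c :: "'a \<Rightarrow> 'b::real_normed_vector"
  assumes "isCont a p" "(c has_derivative c') (at p)" "c p = 0"
  shows "((\<lambda>q. a q *\<^sub>R c q) has_derivative (\<lambda>v. a p *\<^sub>R c' v)) (at p)"
proof -
  obtain K where K: "\<And>x. norm (c' x) \<le> norm x * K" and "K > 0"
    using has_derivative_bounded_linear[OF assms(2)] bounded_linear.pos_bounded by blast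
  have "((\<lambda>q. (a q - a p) *\<^sub>R c q) has_derivative (\<lambda>v. 0)) (at p)"
    unfolding has_derivative_at_alt
  proof (intro conjI allI impI)
    fix e :: real assume e: "e > 0"
    obtain d1 where d1: "d1 > 0" "\<And>y. norm (y - p) < d1 \<Longrightarrow> norm (c y - c p - c' (y - p)) \<le> 1 * norm (y - p)"
      using assms(2) unfolding has_derivative_at_alt by (metis zero_less_one)
    have "e / (K + 1) > 0" using e \<open>K > 0\<close> by simp
    then obtain d2 where d2: "d2 > 0" "\<And>y. norm (y - p) < d2 \<Longrightarrow> \<bar>a y - a p\<bar> < e / (K + 1)"
      using assms(1) unfolding continuous_at_eps_delta by (metis dist_norm real_norm_def)
    show "\<exists>d>0. \<forall>y. norm (y - p) < d \<longrightarrow>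
        norm ((a y - a p) *\<^sub>R c y - (a p - a p) *\<^sub>R c p - 0) \<le> e * norm (y - p)"
    proof (intro exI[of _ "min d1 d2"] conjI allI impI)
      fix y assume y: "norm (y - p) < min d1 d2"
      have "norm (c y) \<le> norm (c y - c p - c' (y - p)) + norm (c' (y - p))"
        using norm_triangle_ineq[of "c y - c p - c' (y - p)" "c' (y - p)"] assms(3) by simp
      also have "\<dots> \<le> (K + 1) * norm (y - p)"
        using d1(2)[of y] y K[of "y - p"] by (simp add: algebra_simps)
      finally have c: "norm (c y) \<le> (K + 1) * norm (y - p)" .
      have "norm ((a y - a p) *\<^sub>R c y) \<le> e / (K + 1) * ((K + 1) * norm (y - p))"
        unfolding norm_scaleR using d2(2)[of y] y c e \<open>K > 0\<close> by (intro mult_mono) auto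
      then show "norm ((a y - a p) *\<^sub>R c y - (a p - a p) *\<^sub>R c p - 0) \<le> e * norm (y - p)"
        using \<open>K > 0\<close> by simp
    qed (use d1 d2 in auto)
  qed simp
  moreover have "((\<lambda>q. a p *\<^sub>R c q) has_derivative (\<lambda>v. a p *\<^sub>R c' v)) (at p)"
    using assms(2) by (rule has_derivative_scaleR_right)
  ultimately have "((\<lambda>q. a p *\<^sub>R c q + (a q - a p) *\<^sub>R c q) has_derivative (\<lambda>v. a p *\<^sub>R c' v + 0)) (at p)"
    by (rule has_derivative_add[rotated])
  then show ?thesis by (simp add: algebra_simps)
qed

text \<open>A basis expansion of \<open>Y q\<close> reduces the product rule for a moving vector in
  a moving linear map to finitely many products of scalars with vectors.\<close>

lemma linear_family_has_derivative:
  fixes G :: "'a::real_normed_vector \<Rightarrow> 'b::euclidean_space \<Rightarrow> 'c::real_normed_vector"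
  assumes lin: "\<And>p. p \<in> S \<Longrightarrow> linear (G p)" and S: "open S" "p \<in> S"
    and dG: "\<And>v. (\<lambda>q. G q v) differentiable (at p)"
    and dY: "(Y has_derivative Y') (at p)"
  shows "((\<lambda>q. G q (Y q)) has_derivative
      (\<lambda>e. frechet_derivative (\<lambda>q. G q (Y p)) (at p) e + G p (Y' e))) (at p)"
proof -
  define D where "D v = frechet_derivative (\<lambda>q. G q v) (at p)" for v
  have D: "((\<lambda>q. G q v) has_derivative D v) (at p)" for v
    unfolding D_def using dG frechet_derivative_works by blast
  have "((\<lambda>q. \<Sum>b\<in>Basis. (v \<bullet> b) *\<^sub>R G q b) has_derivative (\<lambda>e. \<Sum>b\<in>Basis. (v \<bullet> b) *\<^sub>R D b e)) (at p)" for v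
    by (intro has_derivative_sum has_derivative_scaleR_right D)
  then have "((\<lambda>q. G q v) has_derivative (\<lambda>e. \<Sum>b\<in>Basis. (v \<bullet> b) *\<^sub>R D b e)) (at p)" for v
    by (rule has_derivative_transform_within_open[OF _ S]) (metis linear_Basis_expansion lin)
  then have Dv: "D v e = (\<Sum>b\<in>Basis. (v \<bullet> b) *\<^sub>R D b e)" for v e
    using D has_derivative_unique by metis
  have "((\<lambda>q. \<Sum>b\<in>Basis. (Y q \<bullet> b) *\<^sub>R G q b) has_derivative
     (\<lambda>e. \<Sum>b\<in>Basis. (Y p \<bullet> b) *\<^sub>R D b e + (Y' e \<bullet> b) *\<^sub>R G p b)) (at p)"
    by (intro has_derivative_sum has_derivative_scaleR has_derivative_inner_left dY D)
  then have "((\<lambda>q. G q (Y q)) has_derivative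
     (\<lambda>e. \<Sum>b\<in>Basis. (Y p \<bullet> b) *\<^sub>R D b e + (Y' e \<bullet> b) *\<^sub>R G p b)) (at p)"
    by (rule has_derivative_transform_within_open[OF _ S]) (metis linear_Basis_expansion lin)
  moreover have "(\<Sum>b\<in>Basis. (Y p \<bullet> b) *\<^sub>R D b e + (Y' e \<bullet> b) *\<^sub>R G p b) = D (Y p) e + G p (Y' e)" for e
    unfolding sum.distrib Dv[of "Y p"] linear_Basis_expansion[OF lin[OF S(2)], of "Y' e"] ..
  ultimately show ?thesis unfolding D_def by simp
qed

lemma linear_family_smooth:
  fixes G :: "'a::real_normed_vector \<Rightarrow> 'b::euclidean_space \<Rightarrow> 'c::real_normed_vector"
  assumes S: "open S" and lin: "\<And>p. p \<in> S \<Longrightarrow> linear (G p)"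
    and "\<And>v. smooth_on S (\<lambda>q. G q v)" "smooth_on S Y"
  shows "smooth_on S (\<lambda>q. G q (Y q))"
proof (rule smooth_on_cong[OF S])
  show "(\<Sum>b\<in>Basis. (Y q \<bullet> b) *\<^sub>R G q b) = G q (Y q)" if "q \<in> S" for q
    by (rule linear_Basis_expansion[OF lin[OF that], symmetric])
  show "smooth_on S (\<lambda>q. \<Sum>b\<in>Basis. (Y q \<bullet> b) *\<^sub>R G q b)"
    by (intro smooth_on_sum smooth_on_bounded_bilinear[OF _ bounded_bilinear_scaleR]
      smooth_on_bounded_linear_comp[OF _ bounded_linear_inner_left] assms)
qed

text \<open>Closeness within \<open>e\<close> divided by the dimension at each of the finitely many
  basis vectors gives closeness within \<open>e\<close> in operator norm.\<close>

lemma linear_family_continuous_bound: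
  fixes G :: "'a::real_normed_vector \<Rightarrow> 'b::euclidean_space \<Rightarrow> 'c::real_normed_vector"
  assumes "open S" "p \<in> S" and lin: "\<And>p. p \<in> S \<Longrightarrow> linear (G p)"
    and cont: "\<And>v. isCont (\<lambda>q. G q v) p" and e: "e > 0"
  obtains d where "d > 0" "ball p d \<subseteq> S" "\<And>q v. q \<in> ball p d \<Longrightarrow> norm (G q v - G p v) \<le> e * norm v"
proof -
  define N where "N = real DIM('b)"
  have N: "N > 0" by (simp add: N_def)
  have "eventually (\<lambda>q. norm (G q b - G p b) < e / N) (at p)" for b
    using cont[of b, unfolded isCont_def] N e by (simp add: tendsto_iff dist_norm)
  then have "eventually (\<lambda>q. \<forall>b\<in>Basis. norm (G q b - G p b) < e / N) (at p)"
    by (intro eventually_ball_finite) auto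
  then obtain d1 where d1: "d1 > 0" "\<And>q b. q \<noteq> p \<Longrightarrow> dist q p < d1 \<Longrightarrow> b \<in> Basis \<Longrightarrow> norm (G q b - G p b) < e / N"
    unfolding eventually_at by blast
  obtain d2 where d2: "d2 > 0" "ball p d2 \<subseteq> S" using assms openE by blast
  show ?thesis
  proof
    show "min d1 d2 > 0" "ball p (min d1 d2) \<subseteq> S" using d1 d2 by auto
    fix q v assume q: "q \<in> ball p (min d1 d2)"
    have bd: "norm (G q b - G p b) \<le> e / N" if "b \<in> Basis" for b
      using d1(2)[OF _ _ that, of q] q e N by (cases "q = p") (auto simp: dist_commute intro: less_imp_le)
    have "q \<in> S" using q d2 by auto
    then have lin': "linear (\<lambda>v. G q v - G p v)" using lin assms(2) by (intro linear_compose_sub) auto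
    have "onorm (\<lambda>v. G q v - G p v) \<le> (\<Sum>b\<in>Basis. norm (G q b - G p b))"
      using onorm_le_sum_Basis[OF lin'] .
    also have "\<dots> \<le> (\<Sum>b\<in>(Basis::'b set). e / N)" by (intro sum_mono bd)
    also have "\<dots> = e" using N by (simp add: N_def)
    finally have "onorm (\<lambda>v. G q v - G p v) \<le> e" .
    then show "norm (G q v - G p v) \<le> e * norm v"
      using onorm[of "\<lambda>v. G q v - G p v" v] lin' linear_conv_bounded_linear
      by (meson mult_right_mono norm_ge_zero order_trans)
  qed
qed

text \<open>An injective linear map has a positive lower bound; a perturbation of operator norm at
  most half of it leaves the other half.\<close>

lemma linear_family_bounded_below:
  fixes G :: "'a::real_normed_vector \<Rightarrow> 'b::euclidean_space \<Rightarrow> 'b"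
  assumes "open S" "p \<in> S" and lin: "\<And>p. p \<in> S \<Longrightarrow> linear (G p)"
    and cont: "\<And>v. isCont (\<lambda>q. G q v) p" and inj: "inj (G p)"
  obtains d k where "d > 0" "k > 0" "ball p d \<subseteq> S" "\<And>q v. q \<in> ball p d \<Longrightarrow> k * norm v \<le> norm (G q v)"
proof -
  obtain k where k: "k > 0" "\<And>v. k * norm v \<le> norm (G p v)"
    using linear_inj_bounded_below_pos[OF lin[OF assms(2)] inj] by blast
  obtain d where d: "d > 0" "ball p d \<subseteq> S" "\<And>q v. q \<in> ball p d \<Longrightarrow> norm (G q v - G p v) \<le> (k/2) * norm v"
    using linear_family_continuous_bound[OF assms(1-3) cont, of "k/2"] k(1) by auto
  show ?thesis
  proof
    show "d > 0" "k / 2 > 0" "ball p d \<subseteq> S" using d k by auto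
    fix q v assume "q \<in> ball p d"
    from d(3)[OF this, of v] k(2)[of v] norm_triangle_ineq3[of "G q v" "G p v"]
    show "k / 2 * norm v \<le> norm (G q v)" by simp
  qed
qed

lemma linear_inj_iff_bounded_below:
  assumes "linear f" "k > 0" "\<And>v. k * norm v \<le> norm (f v)"
  shows "inj f"
  unfolding linear_injective_0[OF assms(1)]
proof (intro allI impI)
  fix x assume "f x = 0"
  with assms(3)[of x] assms(2) show "x = 0" by (simp add: mult_le_0_iff)
qed

text \<open>With \<open>g p\<close> the inverse of \<open>G p\<close>, the identity
  \<open>g q y = g p (y - (G q - G p) (g q y))\<close> holds, and \<open>G q - G p\<close> vanishes
  at \<open>q = p\<close>. So continuity of \<open>g\<close>, which comes from a uniform lower bound
  for \<open>G\<close>, already yields its derivative. That derivative is expressed by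
  \<open>g\<close> and derivatives of \<open>G\<close>, and induction gives all orders.\<close>

lemma smooth_linear_inverse:
  fixes G :: "'a::euclidean_space \<Rightarrow> 'b::euclidean_space \<Rightarrow> 'b"
  assumes S: "open S" and lin: "\<And>p. p \<in> S \<Longrightarrow> linear (G p)" and inj: "\<And>p. p \<in> S \<Longrightarrow> inj (G p)"
    and sm: "\<And>v. smooth_on S (\<lambda>q. G q v)"
  shows "smooth_on S (\<lambda>p. inv (G p) y)"
proof -
  define g where "g p y = inv (G p) y" for p y
  have bij: "bij (G p)" if "p \<in> S" for p
    using lin inj that by (simp add: bij_def linear_injective_imp_surjective)
  have Gg: "G p (g p y) = y" if "p \<in> S" for p y
    unfolding g_def using bij[OF that] by (simp add: bij_is_surj surj_f_inv_f)
  have gG: "g p (G p y) = y" if "p \<in> S" for p y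
    unfolding g_def using inj[OF that] by simp
  have ling: "linear (g p)" if "p \<in> S" for p
    unfolding g_def using inj_linear_imp_inv_linear[OF lin[OF that] inj[OF that]] .
  have cG: "isCont (\<lambda>q. G q v) p" if "p \<in> S" for p v
    using smooth_on_continuous_on[OF sm] S that continuous_on_eq_continuous_at by blast
  have cg: "isCont (\<lambda>q. g q y) p" if p: "p \<in> S" for p y
  proof -
    obtain d k where d: "d > 0" "k > 0" "ball p d \<subseteq> S" "\<And>q v. q \<in> ball p d \<Longrightarrow> k * norm v \<le> norm (G q v)"
      using linear_family_bounded_below[OF S p lin cG[OF p] inj[OF p]] by metis
    have "((\<lambda>q. G q (g p y)) \<longlongrightarrow> G p (g p y)) (at p)"
      using cG[OF p] by (simp add: isCont_def)
    then have "((\<lambda>q. G q (g p y)) \<longlongrightarrow> y) (at p)" by (simp add: Gg p)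
    then have "((\<lambda>q. norm (G q (g p y) - y) / k) \<longlongrightarrow> 0) (at p)"
      using tendsto_norm_zero[OF LIM_zero] tendsto_divide_zero by blast
    moreover have "eventually (\<lambda>q. norm (g q y - g p y) \<le> norm (G q (g p y) - y) / k) (at p)"
      unfolding eventually_at
    proof (intro exI[of _ d] conjI d(1) ballI impI)
      fix q assume "q \<noteq> p \<and> dist q p < d"
      then have q: "q \<in> ball p d" by (simp add: dist_commute)
      then have qS: "q \<in> S" using d by auto
      have "k * norm (g q y - g p y) \<le> norm (y - G q (g p y))"
        using d(4)[OF q, of "g q y - g p y"] linear_diff[OF lin[OF qS]] Gg[OF qS] by simp
      then show "norm (g q y - g p y) \<le> norm (G q (g p y) - y) / k"
        using d(2) by (simp add: field_simps norm_minus_commute)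
    qed
    ultimately have "((\<lambda>q. g q y - g p y) \<longlongrightarrow> 0) (at p)"
      by (rule Lim_null_comparison[rotated])
    then show ?thesis by (simp add: isCont_def LIM_zero_iff)
  qed
  define DG where "DG p b e = frechet_derivative (\<lambda>q. G q b) (at p) e" for p b e
  have DG: "((\<lambda>q. G q b) has_derivative DG p b) (at p)" if "p \<in> S" for p b
    unfolding DG_def using smooth_on_has_derivative[OF sm that] .
  have dg: "((\<lambda>q. g q y) has_derivative (\<lambda>e. - g p (\<Sum>b\<in>Basis. (g p y \<bullet> b) *\<^sub>R DG p b e))) (at p)"
    if p: "p \<in> S" for p y
  proof -
    have "((\<lambda>q. g p (y - (\<Sum>b\<in>Basis. (g q y \<bullet> b) *\<^sub>R (G q b - G p b)))) has_derivative
        (\<lambda>e. g p (0 - (\<Sum>b\<in>Basis. (g p y \<bullet> b) *\<^sub>R (DG p b e - 0))))) (at p)"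
      using ling[OF p]
      by (intro bounded_linear.has_derivative[of "g p"] has_derivative_diff has_derivative_const has_derivative_sum
           has_derivative_scaleR_vanishing isCont_inner cg DG p) (auto simp: linear_conv_bounded_linear)
    then have "((\<lambda>q. g q y) has_derivative (\<lambda>e. g p (0 - (\<Sum>b\<in>Basis. (g p y \<bullet> b) *\<^sub>R (DG p b e - 0))))) (at p)"
    proof (rule has_derivative_transform_within_open[OF _ S p])
      fix q assume q: "q \<in> S"
      have "(\<Sum>b\<in>Basis. (g q y \<bullet> b) *\<^sub>R (G q b - G p b)) = G q (g q y) - G p (g q y)"
        by (simp add: scaleR_diff_right sum_subtractf linear_Basis_expansion[OF lin[OF q], symmetric]
            linear_Basis_expansion[OF lin[OF p], symmetric])
      then show "g p (y - (\<Sum>b\<in>Basis. (g q y \<bullet> b) *\<^sub>R (G q b - G p b))) = g q y"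
        by (simp add: Gg q gG p)
    qed
    then show ?thesis using linear_neg[OF ling[OF p]] by simp
  qed
  have "Ck_on k S (\<lambda>p. g p y)" for k y
  proof (induction k arbitrary: y)
    case 0
    then show ?case using cg by (auto intro: continuous_at_imp_continuous_on)
  next
    case (Suc k)
    show ?case
    proof (rule Ck_on_SucI[OF S dg])
      fix v
      define w where "w p = (\<Sum>b\<in>Basis. (g p y \<bullet> b) *\<^sub>R DG p b v)" for p
      have w: "Ck_on k S w"
        unfolding w_def DG_def
        by (intro Ck_on_sum S Ck_on_bounded_bilinear[OF _ bounded_bilinear_scaleR]
          Ck_on_bounded_linear_comp[OF _ bounded_linear_inner_left] Suc.IH)
          (use smooth_on_frechet_derivative[OF sm] in \<open>simp add: smooth_on_def\<close>)
      show "Ck_on k S (\<lambda>p. - g p (\<Sum>b\<in>Basis. (g p y \<bullet> b) *\<^sub>R DG p b v))"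
      proof (rule Ck_on_cong[OF S])
        show "- (\<Sum>c\<in>Basis. (w p \<bullet> c) *\<^sub>R g p c) = - g p (\<Sum>b\<in>Basis. (g p y \<bullet> b) *\<^sub>R DG p b v)" if "p \<in> S" for p
          unfolding linear_Basis_expansion[OF ling[OF that], of "w p", symmetric] by (simp add: w_def)
        show "Ck_on k S (\<lambda>p. - (\<Sum>c\<in>Basis. (w p \<bullet> c) *\<^sub>R g p c))"
          by (intro Ck_on_bounded_linear_comp[OF S bounded_linear_minus[OF bounded_linear_ident]] Ck_on_sum S
            Ck_on_bounded_bilinear[OF _ bounded_bilinear_scaleR] w
            Ck_on_bounded_linear_comp[OF _ bounded_linear_inner_left] Suc.IH)
      qed
    qed
  qed
  then show ?thesis by (simp add: smooth_on_def g_def)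
qed

text \<open>The restriction of \<open>g\<close> to the line through \<open>q\<close> in direction
  \<open>e\<close> is constant near 0. In this way identities known only on \<open>E\<close> are
  differentiated along \<open>E\<close>.\<close>

lemma derivative_along_subspace_zero:
  fixes g :: "'a::real_normed_vector \<Rightarrow> 'b::real_normed_vector"
  assumes g: "(g has_derivative g') (at q)" and S: "open S" "q \<in> S" and E: "subspace E" "q \<in> E" "e \<in> E"
    and 0: "\<And>p. p \<in> S \<Longrightarrow> p \<in> E \<Longrightarrow> g p = c"
  shows "g' e = 0"
proof -
  have "((\<lambda>t. g (q + t *\<^sub>R e)) has_derivative (\<lambda>t. g' (t *\<^sub>R e))) (at (0::real))"
    by (rule has_derivative_compose[of "\<lambda>t. q + t *\<^sub>R e" "\<lambda>t. t *\<^sub>R e"])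
      (use g in \<open>auto intro!: derivative_eq_intros\<close>)
  moreover have "((\<lambda>t. g (q + t *\<^sub>R e)) has_derivative (\<lambda>t. 0)) (at (0::real))"
  proof (rule has_derivative_transform_within_open[of "\<lambda>t. c"])
    show "open ((\<lambda>t::real. q + t *\<^sub>R e) -` S)"
      by (intro open_vimage S continuous_intros)
    show "c = g (q + t *\<^sub>R e)" if "t \<in> (\<lambda>t::real. q + t *\<^sub>R e) -` S" for t
      using 0 that E by (simp add: subspace_add subspace_scale)
  qed (use S in auto)
  ultimately have "(\<lambda>t::real. g' (t *\<^sub>R e)) = (\<lambda>t. 0)" by (rule has_derivative_unique)
  from fun_cong[OF this, of 1] show ?thesis by simp
qed

lemma ex_orthogonal_projection:
  fixes E :: "'a::euclidean_space set"
  assumes "subspace E"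
  obtains P where "linear P" "\<And>x. P x \<in> E" "\<And>x. x \<in> E \<Longrightarrow> P x = x" "\<And>x y. P x \<bullet> y = x \<bullet> P y"
    "\<And>x. norm (P x) \<le> norm x"
proof -
  obtain B where B: "B \<subseteq> E" "pairwise orthogonal B" "\<And>x. x \<in> B \<Longrightarrow> norm x = 1"
    "independent B" "span B = E"
    using orthonormal_basis_subspace[OF assms] by metis
  have fin: "finite B" using B independent_imp_finite by blast
  define P where "P x = (\<Sum>b\<in>B. (x \<bullet> b) *\<^sub>R b)" for x
  have lin: "linear P" unfolding P_def
    by (intro linear_compose_sum ballI) (auto intro!: linearI simp: inner_left_distrib scaleR_left_distrib)
  have PE: "P x \<in> E" for x unfolding P_def using B(1) assms by (intro subspace_sum subspace_scale) auto
  have Pb: "P b = b" if "b \<in> B" for b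
  proof -
    have "P b = (\<Sum>c\<in>B. if c = b then b else 0)" unfolding P_def
      using B(2,3) that by (intro sum.cong) (auto simp: pairwise_def orthogonal_def inner_commute dot_square_norm)
    then show ?thesis using fin that by simp
  qed
  have PP: "P x = x" if "x \<in> E" for x
    using that unfolding B(5)[symmetric]
    by (induction x rule: span_induct_alt) (auto simp: lin linear_0 linear_add linear_scale Pb)
  have sa: "P x \<bullet> y = x \<bullet> P y" for x y
    by (simp add: P_def inner_sum_left inner_sum_right inner_commute mult.commute)
  have "norm (P x) \<le> norm x" for x
  proof -
    have "norm (P x) * norm (P x) = x \<bullet> P x"
      using sa[of x "P x"] PP[OF PE[of x]] by (metis norm_eq_square power2_eq_square norm_ge_zero)
    also have "\<dots> \<le> norm x * norm (P x)" by (rule norm_cauchy_schwarz)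
    finally show ?thesis by (cases "norm (P x) = 0") auto
  qed
  with that lin PE PP sa show ?thesis by blast
qed

lemma common_Lipschitz_bound:
  fixes g :: "'i \<Rightarrow> 'a::euclidean_space \<Rightarrow> 'b::real_normed_vector"
  assumes "finite I" "\<And>i. i \<in> I \<Longrightarrow> smooth_on S (g i)" "cball p R \<subseteq> S"
  obtains C where "C \<ge> 0" "\<And>i x y. i \<in> I \<Longrightarrow> x \<in> cball p R \<Longrightarrow> y \<in> cball p R \<Longrightarrow>
     norm (g i x) \<le> C \<and> norm (g i x - g i y) \<le> C * norm (x - y)"
proof -
  have "\<exists>C\<ge>0. \<forall>i\<in>I. \<forall>x\<in>cball p R. \<forall>y\<in>cball p R. norm (g i x) \<le> C \<and> norm (g i x - g i y) \<le> C * norm (x - y)"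
    using assms(1,2)
  proof (induction I rule: finite_induct)
    case empty
    show ?case by auto
  next
    case (insert i I)
    then obtain C where C: "C \<ge> 0" "\<forall>i\<in>I. \<forall>x\<in>cball p R. \<forall>y\<in>cball p R. norm (g i x) \<le> C \<and> norm (g i x - g i y) \<le> C * norm (x - y)"
      by auto
    have sm: "smooth_on S (g i)" using insert by auto
    then have "Ck_on (Suc 0) S (g i)" unfolding smooth_on_def by blast
    from Ck_on_Lipschitz[OF this compact_cball convex_cball assms(3)] obtain C1 where
      C1: "C1 \<ge> 0" "\<And>x y. x \<in> cball p R \<Longrightarrow> y \<in> cball p R \<Longrightarrow> norm (g i x - g i y) \<le> C1 * norm (x - y)" by metis
    have "compact (g i ` cball p R)"
      using smooth_on_continuous_on[OF sm] assms(3) continuous_on_subset compact_continuous_image compact_cball by metis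
    then obtain C2 where C2: "\<And>x. x \<in> cball p R \<Longrightarrow> norm (g i x) \<le> C2"
      using compact_imp_bounded bounded_iff by (metis imageI)
    define M where "M = Max {C, C1, C2}"
    have M: "C \<le> M" "C1 \<le> M" "C2 \<le> M" by (auto simp: M_def)
    show ?case
    proof (intro exI[of _ M] conjI ballI)
      show "0 \<le> M" using M C by auto
      fix j x y assume *: "j \<in> insert i I" "x \<in> cball p R" "y \<in> cball p R"
      have Cj: "norm (g j x) \<le> C" "norm (g j x - g j y) \<le> C * norm (x - y)" if "j \<noteq> i"
        using * that C(2) by blast+
      show "norm (g j x) \<le> M" using M(1,3) C2[OF *(2)] Cj(1) by (cases "j = i") auto
      have "C * norm (x - y) \<le> M * norm (x - y)" "C1 * norm (x - y) \<le> M * norm (x - y)"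
        using M by (auto intro: mult_right_mono)
      then show "norm (g j x - g j y) \<le> M * norm (x - y)"
        using C1(2)[OF *(2,3)] Cj(2) by (cases "j = i") auto
    qed
  qed
  then show ?thesis using that by blast
qed

lemma norm_sum_Basis_le:
  fixes f :: "'a::euclidean_space \<Rightarrow> 'b::real_normed_vector"
  assumes "\<And>b. b \<in> Basis \<Longrightarrow> norm (f b) \<le> C"
  shows "norm (\<Sum>b\<in>Basis. (v \<bullet> b) *\<^sub>R f b) \<le> real DIM('a) * C * norm v"
proof -
  have "norm (\<Sum>b\<in>Basis. (v \<bullet> b) *\<^sub>R f b) \<le> (\<Sum>b\<in>(Basis::'a set). norm v * C)"
    by (intro order_trans[OF norm_sum] sum_mono) (auto simp: Basis_le_norm assms intro!: mult_mono)
  then show ?thesis by (simp add: mult_ac)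
qed

text \<open>On the compact ball the frame and its first derivatives, taken on basis vectors, have
  common bounds \<open>C1\<close> and \<open>C2\<close> that are also Lipschitz constants; the
  Lipschitz bound for the derivatives controls the quadratic remainder. Each basis expansion costs a
  factor equal to the dimension \<open>N\<close>.\<close>

lemma commuting_frame_constants:
  fixes F :: "'e::euclidean_space \<Rightarrow> 'e \<Rightarrow> 'e"
  assumes S: "open S" "cball p0 R \<subseteq> S" "R > 0"
    and lin: "\<And>p. p \<in> S \<Longrightarrow> linear (F p)" and sm: "\<And>v. smooth_on S (\<lambda>p. F p v)"
    and comm: "\<And>p v w. p \<in> cball p0 R \<Longrightarrow>
       frechet_derivative (\<lambda>p. F p w) (at p) (F p v) = frechet_derivative (\<lambda>p. F p v) (at p) (F p w)"
  shows "\<exists>K L. commuting_frame F S p0 R K L"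
proof -
  define D where "D p v w = frechet_derivative (\<lambda>p. F p v) (at p) w" for p v w
  have D: "((\<lambda>p. F p v) has_derivative D p v) (at p)" if "p \<in> S" for p v
    unfolding D_def using smooth_on_has_derivative[OF sm that] .
  have Dexp: "D p v w = (\<Sum>b\<in>Basis. (w \<bullet> b) *\<^sub>R D p v b)" if "p \<in> S" for p v w
    unfolding D_def using frechet_derivative_basis_expansion smooth_on_differentiable[OF sm that] by blast
  have Dlin: "D p v w = (\<Sum>b\<in>Basis. (v \<bullet> b) *\<^sub>R D p b w)" if p: "p \<in> S" for p v w
  proof -
    have "((\<lambda>q. \<Sum>b\<in>Basis. (v \<bullet> b) *\<^sub>R F q b) has_derivative (\<lambda>e. \<Sum>b\<in>Basis. (v \<bullet> b) *\<^sub>R D p b e)) (at p)"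
      by (intro has_derivative_sum has_derivative_scaleR_right D p)
    then have "((\<lambda>q. F q v) has_derivative (\<lambda>e. \<Sum>b\<in>Basis. (v \<bullet> b) *\<^sub>R D p b e)) (at p)"
      by (rule has_derivative_transform_within_open[OF _ S(1) p]) (metis linear_Basis_expansion lin)
    from has_derivative_unique[OF D[OF p] this] show ?thesis by metis
  qed
  obtain C1 where C1: "C1 \<ge> 0" "\<And>b x y. b \<in> Basis \<Longrightarrow> x \<in> cball p0 R \<Longrightarrow> y \<in> cball p0 R \<Longrightarrow>
     norm (F x b) \<le> C1 \<and> norm (F x b - F y b) \<le> C1 * norm (x - y)"
    using common_Lipschitz_bound[of Basis S "\<lambda>b p. F p b" p0 R] sm S(2) by (metis finite_Basis)
  obtain C2 where C2: "C2 \<ge> 0" "\<And>i x y. i \<in> Basis \<times> Basis \<Longrightarrow> x \<in> cball p0 R \<Longrightarrow> y \<in> cball p0 R \<Longrightarrow>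
     norm (D x (fst i) (snd i)) \<le> C2 \<and> norm (D x (fst i) (snd i) - D y (fst i) (snd i)) \<le> C2 * norm (x - y)"
  proof (rule common_Lipschitz_bound[of "Basis \<times> Basis" S "\<lambda>i p. D p (fst i) (snd i)" p0 R])
    show "smooth_on S (\<lambda>p. D p (fst i) (snd i))" for i
      unfolding D_def using smooth_on_frechet_derivative[OF sm] .
  qed (use S in auto)
  define N where "N = real DIM('e)"
  have N: "N \<ge> 1" by (simp add: N_def DIM_ge_Suc0)
  define K where "K = N * C1"
  define L where "L = K + N * (N * C2)"
  have K0: "K \<ge> 0" using N C1 by (simp add: K_def)
  have L: "K \<le> L" "N * (N * C2) \<le> L" "L \<ge> 0" using N C2 K0 by (auto simp: L_def)
  have cS: "p \<in> S" if "p \<in> cball p0 R" for p using S that by auto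
  have bF: "norm (F p v) \<le> K * norm v" if "p \<in> cball p0 R" for p v
    unfolding linear_Basis_expansion[OF lin[OF cS[OF that]], of v] K_def N_def
    by (rule norm_sum_Basis_le) (use C1(2)[OF _ that that] in auto)
  have lF: "norm (F p v - F q v) \<le> K * norm (p - q) * norm v" if p: "p \<in> cball p0 R" and q: "q \<in> cball p0 R" for p q v
  proof -
    have "F p v - F q v = (\<Sum>b\<in>Basis. (v \<bullet> b) *\<^sub>R (F p b - F q b))"
      unfolding linear_Basis_expansion[OF lin[OF cS[OF p]], of v] linear_Basis_expansion[OF lin[OF cS[OF q]], of v]
      by (simp add: sum_subtractf scaleR_diff_right)
    also have "norm \<dots> \<le> N * (C1 * norm (p - q)) * norm v"
      unfolding N_def by (rule norm_sum_Basis_le) (use C1(2)[OF _ p q] in auto)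
    finally show ?thesis by (simp add: K_def mult_ac)
  qed
  have bD: "norm (D p v w) \<le> N * (N * C2) * norm w * norm v" if p: "p \<in> cball p0 R" for p v w
  proof -
    have "norm (D p v b) \<le> N * C2 * norm v" if "b \<in> Basis" for b
      unfolding Dlin[OF cS[OF p], of v] N_def
      by (rule norm_sum_Basis_le) (use C2(2)[OF _ p p, of "(_, b)"] that in auto)
    then have "norm (D p v w) \<le> N * (N * C2 * norm v) * norm w"
      unfolding Dexp[OF cS[OF p], of v w] N_def by (rule norm_sum_Basis_le)
    then show ?thesis by (simp add: mult_ac)
  qed
  have lD: "norm (D p v w - D q v w) \<le> N * (N * C2) * norm (p - q) * norm v * norm w"
    if p: "p \<in> cball p0 R" and q: "q \<in> cball p0 R" for p q v w
  proof -
    have "norm (D p v b - D q v b) \<le> N * (C2 * norm (p - q)) * norm v" if "b \<in> Basis" for b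
    proof -
      have "D p v b - D q v b = (\<Sum>c\<in>Basis. (v \<bullet> c) *\<^sub>R (D p c b - D q c b))"
        unfolding Dlin[OF cS[OF p], of v] Dlin[OF cS[OF q], of v] by (simp add: sum_subtractf scaleR_diff_right)
      also have "norm \<dots> \<le> N * (C2 * norm (p - q)) * norm v"
        unfolding N_def by (rule norm_sum_Basis_le) (use C2(2)[OF _ p q, of "(_, b)"] that in auto)
      finally show ?thesis .
    qed
    moreover have "D p v w - D q v w = (\<Sum>b\<in>Basis. (w \<bullet> b) *\<^sub>R (D p v b - D q v b))"
      unfolding Dexp[OF cS[OF p], of v w] Dexp[OF cS[OF q], of v w] by (simp add: sum_subtractf scaleR_diff_right)
    ultimately have "norm (D p v w - D q v w) \<le> N * (N * (C2 * norm (p - q)) * norm v) * norm w"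
      using norm_sum_Basis_le[of "\<lambda>b. D p v b - D q v b" _ w] unfolding N_def by auto
    then show ?thesis by (simp add: mult_ac)
  qed
  have qF: "norm (F q v - F p v - D p v (q - p)) \<le> L * (norm (q - p))\<^sup>2 * norm v"
    if p: "p \<in> cball p0 R" and q: "q \<in> cball p0 R" for p q v
  proof -
    have seg: "closed_segment p q \<subseteq> cball p0 R" using p q convex_cball convex_contains_segment by blast
    have "norm (F q v - F p v - D p v (q - p)) \<le> norm (q - p) * (N * (N * C2) * norm (q - p) * norm v)"
    proof (rule differentiable_bound_linearization[where S = "closed_segment p q" and f' = "\<lambda>p. D p v"])
      show "p + t *\<^sub>R (q - p) \<in> closed_segment p q" if "t \<in> {0..1}" for t
        using that by (auto simp: in_segment algebra_simps intro!: exI[of _ t])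
      fix x assume x: "x \<in> closed_segment p q"
      then have xc: "x \<in> cball p0 R" using seg by auto
      show "((\<lambda>p. F p v) has_derivative D x v) (at x within closed_segment p q)"
        using D[OF cS[OF xc]] has_derivative_at_withinI by blast
      show "onorm (D x v - D p v) \<le> N * (N * C2) * norm (q - p) * norm v"
      proof (rule onorm_le)
        fix w :: 'e
        have "norm (x - p) \<le> norm (q - p)" using segment_bound[OF x] by (simp add: norm_minus_commute)
        then have "N * (N * C2) * norm (x - p) * norm v * norm w \<le> N * (N * C2) * norm (q - p) * norm v * norm w"
          using N C2 by (intro mult_right_mono mult_left_mono) auto
        with lD[OF xc p, of v w] show "norm ((D x v - D p v) w) \<le> N * (N * C2) * norm (q - p) * norm v * norm w"
          by simp
      qed
    qed auto
    also have "\<dots> = N * (N * C2) * (norm (q - p))\<^sup>2 * norm v" by (simp add: power2_eq_square)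
    also have "\<dots> \<le> L * (norm (q - p))\<^sup>2 * norm v" using L by (intro mult_right_mono) auto
    finally show ?thesis .
  qed
  have mono: "c \<le> L \<Longrightarrow> c * norm x * norm y \<le> L * norm x * norm y" for c and x :: 'e and y :: 'e
    by (intro mult_right_mono) auto
  have "commuting_frame F S p0 R K L"
  proof (rule commuting_frame.intro)
    show "norm (F p v - F q v) \<le> L * norm (p - q) * norm v"
      if "p \<in> cball p0 R" "q \<in> cball p0 R" for p q v
      using lF[OF that] mono[OF L(1)] order_trans by blast
    show "norm (frechet_derivative (\<lambda>p. F p v) (at p) w) \<le> L * norm w * norm v"
      if "p \<in> cball p0 R" for p v w
      using bD[OF that] mono[OF L(2)] order_trans unfolding D_def by blast
  qed (fact S(1) S(2) S(3) K0 L(3) bF lin sm comm qF[unfolded D_def])+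
  then show ?thesis by blast
qed

section \<open>The characteristic distribution of a coisotropic subspace\<close>

lemma bilinear_linear_left: "bilinear f \<Longrightarrow> linear (\<lambda>u. f u v)"
  and bilinear_linear_right: "bilinear f \<Longrightarrow> linear (f u)"
  by (auto simp: bilinear_def)

lemma bilinear_form_has_derivative:
  fixes om :: "'a::real_normed_vector \<Rightarrow> 'e::euclidean_space \<Rightarrow> 'e \<Rightarrow> real"
  assumes bil: "\<And>p. p \<in> S \<Longrightarrow> bilinear (om p)" and S: "open S" "p \<in> S"
    and d: "\<And>u v. (\<lambda>q. om q u v) differentiable (at p)"
    and Y: "(Y has_derivative Y') (at p)" and Z: "(Z has_derivative Z') (at p)"
  shows "((\<lambda>q. om q (Y q) (Z q)) has_derivative
    (\<lambda>e. frechet_derivative (\<lambda>q. om q (Y p) (Z p)) (at p) e + om p (Y' e) (Z p) + om p (Y p) (Z' e))) (at p)"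
proof -
  have 1: "((\<lambda>q. om q (Y q) v) has_derivative
      (\<lambda>e. frechet_derivative (\<lambda>q. om q (Y p) v) (at p) e + om p (Y' e) v)) (at p)" for v
    by (rule linear_family_has_derivative[OF _ S, of "\<lambda>q u. om q u v"])
      (use bil bilinear_linear_left d Y in blast)+
  have "((\<lambda>q. om q (Y q) (Z q)) has_derivative
      (\<lambda>e. frechet_derivative (\<lambda>q. om q (Y q) (Z p)) (at p) e + om p (Y p) (Z' e))) (at p)"
    by (rule linear_family_has_derivative[OF _ S, of "\<lambda>q u. om q (Y q) u"])
      (use bil bilinear_linear_right 1 differentiable_def Z in blast)+
  then show ?thesis unfolding frechet_derivative_at[OF 1, symmetric] .
qed

lemma alternating_antisym:
  fixes f :: "'e::real_vector \<Rightarrow> 'e \<Rightarrow> real"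
  assumes "bilinear f" "\<And>u. f u u = 0"
  shows "f u v = - f v u"
proof -
  have "f (u + v) (u + v) = f u u + f u v + (f v u + f v v)"
    by (simp add: bilinear_ladd[OF assms(1)] bilinear_radd[OF assms(1)])
  then show ?thesis using assms(2) by simp
qed

text \<open>For \<open>p\<close> in \<open>E\<close> let \<open>D p\<close> be the \<open>om p\<close>-orthogonal complement of \<open>E\<close>. There the frame \<open>F p d\<close> is
  the vector of \<open>D p\<close> whose orthogonal projection to \<open>D p0\<close> is that of \<open>d\<close>; since brackets of
  such frame fields project to zero, involutivity makes them commute. Off \<open>E\<close> the frame is extended to
  be constant along the fibres of the orthogonal projection to \<open>E\<close>.\<close>

lemma coisotropic_frame:
  fixes om :: "'e::euclidean_space \<Rightarrow> 'e \<Rightarrow> 'e \<Rightarrow> real" and E :: "'e set"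
  assumes S: "open S" "p0 \<in> S" and E: "subspace E" "p0 \<in> E"
    and bil: "\<And>p. p \<in> S \<Longrightarrow> bilinear (om p)" and alt: "\<And>p u. p \<in> S \<Longrightarrow> om p u u = 0"
    and nd: "\<And>p u. p \<in> S \<Longrightarrow> (\<And>v. om p u v = 0) \<Longrightarrow> u = 0"
    and sm: "\<And>u v. smooth_on S (\<lambda>p. om p u v)"
    and closed: "\<And>p u v w. p \<in> S \<Longrightarrow> frechet_derivative (\<lambda>p. om p v w) (at p) u +
        frechet_derivative (\<lambda>p. om p w u) (at p) v + frechet_derivative (\<lambda>p. om p u v) (at p) w = 0"
    and cois: "\<And>p u. p \<in> S \<Longrightarrow> p \<in> E \<Longrightarrow> (\<And>v. v \<in> E \<Longrightarrow> om p u v = 0) \<Longrightarrow> u \<in> E"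
  obtains F :: "'e \<Rightarrow> 'e \<Rightarrow> 'e" and P :: "'e \<Rightarrow> 'e" and r :: real where
    "r > 0" "ball p0 r \<subseteq> S" "linear P"
    "\<And>x v. v \<in> E \<Longrightarrow> om p0 (P x) v = 0" "\<And>x. (\<And>v. v \<in> E \<Longrightarrow> om p0 x v = 0) \<Longrightarrow> P x = x"
    "\<And>x. norm (P x) \<le> norm x"
    "\<And>p. p \<in> ball p0 r \<Longrightarrow> linear (F p)" "\<And>p v. p \<in> ball p0 r \<Longrightarrow> F p v \<in> E"
    "\<And>p v. p \<in> ball p0 r \<Longrightarrow> P (F p v) = P v" "\<And>p v. p \<in> ball p0 r \<Longrightarrow> F p (P v) = F p v"
    "\<And>v. smooth_on (ball p0 r) (\<lambda>p. F p v)"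
    "\<And>p v w. p \<in> ball p0 r \<Longrightarrow>
       frechet_derivative (\<lambda>p. F p w) (at p) (F p v) = frechet_derivative (\<lambda>p. F p v) (at p) (F p w)"
    "\<And>p. p \<in> ball p0 r \<Longrightarrow> p \<in> E \<Longrightarrow> range (F p) = {u. \<forall>v\<in>E. om p u v = 0}"
proof -
  obtain \<pi> where \<pi>: "linear \<pi>" "\<And>x. \<pi> x \<in> E" "\<And>x. x \<in> E \<Longrightarrow> \<pi> x = x" "\<And>x y. \<pi> x \<bullet> y = x \<bullet> \<pi> y"
    "\<And>x. norm (\<pi> x) \<le> norm x"
    using ex_orthogonal_projection[OF E(1)] by metis
  define D where "D p = {u. \<forall>v\<in>E. om p u v = 0}" for p
  have subD: "subspace (D p)" if "p \<in> S" for p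
    unfolding D_def using bil[OF that]
    by (auto intro!: subspaceI simp: bilinear_lzero bilinear_ladd bilinear_lmul)
  obtain P where P: "linear P" "\<And>x. P x \<in> D p0" "\<And>x. x \<in> D p0 \<Longrightarrow> P x = x" "\<And>x y. P x \<bullet> y = x \<bullet> P y"
    "\<And>x. norm (P x) \<le> norm x"
    using ex_orthogonal_projection[OF subD[OF S(2)]] by metis
  \<comment> \<open>\<open>Om p x\<close> is the vector of \<open>E\<close> that represents the
    functional \<open>om p x\<close> on \<open>E\<close>, so its kernel in \<open>x\<close> is
    \<open>D p\<close>.\<close>
  define Om where "Om p x = (\<Sum>b\<in>Basis. om p x (\<pi> b) *\<^sub>R b)" for p x
  have Om_inner: "Om p x \<bullet> w = om p x (\<pi> w)" if "p \<in> S" for p x w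
  proof -
    have l: "linear (\<lambda>w. om p x (\<pi> w))"
      using linear_compose[OF \<pi>(1) bilinear_linear_right[OF bil[OF that]]] by (simp add: o_def)
    show ?thesis
      unfolding linear_Basis_expansion[OF l, of w] Om_def
      by (simp add: inner_sum_left mult.commute inner_commute[of w])
  qed
  have linOm: "linear (Om p)" if "p \<in> S" for p
    unfolding Om_def
    by (intro linear_compose_sum ballI linearI)
      (auto simp: bilinear_ladd[OF bil[OF that]] bilinear_lmul[OF bil[OF that]] scaleR_left_distrib)
  have Om0: "Om p x = 0 \<longleftrightarrow> x \<in> D p" if "p \<in> S" for p x
  proof
    assume "Om p x = 0"
    then have "om p x (\<pi> w) = 0" for w using Om_inner[OF that] by (metis inner_zero_left)
    then show "x \<in> D p" unfolding D_def using \<pi>(3) by (intro CollectI ballI) metis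
  next
    assume "x \<in> D p"
    then have "Om p x \<bullet> Om p x = 0" using Om_inner[OF that] \<pi>(2) by (simp add: D_def)
    then show "Om p x = 0" by simp
  qed
  define T where "T = adjoint (Om p0)"
  have T: "x \<bullet> T y = Om p0 x \<bullet> y" for x y unfolding T_def using adjoint_works[OF linOm[OF S(2)]] .
  have linT: "linear T" unfolding T_def using adjoint_linear[OF linOm[OF S(2)]] .
  \<comment> \<open>Inverting \<open>G p\<close> on a vector of \<open>range P\<close> solves two
    conditions at once: a prescribed \<open>P\<close>-component and membership in
    \<open>D p\<close>. The adjoint \<open>T\<close> takes values in the kernel of \<open>P\<close>,
    which keeps the two summands apart.\<close>
  define G where "G p x = P x + T (Om p x)" for p x
  have linG: "linear (G p)" if "p \<in> S" for p
    unfolding G_def using linear_compose_add[OF P(1) linear_compose[OF linOm[OF that] linT]]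
    by (simp add: o_def)
  have PT: "P (T y) = 0" for y
  proof -
    have "P (T y) \<bullet> P (T y) = P (P (T y)) \<bullet> T y" using P(4)[of "P (T y)" "T y"] by simp
    also have "\<dots> = Om p0 (P (P (T y))) \<bullet> y" by (rule T)
    also have "\<dots> = 0" using Om0[OF S(2), of "P (P (T y))"] P(2) by simp
    finally show ?thesis by simp
  qed
  have PP: "P (P x) = P x" for x using P by blast
  have PG: "P (G p x) = P x" for p x unfolding G_def by (simp add: linear_add[OF P(1)] PT PP)
  \<comment> \<open>\<open>T\<close> is injective on the values of \<open>Om p\<close>, also for
    \<open>p\<close> other than \<open>p0\<close>: if \<open>T y = 0\<close>, then
    \<open>\<pi> y\<close> is \<open>om p0\<close>-orthogonal to everything, hence zero by
    nondegeneracy, while for \<open>y = Om p x\<close> the square of \<open>y\<close> is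
    \<open>om p x (\<pi> y)\<close>.\<close>
  have GT: "x \<in> D p" if p: "p \<in> S" and eq: "T (Om p x) = 0" for p x
  proof -
    define y where "y = Om p x"
    have "om p0 z (\<pi> y) = 0" for z
      using T[of z y] eq Om_inner[OF S(2), of z y] by (simp add: y_def)
    then have "om p0 (\<pi> y) z = 0" for z
      using alternating_antisym[OF bil[OF S(2)] alt[OF S(2)], of "\<pi> y" z] by simp
    then have "\<pi> y = 0" using nd[OF S(2)] by blast
    then have "y \<bullet> y = 0"
      using Om_inner[OF p, of x y] bilinear_rzero[OF bil[OF p]] by (simp add: y_def)
    then show ?thesis using Om0[OF p] by (simp add: y_def)
  qed
  have injG: "inj (G p0)"
    unfolding linear_injective_0[OF linG[OF S(2)]]
  proof (intro allI impI)
    fix x assume x: "G p0 x = 0"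
    then have "P x = 0" using PG[of p0 x] by (simp add: linear_0[OF P(1)])
    moreover have "x \<in> D p0" using x \<open>P x = 0\<close> by (intro GT S) (simp add: G_def)
    ultimately show "x = 0" using P(3) by metis
  qed
  have smOm: "smooth_on S (\<lambda>p. Om p v)" for v
    unfolding Om_def
    by (intro smooth_on_sum S smooth_on_bounded_linear_comp[OF _ bounded_linear_scaleR_left] sm)
  have smG: "smooth_on S (\<lambda>p. G p v)" for v
    unfolding G_def
    by (intro smooth_on_add S smooth_on_const smooth_on_bounded_linear_comp[OF _ _ smOm])
      (use linT in \<open>simp add: linear_conv_bounded_linear\<close>)
  have cG: "isCont (\<lambda>q. G q v) p0" for v
    using smooth_on_continuous_on[OF smG] S continuous_on_eq_continuous_at by blast
  obtain r k where r: "r > 0" "k > 0" "ball p0 r \<subseteq> S" "\<And>q v. q \<in> ball p0 r \<Longrightarrow> k * norm v \<le> norm (G q v)"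
    using linear_family_bounded_below[OF S linG cG injG] by metis
  have inS: "p \<in> S" if "p \<in> ball p0 r" for p using that r by auto
  have inj: "inj (G p)" if "p \<in> ball p0 r" for p
    using linear_inj_iff_bounded_below[OF linG[OF inS[OF that]] r(2) r(4)[OF that]] .
  define X where "X p d = inv (G p) (P d)" for p d
  have GX: "G p (X p d) = P d" if "p \<in> ball p0 r" for p d
    unfolding X_def
    using linear_injective_imp_surjective[OF linG[OF inS[OF that]] inj[OF that]] by (simp add: surj_f_inv_f)
  have smX: "smooth_on (ball p0 r) (\<lambda>p. X p v)" for v
    unfolding X_def
    by (rule smooth_linear_inverse) (use linG inS inj smooth_on_subset[OF smG r(3)] in auto)
  have linX: "linear (X p)" if "p \<in> ball p0 r" for p
    unfolding X_def
    using linear_compose[OF P(1) inj_linear_imp_inv_linear[OF linG[OF inS[OF that]] inj[OF that]]]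
    by (simp add: o_def)
  have PX: "P (X p d) = P d" if "p \<in> ball p0 r" for p d
    using PG[of p "X p d"] GX[OF that, of d] by (simp add: PP)
  have XD: "X p d \<in> D p" if p: "p \<in> ball p0 r" for p d
  proof (rule GT[OF inS[OF p]])
    have "P (X p d) + T (Om p (X p d)) = P d" using GX[OF p] by (simp add: G_def)
    then show "T (Om p (X p d)) = 0" using PX[OF p] by simp
  qed
  have DX: "X p x = x" if p: "p \<in> ball p0 r" and x: "x \<in> D p" for p x
  proof -
    have "Om p x = 0" using Om0[OF inS[OF p]] x by simp
    then have "G p x = P x" by (simp add: G_def linear_0[OF linT])
    then show ?thesis unfolding X_def using inv_f_f[OF inj[OF p], of x] by simp
  qed
  have DE: "D p \<subseteq> E" if "p \<in> S" "p \<in> E" for p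
    using cois[OF that] by (auto simp: D_def)
  define DX where "DX p v = frechet_derivative (\<lambda>p. X p v) (at p)" for p v
  have dX: "((\<lambda>p. X p v) has_derivative DX p v) (at p)" if "p \<in> ball p0 r" for p v
    unfolding DX_def using smooth_on_has_derivative[OF smX that] .
  define O' where "O' p u v = frechet_derivative (\<lambda>p. om p u v) (at p)" for p u v
  have domu: "(\<lambda>q. om q u v) differentiable (at p)" if "p \<in> S" for p u v
    using smooth_on_differentiable[OF sm that] .
  have commX: "DX p w (X p v) = DX p v (X p w)" if p: "p \<in> ball p0 r" and pE: "p \<in> E" for p v w
  proof -
    have pS: "p \<in> S" using inS[OF p] .
    note b = bil[OF pS]
    have XE: "X p v \<in> E" for v using XD[OF p] DE[OF pS pE] by auto
    \<comment> \<open>At points of \<open>E\<close> coisotropy puts \<open>D q\<close>, and with it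
      \<open>X q v\<close>, inside \<open>E\<close>. Derivatives in directions of \<open>E\<close>
      therefore stay in \<open>E\<close>, and \<open>om p\<close> vanishes on them against
      \<open>D p\<close>.\<close>
    have DXE: "DX p v e \<in> E" if e: "e \<in> E" for v e
    proof -
      have "((\<lambda>q. X q v - \<pi> (X q v)) has_derivative (\<lambda>e. DX p v e - \<pi> (DX p v e))) (at p)"
        by (intro has_derivative_diff dX p bounded_linear.has_derivative[of \<pi>])
          (use \<pi> in \<open>simp add: linear_conv_bounded_linear\<close>)
      note dz = derivative_along_subspace_zero[OF this open_ball p E(1) pE e, of 0]
      have "DX p v e - \<pi> (DX p v e) = 0"
      proof (rule dz)
        fix q assume q: "q \<in> ball p0 r" "q \<in> E"
        have "X q v \<in> E" using XD[OF q(1)] DE[OF inS[OF q(1)] q(2)] by auto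
        then show "X q v - \<pi> (X q v) = 0" using \<pi>(3) by simp
      qed
      then show ?thesis using \<pi>(2) by (metis right_minus_eq)
    qed
    have a: "O' p (X p v) w (X p v') + om p (DX p v (X p v')) w = 0" if w: "w \<in> E" for v v' w
    proof -
      have "((\<lambda>q. om q (X q v) w) has_derivative
          (\<lambda>e. O' p (X p v) w e + om p (DX p v e) w + om p (X p v) 0)) (at p)"
        unfolding O'_def
        by (rule bilinear_form_has_derivative[OF bil S(1) pS domu[OF pS] dX[OF p] has_derivative_const])
      note dz = derivative_along_subspace_zero[OF this open_ball p E(1) pE XE, of 0]
      have "O' p (X p v) w (X p v') + om p (DX p v (X p v')) w + om p (X p v) 0 = 0"
      proof (rule dz)
        fix q assume q: "q \<in> ball p0 r" "q \<in> E"
        show "om q (X q v) w = 0" using XD[OF q(1), of v] w by (simp add: D_def)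
      qed
      then show ?thesis by (simp add: bilinear_rzero[OF b])
    qed
    have c: "O' p (X p v) (X p w) z = 0" if z: "z \<in> E" for z
    proof -
      have "((\<lambda>q. om q (X q v) (X q w)) has_derivative
          (\<lambda>e. O' p (X p v) (X p w) e + om p (DX p v e) (X p w) + om p (X p v) (DX p w e))) (at p)"
        unfolding O'_def by (rule bilinear_form_has_derivative[OF bil S(1) pS domu[OF pS] dX[OF p] dX[OF p]])
      note dz = derivative_along_subspace_zero[OF this open_ball p E(1) pE z, of 0]
      have "O' p (X p v) (X p w) z + om p (DX p v z) (X p w) + om p (X p v) (DX p w z) = 0"
      proof (rule dz)
        fix q assume q: "q \<in> ball p0 r" "q \<in> E"
        have "X q w \<in> E" using XD[OF q(1)] DE[OF inS[OF q(1)] q(2)] by auto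
        then show "om q (X q v) (X q w) = 0" using XD[OF q(1), of v] by (simp add: D_def)
      qed
      moreover have "om p (X p v) (DX p w z) = 0" using XD[OF p, of v] DXE[OF z] by (auto simp: D_def)
      moreover have "om p (DX p v z) (X p w) = 0"
        using XD[OF p, of w] DXE[OF z, of v] alternating_antisym[OF b alt[OF pS], of "DX p v z" "X p w"] by (auto simp: D_def)
      ultimately show ?thesis by simp
    qed
    \<comment> \<open>\<open>B\<close> is the bracket of two frame fields up to sign.
      Differentiating along \<open>E\<close> the vanishing of the form on \<open>X v\<close> against
      \<open>w \<in> E\<close> and against \<open>X w\<close>, and inserting the results in the
      closedness identity, gives \<open>B \<in> D p\<close>. The constant projection
      \<open>P (X q v) = P v\<close> gives \<open>P B = 0\<close>, and \<open>X p\<close> recovers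
      an element of \<open>D p\<close> from its projection.\<close>
    define B where "B = DX p w (X p v) - DX p v (X p w)"
    have "B \<in> D p"
      unfolding D_def
    proof (intro CollectI ballI)
      fix z assume z: "z \<in> E"
      have "O' p z (X p v) e = - O' p (X p v) z e" for e
      proof -
        have "((\<lambda>q. om q z (X p v)) has_derivative (\<lambda>e. - O' p (X p v) z e)) (at p)"
        proof (rule has_derivative_transform_within_open[OF _ S(1) pS])
          show "((\<lambda>q. - om q (X p v) z) has_derivative (\<lambda>e. - O' p (X p v) z e)) (at p)"
            unfolding O'_def using domu[OF pS] frechet_derivative_works by (intro has_derivative_minus) blast
          show "- om q (X p v) z = om q z (X p v)" if "q \<in> S" for q
            using alternating_antisym[OF bil[OF that] alt[OF that], of z "X p v"] by simp
        qed
        from frechet_derivative_at[OF this] show ?thesis unfolding O'_def by metis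
      qed
      then have "O' p (X p w) z (X p v) - O' p (X p v) z (X p w) + O' p (X p v) (X p w) z = 0"
        using closed[OF pS, of "X p w" z "X p v", folded O'_def] by simp
      then have "O' p (X p w) z (X p v) = O' p (X p v) z (X p w)" using c[OF z] by simp
      then have "om p (DX p w (X p v)) z = om p (DX p v (X p w)) z" using a[OF z, of w v] a[OF z, of v w] by simp
      then show "om p B z = 0" by (simp add: B_def bilinear_lsub[OF b])
    qed
    moreover have "P B = 0"
    proof -
      have "P (DX p v e) = 0" for v e
      proof -
        have "((\<lambda>q. P (X q v)) has_derivative (\<lambda>e. P (DX p v e))) (at p)"
          by (intro bounded_linear.has_derivative[of P] dX p) (use P in \<open>simp add: linear_conv_bounded_linear\<close>)
        moreover have "((\<lambda>q. P (X q v)) has_derivative (\<lambda>e. 0)) (at p)"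
          by (rule has_derivative_transform_within_open[OF has_derivative_const open_ball p]) (simp add: PX)
        ultimately show ?thesis using has_derivative_unique by metis
      qed
      then show ?thesis by (simp add: B_def linear_diff[OF P(1)])
    qed
    ultimately have "B = 0"
    proof -
      assume B: "B \<in> D p" "P B = 0"
      have "B = X p B" using DX[OF p B(1)] by simp
      also have "\<dots> = X p (P B)" by (simp add: X_def PP)
      also have "\<dots> = 0" using linear_0[OF linX[OF p]] B by simp
      finally show ?thesis .
    qed
    then show ?thesis by (simp add: B_def)
  qed
  have \<pi>b: "\<pi> p \<in> ball p0 r" if "p \<in> ball p0 r" for p
  proof -
    have "norm (p0 - \<pi> p) = norm (\<pi> (p0 - p))" using \<pi>(3)[OF E(2)] by (simp add: linear_diff[OF \<pi>(1)])
    also have "\<dots> \<le> norm (p0 - p)" by (rule \<pi>(5))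
    finally show ?thesis using that by (simp add: dist_norm)
  qed
  have bl\<pi>: "bounded_linear \<pi>" using \<pi> by (simp add: linear_conv_bounded_linear)
  \<comment> \<open>The flow estimates require commutation on a full ball rather than on
    \<open>E\<close> alone. As \<open>F p v\<close> lies in \<open>E\<close> and is fixed by
    \<open>\<pi>\<close>, the identity for \<open>F\<close> at \<open>p\<close> is that for
    \<open>X\<close> at \<open>\<pi> p\<close>.\<close>
  define F where "F p d = X (\<pi> p) d" for p d
  have dF: "((\<lambda>p. F p v) has_derivative (\<lambda>e. DX (\<pi> p) v (\<pi> e))) (at p)" if "p \<in> ball p0 r" for p v
    unfolding F_def
    by (rule has_derivative_compose[OF bounded_linear_imp_has_derivative[OF bl\<pi>] dX[OF \<pi>b[OF that]]])
  have FE: "F p v \<in> E" if "p \<in> ball p0 r" for p v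
    unfolding F_def using XD[OF \<pi>b[OF that]] DE[OF inS[OF \<pi>b[OF that]] \<pi>(2)] by auto
  show thesis
  proof (rule that[of r P F])
    show "smooth_on (ball p0 r) (\<lambda>p. F p v)" for v
      unfolding F_def
      by (rule smooth_on_compose[OF open_ball open_ball smooth_on_bounded_linear[OF open_ball bl\<pi>] smX]) (use \<pi>b in auto)
    show "frechet_derivative (\<lambda>p. F p w) (at p) (F p v) = frechet_derivative (\<lambda>p. F p v) (at p) (F p w)"
      if p: "p \<in> ball p0 r" for p v w
      unfolding frechet_derivative_at[OF dF[OF p], symmetric] \<pi>(3)[OF FE[OF p]]
      unfolding F_def using commX[OF \<pi>b[OF p] \<pi>(2)] .
    show "range (F p) = {u. \<forall>v\<in>E. om p u v = 0}" if p: "p \<in> ball p0 r" "p \<in> E" for p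
      unfolding F_def \<pi>(3)[OF p(2)] D_def[symmetric]
    proof
      show "range (X p) \<subseteq> D p" using XD[OF p(1)] by auto
      show "D p \<subseteq> range (X p)" using DX[OF p(1)] by (metis rangeI subsetI)
    qed
    show "F p (P v) = F p v" for p v by (simp add: F_def X_def PP)
    show "P (F p v) = P v" if "p \<in> ball p0 r" for p v unfolding F_def using PX[OF \<pi>b[OF that]] .
    show "linear (F p)" if "p \<in> ball p0 r" for p unfolding F_def using linX[OF \<pi>b[OF that]] .
    show "om p0 (P x) v = 0" if "v \<in> E" for x v using P(2) that by (auto simp: D_def)
    show "P x = x" if "\<And>v. v \<in> E \<Longrightarrow> om p0 x v = 0" for x using P(3) that by (auto simp: D_def)
  qed (use r P FE in auto)
qed

section \<open>Charts and tangent vectors in coordinates\<close>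

definition chart_transition :: "'p set \<Rightarrow> ('p \<Rightarrow> 'e::real_normed_vector) \<Rightarrow> ('p \<Rightarrow> 'f::real_normed_vector) \<Rightarrow> 'p \<Rightarrow> 'e \<Rightarrow> 'f"
  where "chart_transition U \<psi> \<eta> x = frechet_derivative (\<eta> \<circ> inv_into U \<psi>) (at (\<psi> x))"

text \<open>A tangent vector at \<open>x\<close> is stored by its components in the chosen chart
  \<open>chart_at A x\<close>; this re-expresses it in \<open>\<psi>\<close>, and
  \<open>coord_tangent\<close> is the inverse conversion.\<close>

definition tangent_coord :: "('p, 'e::euclidean_space) chart set \<Rightarrow> ('p \<Rightarrow> 'e) \<Rightarrow> 'p \<Rightarrow> 'e \<Rightarrow> 'e"
  where "tangent_coord A \<psi> x = chart_transition (fst (chart_at A x)) (snd (chart_at A x)) \<psi> x"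

definition coord_tangent :: "('p, 'e::euclidean_space) chart set \<Rightarrow> 'p set \<Rightarrow> ('p \<Rightarrow> 'e) \<Rightarrow> 'p \<Rightarrow> 'e \<Rightarrow> 'e"
  where "coord_tangent A U \<psi> x = chart_transition U \<psi> (snd (chart_at A x)) x"

lemma inv_into_ident: "inv_into UNIV (\<lambda>x. x) = (\<lambda>x. x)"
  by (rule ext) (rule inv_into_f_f[of "\<lambda>x. x" UNIV], auto)

lemma chart_at_euclidean: "chart_at euclidean_atlas x = (UNIV, \<lambda>x. x)"
  unfolding chart_at_def euclidean_atlas_def by auto

lemma tangent_map_to_euclidean:
  "tangent_map A euclidean_atlas f x = chart_transition (fst (chart_at A x)) (snd (chart_at A x)) f x"
  unfolding tangent_map_def chart_at_euclidean chart_transition_def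
  by (simp add: case_prod_beta o_def)

lemma tangent_map_from_euclidean:
  "tangent_map euclidean_atlas A f t = frechet_derivative (snd (chart_at A (f t)) \<circ> f) (at t)"
  unfolding tangent_map_def chart_at_euclidean
  by (simp add: case_prod_beta inv_into_ident o_def)

text \<open>The orthogonal projection onto \<open>E\<close> does not change \<open>f\<close> near
  \<open>x\<close>, so by uniqueness of derivatives it does not change \<open>f'\<close>
  either.\<close>

lemma has_derivative_in_subspace:
  fixes f :: "'a::real_normed_vector \<Rightarrow> 'b::euclidean_space"
  assumes "(f has_derivative f') (at x)" "open S" "x \<in> S" "\<And>y. y \<in> S \<Longrightarrow> f y \<in> E" "subspace E"
  shows "f' v \<in> E"
proof -
  obtain \<pi> where \<pi>: "linear \<pi>" "\<And>x. \<pi> x \<in> E" "\<And>x. x \<in> E \<Longrightarrow> \<pi> x = x"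
    using ex_orthogonal_projection[OF assms(5)] by metis
  have "((\<lambda>y. \<pi> (f y)) has_derivative (\<lambda>v. \<pi> (f' v))) (at x)"
    using \<pi>(1) assms(1) bounded_linear.has_derivative by (auto simp: linear_conv_bounded_linear)
  then have "(f has_derivative (\<lambda>v. \<pi> (f' v))) (at x)"
    by (rule has_derivative_transform_within_open[OF _ assms(2,3)]) (use assms(4) \<pi>(3) in auto)
  then have "f' = (\<lambda>v. \<pi> (f' v))" using assms(1) has_derivative_unique by blast
  then show ?thesis using \<pi>(2) by metis
qed

locale atlas =
  fixes A :: "('p::topological_space, 'e::euclidean_space) chart set"
  assumes smooth_atlas: "smooth_atlas A"
begin

lemma atlas_compatible: "c \<in> A \<Longrightarrow> compatible_chart A c"
  using smooth_atlas by (simp add: compatible_chart_def insert_absorb)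

lemma chart_at: "chart_at A x \<in> A" "x \<in> fst (chart_at A x)"
proof -
  have "\<exists>c. c \<in> A \<and> x \<in> fst c" using smooth_atlas unfolding smooth_atlas_def by blast
  then show "chart_at A x \<in> A" "x \<in> fst (chart_at A x)"
    unfolding chart_at_def by (metis (mono_tags, lifting) someI_ex)+
qed

lemma chart_at_compatible: "compatible_chart A (fst (chart_at A x), snd (chart_at A x))"
  using atlas_compatible chart_at by simp

lemma compatible_chartD:
  assumes "compatible_chart A (U, \<psi>)"
  shows "open U" "open (\<psi> ` U)" "homeomorphism U (\<psi> ` U) \<psi> (inv_into U \<psi>)" "inj_on \<psi> U"
proof -
  have "is_chart (U, \<psi>)" using assms unfolding compatible_chart_def smooth_atlas_def by blast
  then show *: "open U" "open (\<psi> ` U)" "homeomorphism U (\<psi> ` U) \<psi> (inv_into U \<psi>)"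
    by (auto simp: is_chart_def)
  show "inj_on \<psi> U" using *(3) unfolding homeomorphism_def by (metis inj_on_inverseI)
qed

lemma chart_continuous:
  assumes "compatible_chart A (U, \<psi>)"
  shows "continuous_on U \<psi>" "continuous_on (\<psi> ` U) (inv_into U \<psi>)"
  using compatible_chartD(3)[OF assms] by (auto simp: homeomorphism_def)

lemma inv_chart:
  assumes "compatible_chart A (U, \<psi>)" "x \<in> U"
  shows "inv_into U \<psi> (\<psi> x) = x"
  using compatible_chartD(4)[OF assms(1)] assms(2) by simp

lemma open_chart_image:
  assumes "compatible_chart A (U, \<psi>)" "open W"
  shows "open (\<psi> ` (U \<inter> W))"
proof -
  note h = compatible_chartD(3)[OF assms(1)]
  have "\<psi> ` (U \<inter> W) = \<psi> ` U \<inter> inv_into U \<psi> -` W"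
    using inv_chart[OF assms(1)] by (auto simp: image_iff)
  then show ?thesis
    using continuous_on_open_vimage[OF compatible_chartD(2)[OF assms(1)]] chart_continuous(2)[OF assms(1)] assms(2)
    by (metis Int_commute)
qed

lemma atlas_transition_smooth:
  assumes "compatible_chart A (U, \<psi>)" "(V, \<theta>) \<in> A"
  shows "smooth_on (\<psi> ` (U \<inter> V)) (\<theta> \<circ> inv_into U \<psi>)" "smooth_on (\<theta> ` (V \<inter> U)) (\<psi> \<circ> inv_into V \<theta>)"
  using assms unfolding compatible_chart_def smooth_atlas_def by blast+

text \<open>Compatibility relates a chart to the members of \<open>A\<close> only. Near each common
  point the coordinate change between two compatible charts is factored through a chart of
  \<open>A\<close>.\<close>

lemma transition_smooth:
  assumes c: "compatible_chart A (U, \<psi>)" and d: "compatible_chart A (W, \<eta>)"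
  shows "smooth_on (\<psi> ` (U \<inter> W)) (\<eta> \<circ> inv_into U \<psi>)"
proof (rule smooth_on_local)
  fix p assume "p \<in> \<psi> ` (U \<inter> W)"
  then obtain x where x: "x \<in> U" "x \<in> W" "p = \<psi> x" by auto
  obtain V \<theta> where V: "(V, \<theta>) \<in> A" "x \<in> V" using chart_at[of x] by (metis prod.collapse)
  have cV: "compatible_chart A (V, \<theta>)" using V atlas_compatible by blast
  define T where "T = \<psi> ` (U \<inter> (W \<inter> V))"
  have oT: "open T" unfolding T_def
    by (intro open_chart_image c open_Int compatible_chartD(1)[OF d] compatible_chartD(1)[OF cV])
  have oV: "open (\<theta> ` (V \<inter> W))" by (intro open_chart_image cV compatible_chartD(1)[OF d])
  have "smooth_on T (\<lambda>q. (\<eta> \<circ> inv_into V \<theta>) ((\<theta> \<circ> inv_into U \<psi>) q))"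
  proof (rule smooth_on_compose[OF oT oV, where f = "\<theta> \<circ> inv_into U \<psi>" and g = "\<eta> \<circ> inv_into V \<theta>"])
    show "smooth_on T (\<theta> \<circ> inv_into U \<psi>)"
      by (rule smooth_on_subset[OF atlas_transition_smooth(1)[OF c V(1)]]) (auto simp: T_def)
    show "smooth_on (\<theta> ` (V \<inter> W)) (\<eta> \<circ> inv_into V \<theta>)" by (rule atlas_transition_smooth(2)[OF d V(1)])
    show "(\<theta> \<circ> inv_into U \<psi>) ` T \<subseteq> \<theta> ` (V \<inter> W)" by (auto simp: T_def inv_chart[OF c])
  qed
  then have "smooth_on T (\<eta> \<circ> inv_into U \<psi>)"
    by (rule smooth_on_cong[OF oT, rotated]) (auto simp: T_def inv_chart[OF c] inv_chart[OF cV])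
  moreover have "p \<in> T" using x V by (auto simp: T_def)
  ultimately show "\<exists>T. open T \<and> p \<in> T \<and> smooth_on T (\<eta> \<circ> inv_into U \<psi>)" using oT by blast
qed

lemma smooth_map_in_chart:
  fixes f :: "'p \<Rightarrow> 'f::euclidean_space"
  assumes c: "compatible_chart A (U, \<psi>)" and f: "smooth_map A euclidean_atlas UNIV f"
  shows "smooth_on (\<psi> ` U) (f \<circ> inv_into U \<psi>)"
proof (rule smooth_on_local)
  fix p assume "p \<in> \<psi> ` U"
  then obtain x where x: "x \<in> U" "p = \<psi> x" by auto
  obtain V \<theta> where V: "(V, \<theta>) \<in> A" "x \<in> V" using chart_at[of x] by (metis prod.collapse)
  have cV: "compatible_chart A (V, \<theta>)" using V atlas_compatible by blast
  have oT: "open (\<psi> ` (U \<inter> V))" by (intro open_chart_image c compatible_chartD(1)[OF cV])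
  have "smooth_on (\<theta> ` (V \<inter> UNIV \<inter> f -` UNIV)) ((\<lambda>x. x) \<circ> f \<circ> inv_into V \<theta>)"
    using f V(1) unfolding smooth_map_def euclidean_atlas_def by blast
  then have fV: "smooth_on (\<theta> ` V) (f \<circ> inv_into V \<theta>)" by (simp add: o_def)
  have "smooth_on (\<psi> ` (U \<inter> V)) (\<lambda>q. (f \<circ> inv_into V \<theta>) ((\<theta> \<circ> inv_into U \<psi>) q))"
    by (rule smooth_on_compose[OF oT compatible_chartD(2)[OF cV] transition_smooth[OF c cV] fV])
       (auto simp: inv_chart[OF c])
  then have "smooth_on (\<psi> ` (U \<inter> V)) (f \<circ> inv_into U \<psi>)"
    by (rule smooth_on_cong[OF oT, rotated]) (auto simp: inv_chart[OF c] inv_chart[OF cV])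
  then show "\<exists>T. open T \<and> p \<in> T \<and> smooth_on T (f \<circ> inv_into U \<psi>)" using oT x V by blast
qed

lemma transition_has_derivative:
  assumes c: "compatible_chart A (U, \<psi>)" and d: "compatible_chart A (W, \<eta>)" and x: "x \<in> U" "x \<in> W"
  shows "((\<eta> \<circ> inv_into U \<psi>) has_derivative chart_transition U \<psi> \<eta> x) (at (\<psi> x))"
  unfolding chart_transition_def
  by (rule smooth_on_has_derivative[OF transition_smooth[OF c d]]) (use x in auto)

lemma transition_linear:
  assumes "compatible_chart A (U, \<psi>)" "compatible_chart A (W, \<eta>)" "x \<in> U" "x \<in> W"
  shows "linear (chart_transition U \<psi> \<eta> x)"
  using has_derivative_linear[OF transition_has_derivative[OF assms]] .

lemma chart_chain_rule:
  fixes f :: "'p \<Rightarrow> 'f::real_normed_vector"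
  assumes c: "compatible_chart A (U, \<psi>)" and d: "compatible_chart A (W, \<eta>)" and x: "x \<in> U" "x \<in> W"
    and f: "(f \<circ> inv_into W \<eta>) differentiable (at (\<eta> x))"
  shows "chart_transition U \<psi> f x v = chart_transition W \<eta> f x (chart_transition U \<psi> \<eta> x v)"
    and "(f \<circ> inv_into U \<psi>) differentiable (at (\<psi> x))"
proof -
  have "((\<lambda>q. (f \<circ> inv_into W \<eta>) ((\<eta> \<circ> inv_into U \<psi>) q)) has_derivative
      (\<lambda>v. chart_transition W \<eta> f x (chart_transition U \<psi> \<eta> x v))) (at (\<psi> x))"
  proof (rule has_derivative_compose[OF transition_has_derivative[OF c d x]])
    have "(\<eta> \<circ> inv_into U \<psi>) (\<psi> x) = \<eta> x" by (simp add: inv_chart[OF c x(1)])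
    then show "(f \<circ> inv_into W \<eta> has_derivative chart_transition W \<eta> f x) (at ((\<eta> \<circ> inv_into U \<psi>) (\<psi> x)))"
      unfolding chart_transition_def using f frechet_derivative_works by metis
  qed
  then have "((f \<circ> inv_into U \<psi>) has_derivative
      (\<lambda>v. chart_transition W \<eta> f x (chart_transition U \<psi> \<eta> x v))) (at (\<psi> x))"
    by (rule has_derivative_transform_within_open[OF _ open_chart_image[OF c compatible_chartD(1)[OF d]]])
      (use x in \<open>auto simp: inv_chart[OF c] inv_chart[OF d]\<close>)
  then show "chart_transition U \<psi> f x v = chart_transition W \<eta> f x (chart_transition U \<psi> \<eta> x v)"
    "(f \<circ> inv_into U \<psi>) differentiable (at (\<psi> x))"
    by (auto simp: chart_transition_def frechet_derivative_at[symmetric] differentiable_def)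
qed

lemma transition_compose:
  assumes "compatible_chart A (U, \<psi>)" "compatible_chart A (W, \<eta>)" "compatible_chart A (V, \<theta>)"
    "x \<in> U" "x \<in> W" "x \<in> V"
  shows "chart_transition W \<eta> \<theta> x (chart_transition U \<psi> \<eta> x v) = chart_transition U \<psi> \<theta> x v"
  using chart_chain_rule(1)[OF assms(1,2,4,5)] transition_has_derivative[OF assms(2,3,5,6)] differentiable_def
  by metis

lemma transition_self:
  assumes c: "compatible_chart A (U, \<psi>)" and x: "x \<in> U"
  shows "chart_transition U \<psi> \<psi> x v = v"
proof -
  have "((\<psi> \<circ> inv_into U \<psi>) has_derivative (\<lambda>v. v)) (at (\<psi> x))"
    by (rule has_derivative_transform_within_open[OF has_derivative_ident compatible_chartD(2)[OF c]])
      (use x in \<open>auto simp: inv_chart[OF c]\<close>)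
  then show ?thesis unfolding chart_transition_def by (simp add: frechet_derivative_at[symmetric])
qed

lemma tangent_coord_inverse:
  assumes c: "compatible_chart A (U, \<psi>)" and x: "x \<in> U"
  shows "tangent_coord A \<psi> x (coord_tangent A U \<psi> x v) = v" "coord_tangent A U \<psi> x (tangent_coord A \<psi> x v) = v"
  unfolding tangent_coord_def coord_tangent_def
  using transition_compose[OF c chart_at_compatible c x chart_at(2) x] transition_self[OF c x]
    transition_compose[OF chart_at_compatible c chart_at_compatible chart_at(2) x chart_at(2)]
    transition_self[OF chart_at_compatible chart_at(2)]
  by auto

lemma tangent_coord_linear:
  assumes c: "compatible_chart A (U, \<psi>)" and x: "x \<in> U"
  shows "linear (tangent_coord A \<psi> x)" "linear (coord_tangent A U \<psi> x)"
  unfolding tangent_coord_def coord_tangent_def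
  by (auto intro!: transition_linear chart_at_compatible c x chart_at)

lemma tangent_coord_transition:
  assumes c: "compatible_chart A (U, \<psi>)" and d: "compatible_chart A (W, \<eta>)" and x: "x \<in> U" "x \<in> W"
  shows "tangent_coord A \<eta> x v = chart_transition U \<psi> \<eta> x (tangent_coord A \<psi> x v)"
    "coord_tangent A U \<psi> x v = coord_tangent A W \<eta> x (chart_transition U \<psi> \<eta> x v)"
  unfolding tangent_coord_def coord_tangent_def
  using transition_compose[OF chart_at_compatible c d chart_at(2) x]
    transition_compose[OF c d chart_at_compatible x chart_at(2)] by auto

lemma differential_in_chart:
  assumes c: "compatible_chart A (U, \<psi>)" and x: "x \<in> U"
    and f: "smooth_map A euclidean_atlas UNIV f"
  shows "differential A f x v = frechet_derivative (f \<circ> inv_into U \<psi>) (at (\<psi> x)) (tangent_coord A \<psi> x v)"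
  unfolding tangent_map_to_euclidean tangent_coord_def
  using chart_chain_rule(1)[OF chart_at_compatible c chart_at(2) x
      smooth_on_differentiable[OF smooth_map_in_chart[OF c f]]] x
  by (auto simp: chart_transition_def)

lemma velocity_in_chart:
  assumes c: "compatible_chart A (U, \<psi>)" and x: "\<gamma> 0 \<in> U" and S: "open S" "0 \<in> S" "continuous_on S \<gamma>"
    and d: "((snd (chart_at A (\<gamma> 0))) \<circ> \<gamma>) differentiable (at 0)"
  shows "((\<psi> \<circ> \<gamma>) has_derivative (\<lambda>t. t *\<^sub>R tangent_coord A \<psi> (\<gamma> 0) (velocity A \<gamma>))) (at 0)"
proof -
  define W where "W = fst (chart_at A (\<gamma> 0))"
  define \<eta> where "\<eta> = snd (chart_at A (\<gamma> 0))"
  have cW: "compatible_chart A (W, \<eta>)" and xW: "\<gamma> 0 \<in> W"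
    using chart_at_compatible chart_at by (auto simp: W_def \<eta>_def)
  have "((\<lambda>t. (\<psi> \<circ> inv_into W \<eta>) ((\<eta> \<circ> \<gamma>) t)) has_derivative
      (\<lambda>t. chart_transition W \<eta> \<psi> (\<gamma> 0) (frechet_derivative (\<eta> \<circ> \<gamma>) (at 0) t))) (at 0)"
    by (rule has_derivative_compose[where f = "\<eta> \<circ> \<gamma>" and g = "\<psi> \<circ> inv_into W \<eta>"])
      (use d transition_has_derivative[OF cW c xW x] in \<open>simp_all add: \<eta>_def frechet_derivative_works\<close>)
  then have "((\<psi> \<circ> \<gamma>) has_derivative
      (\<lambda>t. chart_transition W \<eta> \<psi> (\<gamma> 0) (frechet_derivative (\<eta> \<circ> \<gamma>) (at 0) t))) (at 0)"
  proof (rule has_derivative_transform_within_open)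
    show "open (S \<inter> \<gamma> -` W)"
      using S compatible_chartD(1)[OF cW] continuous_on_open_vimage by (metis Int_commute)
  qed (use S xW in \<open>auto simp: inv_chart[OF cW]\<close>)
  moreover have "frechet_derivative (\<eta> \<circ> \<gamma>) (at 0) t = t *\<^sub>R velocity A \<gamma>" for t
    unfolding tangent_map_from_euclidean \<eta>_def
    using linear_scale[OF linear_frechet_derivative[OF d], of t 1] by simp
  ultimately show ?thesis
    unfolding tangent_coord_def W_def[symmetric] \<eta>_def[symmetric]
    using linear_scale[OF transition_linear[OF cW c xW x]] by simp
qed

text \<open>In slice coordinates a curve in \<open>N\<close> has its velocity in \<open>E\<close>;
  conversely, a short straight segment through \<open>\<psi> x\<close> in a direction of
  \<open>E\<close> is a smooth curve in \<open>N\<close> with that velocity.\<close>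

lemma tangent_space_slice:
  assumes c: "compatible_chart A (U, \<psi>)" and x: "x \<in> U" "x \<in> N" and E: "subspace E"
    and N: "U \<inter> N = {y \<in> U. \<psi> y \<in> E}"
  shows "tangent_space A N x = {v. tangent_coord A \<psi> x v \<in> E}"
proof (intro set_eqI iffI)
  fix v assume "v \<in> tangent_space A N x"
  then obtain \<gamma> \<epsilon> where g: "v = velocity A \<gamma>" "\<epsilon> > 0" "smooth_map euclidean_atlas A {-\<epsilon><..<\<epsilon>} \<gamma>"
    "\<gamma> 0 = x" "\<And>t. t \<in> {-\<epsilon><..<\<epsilon>} \<Longrightarrow> \<gamma> t \<in> N"
    unfolding tangent_space_def by blast
  have cont: "continuous_on {-\<epsilon><..<\<epsilon>} \<gamma>" using g(3) by (simp add: smooth_map_def)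
  define W where "W = fst (chart_at A x)"
  define \<eta> where "\<eta> = snd (chart_at A x)"
  have "(W, \<eta>) \<in> A" "x \<in> W" using chart_at by (auto simp: W_def \<eta>_def)
  then have "smooth_on ((\<lambda>x. x) ` (UNIV \<inter> {-\<epsilon><..<\<epsilon>} \<inter> \<gamma> -` W)) (\<eta> \<circ> \<gamma> \<circ> inv_into UNIV (\<lambda>x. x))"
    using g(3) unfolding smooth_map_def euclidean_atlas_def by blast
  then have "(\<eta> \<circ> \<gamma> \<circ> inv_into UNIV (\<lambda>x. x)) differentiable (at 0)"
    by (rule smooth_on_differentiable) (use g \<open>x \<in> W\<close> in auto)
  then have "(snd (chart_at A (\<gamma> 0)) \<circ> \<gamma>) differentiable (at 0)"
    unfolding inv_into_ident g(4) by (simp add: \<eta>_def o_def)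
  from velocity_in_chart[OF c _ open_greaterThanLessThan _ cont this]
  have "((\<psi> \<circ> \<gamma>) has_derivative (\<lambda>t. t *\<^sub>R tangent_coord A \<psi> x v)) (at 0)"
    using g x by simp
  then have "1 *\<^sub>R tangent_coord A \<psi> x v \<in> E"
  proof (rule has_derivative_in_subspace[OF _ _ _ _ E])
    show "open ({-\<epsilon><..<\<epsilon>} \<inter> \<gamma> -` U)"
      using cont compatible_chartD(1)[OF c] continuous_on_open_vimage[OF open_greaterThanLessThan]
      by (metis Int_commute)
    show "(\<psi> \<circ> \<gamma>) t \<in> E" if "t \<in> {-\<epsilon><..<\<epsilon>} \<inter> \<gamma> -` U" for t
      using that g(5)[of t] N by auto
  qed (use g x in auto)
  then show "v \<in> {v. tangent_coord A \<psi> x v \<in> E}" by simp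
next
  fix v assume "v \<in> {v. tangent_coord A \<psi> x v \<in> E}"
  then have w: "tangent_coord A \<psi> x v \<in> E" by simp
  define w where "w = tangent_coord A \<psi> x v"
  define l where "l t = \<psi> x + t *\<^sub>R w" for t :: real
  define \<gamma> where "\<gamma> t = inv_into U \<psi> (l t)" for t
  have ol: "open (l -` \<psi> ` U)" unfolding l_def
    by (intro open_vimage compatible_chartD(2)[OF c] continuous_intros)
  moreover have "0 \<in> l -` \<psi> ` U" using x by (auto simp: l_def)
  ultimately obtain \<epsilon> where e: "\<epsilon> > 0" "ball 0 \<epsilon> \<subseteq> l -` \<psi> ` U" using openE by blast
  have b: "{-\<epsilon><..<\<epsilon>} = ball 0 \<epsilon>" by (auto simp: dist_real_def)
  have lU: "l t \<in> \<psi> ` U" if "t \<in> {-\<epsilon><..<\<epsilon>}" for t using that e b by auto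
  have \<psi>\<gamma>: "\<gamma> t \<in> U" "\<psi> (\<gamma> t) = l t" if "t \<in> {-\<epsilon><..<\<epsilon>}" for t
    using lU[OF that] by (auto simp: \<gamma>_def inv_chart[OF c])
  have g0: "\<gamma> 0 = x" by (simp add: \<gamma>_def l_def inv_chart[OF c x(1)])
  have cont: "continuous_on {-\<epsilon><..<\<epsilon>} \<gamma>"
    unfolding \<gamma>_def by (rule continuous_on_compose2[OF chart_continuous(2)[OF c]])
      (use lU in \<open>auto simp: l_def intro!: continuous_intros\<close>)
  have sml: "smooth_on T l" if "open T" for T
    unfolding l_def
    by (intro smooth_on_add that smooth_on_const smooth_on_bounded_linear[OF _ bounded_linear_scaleR_left])
  have sm: "smooth_on ({-\<epsilon><..<\<epsilon>} \<inter> \<gamma> -` W) (\<eta> \<circ> \<gamma>)" if cW: "compatible_chart A (W, \<eta>)" for W \<eta>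
  proof -
    have o: "open ({-\<epsilon><..<\<epsilon>} \<inter> \<gamma> -` W)"
      using cont compatible_chartD(1)[OF cW] continuous_on_open_vimage[OF open_greaterThanLessThan]
      by (metis Int_commute)
    have "smooth_on ({-\<epsilon><..<\<epsilon>} \<inter> \<gamma> -` W) (\<lambda>t. (\<eta> \<circ> inv_into U \<psi>) (l t))"
    proof (rule smooth_on_compose[OF o open_chart_image[OF c compatible_chartD(1)[OF cW]] sml[OF o] transition_smooth[OF c cW]])
      show "l ` ({-\<epsilon><..<\<epsilon>} \<inter> \<gamma> -` W) \<subseteq> \<psi> ` (U \<inter> W)"
        using \<psi>\<gamma> by (auto simp: image_iff) (metis IntI)
    qed
    then show ?thesis by (simp add: \<gamma>_def o_def)
  qed
  have "smooth_map euclidean_atlas A {-\<epsilon><..<\<epsilon>} \<gamma>"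
  proof -
    have "smooth_on ({-\<epsilon><..<\<epsilon>} \<inter> \<gamma> -` fst d) (\<lambda>t. snd d (\<gamma> t))" if "d \<in> A" for d
      using sm[of "fst d" "snd d"] atlas_compatible[OF that] by (simp add: o_def)
    then show ?thesis
      by (simp add: smooth_map_def euclidean_atlas_def case_prod_beta inv_into_ident o_def cont)
  qed
  moreover have "\<gamma> t \<in> N" if "t \<in> {-\<epsilon><..<\<epsilon>}" for t
  proof -
    have "\<psi> x \<in> E" using x N by auto
    then have "l t \<in> E" using w E by (simp add: l_def w_def subspace_add subspace_scale)
    then have "\<gamma> t \<in> {y \<in> U. \<psi> y \<in> E}" using \<psi>\<gamma>[OF that] by simp
    then show ?thesis using N by blast
  qed
  moreover have "velocity A \<gamma> = v"
  proof -
    have "(snd (chart_at A (\<gamma> 0)) \<circ> \<gamma>) differentiable (at 0)"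
      by (rule smooth_on_differentiable[OF sm[OF chart_at_compatible]]) (use e g0 chart_at in auto)
    from velocity_in_chart[OF c _ open_greaterThanLessThan _ cont this]
    have "((\<psi> \<circ> \<gamma>) has_derivative (\<lambda>t. t *\<^sub>R tangent_coord A \<psi> x (velocity A \<gamma>))) (at 0)"
      using e x g0 by simp
    moreover have "((\<psi> \<circ> \<gamma>) has_derivative (\<lambda>t. t *\<^sub>R w)) (at 0)"
    proof (rule has_derivative_transform_within_open[OF _ open_greaterThanLessThan[of "-\<epsilon>" \<epsilon>]])
      show "(l has_derivative (\<lambda>t. t *\<^sub>R w)) (at 0)" unfolding l_def by (auto intro!: derivative_eq_intros)
    qed (use e \<psi>\<gamma> in auto)
    ultimately have "(\<lambda>t. t *\<^sub>R tangent_coord A \<psi> x (velocity A \<gamma>)) = (\<lambda>t::real. t *\<^sub>R w)"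
      by (rule has_derivative_unique)
    from fun_cong[OF this, of 1] have "tangent_coord A \<psi> x (velocity A \<gamma>) = tangent_coord A \<psi> x v"
      by (simp add: w_def)
    then show ?thesis using tangent_coord_inverse(2)[OF c x(1)] by metis
  qed
  ultimately show "v \<in> tangent_space A N x"
    unfolding tangent_space_def using e(1) g0 by blast
qed

section \<open>Two-forms in coordinates\<close>

lemma chart_form_eq:
  assumes c: "compatible_chart A (U, \<psi>)" and x: "x \<in> U"
  shows "chart_form A \<omega> U \<psi> (\<psi> x) u v = \<omega> x (coord_tangent A U \<psi> x u) (coord_tangent A U \<psi> x v)"
  unfolding chart_form_def tangent_map_from_euclidean coord_tangent_def chart_transition_def
  by (simp add: inv_chart[OF c x])

lemma form_eq_chart_form:
  assumes c: "compatible_chart A (U, \<psi>)" and x: "x \<in> U"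
  shows "\<omega> x u v = chart_form A \<omega> U \<psi> (\<psi> x) (tangent_coord A \<psi> x u) (tangent_coord A \<psi> x v)"
  by (simp add: chart_form_eq[OF c x] tangent_coord_inverse[OF c x])

lemma chart_form_transition:
  assumes c: "compatible_chart A (U, \<psi>)" and d: "compatible_chart A (W, \<eta>)" and x: "x \<in> U" "x \<in> W"
  shows "chart_form A \<omega> U \<psi> (\<psi> x) u v =
    chart_form A \<omega> W \<eta> (\<eta> x) (chart_transition U \<psi> \<eta> x u) (chart_transition U \<psi> \<eta> x v)"
  unfolding chart_form_eq[OF c x(1)] chart_form_eq[OF d x(2)] tangent_coord_transition(2)[OF c d x] ..

lemma chart_form_bilinear:
  assumes c: "compatible_chart A (U, \<psi>)" and p: "p \<in> \<psi> ` U" and "\<And>x. bilinear (\<omega> x)"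
  shows "bilinear (chart_form A \<omega> U \<psi> p)"
proof -
  obtain x where x: "x \<in> U" "p = \<psi> x" using p by auto
  have l: "linear (coord_tangent A U \<psi> x)" using tangent_coord_linear[OF c x(1)] by blast
  show ?thesis
    unfolding bilinear_def x(2) chart_form_eq[OF c x(1)]
    by (auto intro!: linearI
        simp: linear_add[OF l] linear_scale[OF l] bilinear_ladd[OF assms(3)] bilinear_radd[OF assms(3)]
          bilinear_lmul[OF assms(3)] bilinear_rmul[OF assms(3)])
qed

end

text \<open>In finite dimension the injective map that sends \<open>x\<close> to the vector
  representing \<open>f x\<close> is onto. For a symplectic form and a differential this produces
  the Hamiltonian vector.\<close>

lemma nondegenerate_representation:
  fixes f :: "'e::euclidean_space \<Rightarrow> 'e \<Rightarrow> real"
  assumes f: "bilinear f" and nd: "\<And>u. (\<And>v. f u v = 0) \<Longrightarrow> u = 0" and g: "linear g"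
  shows "\<exists>!X. \<forall>v. f X v = g v"
proof -
  define Om where "Om x = (\<Sum>b\<in>Basis. f x b *\<^sub>R b)" for x
  have Om: "Om x \<bullet> v = f x v" for x v
    unfolding linear_Basis_expansion[OF bilinear_linear_right[OF f], of x v] Om_def
    by (simp add: inner_sum_left mult.commute inner_commute[of v])
  have lin: "linear Om" unfolding Om_def
    by (intro linear_compose_sum ballI linearI)
      (auto simp: bilinear_ladd[OF f] bilinear_lmul[OF f] scaleR_left_distrib)
  have inj: "inj Om" unfolding linear_injective_0[OF lin]
  proof (intro allI impI)
    fix x assume "Om x = 0"
    then have "f x v = 0" for v using Om[of x v] by simp
    then show "x = 0" using nd by blast
  qed
  then obtain X where X: "Om X = (\<Sum>b\<in>Basis. g b *\<^sub>R b)"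
    using linear_injective_imp_surjective[OF lin inj] by (metis surjD)
  have "f X v = g v" for v
    unfolding Om[symmetric] X linear_Basis_expansion[OF g, of v]
    by (simp add: inner_sum_left mult.commute inner_commute[of v])
  moreover have "Y = X" if "\<forall>v. f Y v = g v" for Y
  proof -
    have "f (Y - X) v = 0" for v using that \<open>\<And>v. f X v = g v\<close> by (simp add: bilinear_lsub[OF f])
    then show ?thesis using nd by (metis right_minus_eq)
  qed
  ultimately show ?thesis by blast
qed

section \<open>Differentials, and new charts from local diffeomorphisms\<close>

context atlas begin

lemma differential_linear:
  assumes "smooth_map A euclidean_atlas UNIV f"
  shows "linear (differential A f x)"
proof -
  have c: "compatible_chart A (fst (chart_at A x), snd (chart_at A x))" by (rule chart_at_compatible)
  have "((f \<circ> inv_into (fst (chart_at A x)) (snd (chart_at A x)))) differentiable (at (snd (chart_at A x) x))"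
    by (rule smooth_on_differentiable[OF smooth_map_in_chart[OF c assms]]) (use chart_at in auto)
  then show ?thesis
    unfolding tangent_map_to_euclidean chart_transition_def by (rule linear_frechet_derivative)
qed

text \<open>The charts that straighten plaques arise by following a slice chart with a local
  diffeomorphism \<open>\<theta>\<close> of the model space. Its smooth inverse
  \<open>\<tau>\<close> keeps the transition maps smooth in both directions and makes the inverse of
  the new chart explicit.\<close>

lemma compatible_chart_compose:
  assumes c: "compatible_chart A (U, \<psi>)" and T: "open T" "T \<subseteq> \<psi> ` U" "open (\<theta> ` T)"
    and sm: "smooth_on T \<theta>" "smooth_on (\<theta> ` T) \<tau>" and inv: "\<And>p. p \<in> T \<Longrightarrow> \<tau> (\<theta> p) = p"
  shows "compatible_chart A (U \<inter> \<psi> -` T, \<theta> \<circ> \<psi>)"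
    and "q \<in> \<theta> ` T \<Longrightarrow> inv_into (U \<inter> \<psi> -` T) (\<theta> \<circ> \<psi>) q = inv_into U \<psi> (\<tau> q)"
    and "(\<theta> \<circ> \<psi>) ` (U \<inter> \<psi> -` T) = \<theta> ` T"
proof -
  define U' where "U' = U \<inter> \<psi> -` T"
  have oU': "open U'"
    unfolding U'_def using chart_continuous(1)[OF c] compatible_chartD(1)[OF c] T(1) continuous_on_open_vimage
    by (metis Int_commute)
  have \<psi>U': "\<psi> ` U' = T" using T(2) by (auto simp: U'_def)
  show im: "(\<theta> \<circ> \<psi>) ` (U \<inter> \<psi> -` T) = \<theta> ` T" using \<psi>U' by (metis U'_def image_comp)
  have inj: "inj_on (\<theta> \<circ> \<psi>) U'"
  proof (rule inj_on_inverseI[of _ "\<lambda>q. inv_into U \<psi> (\<tau> q)"])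
    fix x assume "x \<in> U'"
    then show "inv_into U \<psi> (\<tau> ((\<theta> \<circ> \<psi>) x)) = x" using inv inv_chart[OF c] by (auto simp: U'_def)
  qed
  have inv': "inv_into U' (\<theta> \<circ> \<psi>) q = inv_into U \<psi> (\<tau> q)" if q: "q \<in> \<theta> ` T" for q
  proof -
    obtain x where x: "x \<in> U'" "q = \<theta> (\<psi> x)" using q unfolding \<psi>U'[symmetric] by blast
    then show ?thesis using inv_into_f_f[OF inj x(1)] inv inv_chart[OF c] by (auto simp: U'_def)
  qed
  then show "q \<in> \<theta> ` T \<Longrightarrow> inv_into (U \<inter> \<psi> -` T) (\<theta> \<circ> \<psi>) q = inv_into U \<psi> (\<tau> q)" by (simp add: U'_def)
  have \<tau>T: "\<tau> q \<in> T" if "q \<in> \<theta> ` T" for q using that inv by auto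
  have cont\<tau>: "continuous_on (\<theta> ` T) (\<lambda>q. inv_into U \<psi> (\<tau> q))"
    by (rule continuous_on_compose2[OF chart_continuous(2)[OF c] smooth_on_continuous_on[OF sm(2)]])
      (use \<tau>T T in auto)
  have cont: "continuous_on U' (\<theta> \<circ> \<psi>)"
    by (rule continuous_on_compose[OF continuous_on_subset[OF chart_continuous(1)[OF c]]])
      (use smooth_on_continuous_on[OF sm(1)] \<psi>U' in \<open>auto simp: U'_def intro: continuous_on_subset\<close>)
  have im': "(\<theta> \<circ> \<psi>) ` U' = \<theta> ` T" using im by (simp add: U'_def)
  have ch: "is_chart (U', \<theta> \<circ> \<psi>)"
    unfolding is_chart_def prod.case im'
  proof (intro conjI oU' T(3), rule homeomorphismI)
    show "continuous_on (\<theta> ` T) (inv_into U' (\<theta> \<circ> \<psi>))"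
      using cont\<tau> inv' by (simp cong: continuous_on_cong)
    show "inv_into U' (\<theta> \<circ> \<psi>) ` \<theta> ` T \<subseteq> U'"
      unfolding im'[symmetric] by (auto simp: inv_into_into simp del: o_apply)
    show "(\<theta> \<circ> \<psi>) (inv_into U' (\<theta> \<circ> \<psi>) y) = y" if "y \<in> \<theta> ` T" for y
      using that unfolding im'[symmetric] by (rule f_inv_into_f)
  qed (use cont im' inv_into_f_f[OF inj] in auto)
  have s1: "smooth_on ((\<theta> \<circ> \<psi>) ` (U' \<inter> W)) (\<eta> \<circ> inv_into U' (\<theta> \<circ> \<psi>))"
    and s2: "smooth_on (\<eta> ` (W \<inter> U')) ((\<theta> \<circ> \<psi>) \<circ> inv_into W \<eta>)" if W: "(W, \<eta>) \<in> A" for W \<eta>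
  proof -
    have cW: "compatible_chart A (W, \<eta>)" using W atlas_compatible by blast
    have oW: "open W" using compatible_chartD(1)[OF cW] .
    define B where "B = (\<theta> \<circ> \<psi>) ` (U' \<inter> W)"
    have B: "B = \<theta> ` T \<inter> (\<lambda>q. inv_into U \<psi> (\<tau> q)) -` W"
      unfolding B_def im'[symmetric] using inv inv_chart[OF c] by (auto simp: U'_def)
    have oB: "open B" unfolding B using cont\<tau> T(3) oW continuous_on_open_vimage by (metis Int_commute)
    have "smooth_on B (\<lambda>q. (\<eta> \<circ> inv_into U \<psi>) (\<tau> q))"
    proof (rule smooth_on_compose[OF oB open_chart_image[OF c oW] _ transition_smooth[OF c cW]])
      show "smooth_on B \<tau>" by (rule smooth_on_subset[OF sm(2)]) (auto simp: B)
      show "\<tau> ` B \<subseteq> \<psi> ` (U \<inter> W)"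
        unfolding B_def using inv by (auto simp: U'_def)
    qed
    then show "smooth_on ((\<theta> \<circ> \<psi>) ` (U' \<inter> W)) (\<eta> \<circ> inv_into U' (\<theta> \<circ> \<psi>))"
      unfolding B_def[symmetric] by (rule smooth_on_cong[OF oB, rotated]) (use inv' in \<open>auto simp: B\<close>)
    have oC: "open (\<eta> ` (W \<inter> U'))" by (rule open_chart_image[OF cW oU'])
    have "smooth_on (\<eta> ` (W \<inter> U')) (\<psi> \<circ> inv_into W \<eta>)"
      by (rule smooth_on_subset[OF transition_smooth[OF cW c]]) (auto simp: U'_def)
    moreover have "(\<psi> \<circ> inv_into W \<eta>) ` \<eta> ` (W \<inter> U') \<subseteq> T"
      using inv_chart[OF cW] by (auto simp: U'_def)
    ultimately have "smooth_on (\<eta> ` (W \<inter> U')) (\<lambda>q. \<theta> ((\<psi> \<circ> inv_into W \<eta>) q))"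
      using smooth_on_compose[OF oC T(1) _ sm(1)] by blast
    then show "smooth_on (\<eta> ` (W \<inter> U')) ((\<theta> \<circ> \<psi>) \<circ> inv_into W \<eta>)" by (simp add: o_def)
  qed
  have s3: "smooth_on ((\<theta> \<circ> \<psi>) ` (U' \<inter> U')) ((\<theta> \<circ> \<psi>) \<circ> inv_into U' (\<theta> \<circ> \<psi>))"
    unfolding Int_absorb im'
    by (rule smooth_on_cong[OF T(3) _ smooth_on_ident[OF T(3)]])
      (metis im' f_inv_into_f o_apply)
  have "smooth_atlas (insert (U', \<theta> \<circ> \<psi>) A)"
    unfolding smooth_atlas_def case_prod_beta
  proof (intro conjI ballI)
    show "is_chart d" if "d \<in> insert (U', \<theta> \<circ> \<psi>) A" for d
      using that ch smooth_atlas unfolding smooth_atlas_def by blast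
    show "(\<Union>c\<in>insert (U', \<theta> \<circ> \<psi>) A. fst c) = UNIV" using smooth_atlas unfolding smooth_atlas_def by blast
    fix d e assume d: "d \<in> insert (U', \<theta> \<circ> \<psi>) A" and e: "e \<in> insert (U', \<theta> \<circ> \<psi>) A"
    show "smooth_on (snd d ` (fst d \<inter> fst e)) (snd e \<circ> inv_into (fst d) (snd d))"
    proof (cases "d \<in> A")
      case True
      show ?thesis
      proof (cases "e \<in> A")
        case True
        then show ?thesis using \<open>d \<in> A\<close> smooth_atlas unfolding smooth_atlas_def by (force simp: case_prod_beta)
      next
        case False
        then show ?thesis using e s2[of "fst d" "snd d"] True by auto
      qed
    next
      case False
      then have "d = (U', \<theta> \<circ> \<psi>)" using d by simp
      then show ?thesis using e s1[of "fst e" "snd e"] s3 by (cases "e \<in> A") auto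
    qed
  qed
  then show "compatible_chart A (U \<inter> \<psi> -` T, \<theta> \<circ> \<psi>)" by (simp add: compatible_chart_def U'_def)
qed

end

section \<open>The symplectic form in arbitrary compatible charts\<close>

locale symplectic = atlas A
  for A :: "('p::topological_space, 'e::euclidean_space) chart set" +
  fixes \<omega> :: "'p \<Rightarrow> 'e \<Rightarrow> 'e \<Rightarrow> real"
  assumes symplectic: "symplectic_manifold A \<omega>"
begin

lemma form_bilinear: "bilinear (\<omega> x)"
  and form_alternating: "\<omega> x u u = 0"
  and form_nondegenerate: "(\<And>v. \<omega> x u v = 0) \<Longrightarrow> u = 0"
  using symplectic unfolding symplectic_manifold_def smooth_two_form_def by blast+

lemma form_antisym: "\<omega> x u v = - \<omega> x v u"
  by (rule alternating_antisym[OF form_bilinear form_alternating])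

lemma hamiltonian_vector_field:
  assumes "smooth_map A euclidean_atlas UNIV H"
  shows "\<omega> z (hamiltonian_vector_field A \<omega> H z) v = differential A H z v"
proof -
  have "\<exists>!X. \<forall>v. \<omega> z X v = differential A H z v"
    by (rule nondegenerate_representation[OF form_bilinear form_nondegenerate differential_linear[OF assms]])
  from theI'[OF this] show ?thesis unfolding hamiltonian_vector_field_def by blast
qed

context
  fixes U :: "'p set" and \<psi> :: "'p \<Rightarrow> 'e"
  assumes c: "compatible_chart A (U, \<psi>)"
begin

lemma chart_form_alternating: "p \<in> \<psi> ` U \<Longrightarrow> chart_form A \<omega> U \<psi> p u u = 0"
  using chart_form_eq[OF c] form_alternating by auto

lemma chart_form_nondegenerate:
  assumes "p \<in> \<psi> ` U" "\<And>v. chart_form A \<omega> U \<psi> p u v = 0"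
  shows "u = 0"
proof -
  obtain x where x: "x \<in> U" "p = \<psi> x" using assms by auto
  have "\<omega> x (coord_tangent A U \<psi> x u) v = 0" for v
    using assms(2)[of "tangent_coord A \<psi> x v"] unfolding x(2) chart_form_eq[OF c x(1)]
      tangent_coord_inverse[OF c x(1)] .
  then have "coord_tangent A U \<psi> x u = 0" using form_nondegenerate by blast
  then have "tangent_coord A \<psi> x (coord_tangent A U \<psi> x u) = 0"
    using linear_0[OF tangent_coord_linear(1)[OF c x(1)]] by simp
  then show ?thesis by (simp add: tangent_coord_inverse[OF c x(1)])
qed

text \<open>Smoothness and closedness are postulated in charts of \<open>A\<close> and are pulled
  back here along the coordinate change \<open>\<sigma>\<close>. Differentiation produces extra
  terms with second derivatives of \<open>\<sigma>\<close>; these are symmetric and cancel in the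
  cyclic sum because the form is antisymmetric.\<close>

lemma chart_form_local:
  assumes V: "(V, \<theta>) \<in> A"
  defines "\<sigma> \<equiv> \<theta> \<circ> inv_into U \<psi>"
  shows "smooth_on (\<psi> ` (U \<inter> V)) (\<lambda>p. chart_form A \<omega> U \<psi> p u v)"
    and "p \<in> \<psi> ` (U \<inter> V) \<Longrightarrow> frechet_derivative (\<lambda>p. chart_form A \<omega> U \<psi> p v w) (at p) u +
        frechet_derivative (\<lambda>p. chart_form A \<omega> U \<psi> p w u) (at p) v +
        frechet_derivative (\<lambda>p. chart_form A \<omega> U \<psi> p u v) (at p) w = 0"
proof -
  have cV: "compatible_chart A (V, \<theta>)" using V atlas_compatible by blast
  define T where "T = \<psi> ` (U \<inter> V)"
  have oT: "open T" unfolding T_def by (rule open_chart_image[OF c compatible_chartD(1)[OF cV]])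
  have sm\<sigma>: "smooth_on T \<sigma>" unfolding T_def \<sigma>_def by (rule transition_smooth[OF c cV])
  have \<sigma>T: "\<sigma> ` T \<subseteq> \<theta> ` V" by (auto simp: T_def \<sigma>_def inv_chart[OF c])
  define cf where "cf q = chart_form A \<omega> V \<theta> q" for q
  define D where "D p = frechet_derivative \<sigma> (at p)" for p
  have smD: "smooth_on T (\<lambda>p. D p u)" for u
    unfolding D_def by (rule smooth_on_frechet_derivative[OF sm\<sigma>])
  have eq: "chart_form A \<omega> U \<psi> p u v = cf (\<sigma> p) (D p u) (D p v)" if p: "p \<in> T" for p u v
  proof -
    obtain x where x: "x \<in> U" "x \<in> V" "p = \<psi> x" using p by (auto simp: T_def)
    then show ?thesis using chart_form_transition[OF c cV x(1,2), of \<omega> u v]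
      by (simp add: cf_def D_def \<sigma>_def chart_transition_def inv_chart[OF c])
  qed
  have smcf: "smooth_on (\<theta> ` V) (\<lambda>q. cf q u v)" for u v
    using symplectic V by (auto simp: symplectic_manifold_def smooth_two_form_def cf_def)
  have bil: "bilinear (cf q)" if "q \<in> \<theta> ` V" for q
    unfolding cf_def by (rule chart_form_bilinear[OF cV that form_bilinear])
  have alt: "cf q u u = 0" if "q \<in> \<theta> ` V" for q u
    using that chart_form_eq[OF cV] form_alternating by (auto simp: cf_def)
  have bil': "bilinear (cf (\<sigma> p))" if "p \<in> T" for p using bil \<sigma>T that by blast
  have sm0: "smooth_on T (\<lambda>p. cf (\<sigma> p) a b)" for a b
    by (rule smooth_on_compose[OF oT compatible_chartD(2)[OF cV] sm\<sigma> smcf \<sigma>T])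
  have sm1: "smooth_on T (\<lambda>p. cf (\<sigma> p) a (D p v))" for a v
    by (rule linear_family_smooth[OF oT _ sm0 smD]) (use bil' bilinear_linear_right in blast)
  have "smooth_on T (\<lambda>p. cf (\<sigma> p) (D p u) (D p v))" for u v
    by (rule linear_family_smooth[OF oT _ sm1 smD]) (use bil' bilinear_linear_left in blast)
  from smooth_on_cong[OF oT _ this]
  show "smooth_on (\<psi> ` (U \<inter> V)) (\<lambda>p. chart_form A \<omega> U \<psi> p u v)"
    unfolding T_def[symmetric] using eq by simp
  assume "p \<in> \<psi> ` (U \<inter> V)"
  then have p: "p \<in> T" by (simp add: T_def)
  have \<sigma>p: "\<sigma> p \<in> \<theta> ` V" using \<sigma>T p by blast
  define S where "S v e = frechet_derivative (\<lambda>q. D q v) (at p) e" for v e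
  have dD: "((\<lambda>q. D q v) has_derivative S v) (at p)" for v
    unfolding S_def using smooth_on_has_derivative[OF smD p] .
  have S_sym: "S v e = S e v" for v e
    unfolding S_def D_def by (rule symmetric_second_derivative[OF oT p sm\<sigma>])
  define O' where "O' a b e = frechet_derivative (\<lambda>q. cf q a b) (at (\<sigma> p)) e" for a b e
  have dcf: "((\<lambda>q. cf (\<sigma> q) a b) has_derivative (\<lambda>e. O' a b (D p e))) (at p)" for a b
    unfolding O'_def D_def
    by (rule has_derivative_compose[OF smooth_on_has_derivative[OF sm\<sigma> p] smooth_on_has_derivative[OF smcf \<sigma>p]])
  have fd: "frechet_derivative (\<lambda>p. chart_form A \<omega> U \<psi> p v w) (at p) u =
     O' (D p v) (D p w) (D p u) + cf (\<sigma> p) (S v u) (D p w) + cf (\<sigma> p) (D p v) (S w u)" for u v w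
  proof -
    have "((\<lambda>q. cf (\<sigma> q) (D q v) (D q w)) has_derivative
      (\<lambda>e. frechet_derivative (\<lambda>q. cf (\<sigma> q) (D p v) (D p w)) (at p) e + cf (\<sigma> p) (S v e) (D p w) +
          cf (\<sigma> p) (D p v) (S w e))) (at p)"
      by (rule bilinear_form_has_derivative[OF bil' oT p differentiableI[OF dcf] dD dD])
    then have "((\<lambda>q. chart_form A \<omega> U \<psi> q v w) has_derivative
      (\<lambda>e. O' (D p v) (D p w) (D p e) + cf (\<sigma> p) (S v e) (D p w) + cf (\<sigma> p) (D p v) (S w e))) (at p)"
      unfolding frechet_derivative_at[OF dcf, symmetric]
      by (rule has_derivative_transform_within_open[OF _ oT p]) (use eq in simp)
    from fun_cong[OF frechet_derivative_at[OF this], of u] show ?thesis by (rule sym)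
  qed
  have anti: "cf (\<sigma> p) a b = - cf (\<sigma> p) b a" for a b
    by (rule alternating_antisym[OF bil[OF \<sigma>p] alt[OF \<sigma>p]])
  have closed: "O' b c' a + O' c' a b + O' a b c' = 0" for a b c'
    using symplectic V \<sigma>p unfolding symplectic_manifold_def closed_two_form_def O'_def cf_def by blast
  show "frechet_derivative (\<lambda>p. chart_form A \<omega> U \<psi> p v w) (at p) u +
        frechet_derivative (\<lambda>p. chart_form A \<omega> U \<psi> p w u) (at p) v +
        frechet_derivative (\<lambda>p. chart_form A \<omega> U \<psi> p u v) (at p) w = 0"
    unfolding fd
    using closed[of "D p v" "D p w" "D p u"] S_sym[of u v] S_sym[of u w] S_sym[of v w]
      anti[of "S u v" "D p w"] anti[of "S u w" "D p v"] anti[of "S v w" "D p u"]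
    by simp
qed

lemma chart_form_smooth: "smooth_on (\<psi> ` U) (\<lambda>p. chart_form A \<omega> U \<psi> p u v)"
proof (rule smooth_on_local)
  fix p assume "p \<in> \<psi> ` U"
  then obtain x where x: "x \<in> U" "p = \<psi> x" by auto
  obtain V \<theta> where V: "(V, \<theta>) \<in> A" "x \<in> V" using chart_at[of x] by (metis prod.collapse)
  have "open (\<psi> ` (U \<inter> V))"
    by (rule open_chart_image[OF c compatible_chartD(1)[OF atlas_compatible[OF V(1)]]])
  then show "\<exists>T. open T \<and> p \<in> T \<and> smooth_on T (\<lambda>p. chart_form A \<omega> U \<psi> p u v)"
    using chart_form_local(1)[OF V(1)] x V(2) by blast
qed

lemma chart_form_closed:
  assumes "p \<in> \<psi> ` U"
  shows "frechet_derivative (\<lambda>p. chart_form A \<omega> U \<psi> p v w) (at p) u +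
        frechet_derivative (\<lambda>p. chart_form A \<omega> U \<psi> p w u) (at p) v +
        frechet_derivative (\<lambda>p. chart_form A \<omega> U \<psi> p u v) (at p) w = 0"
proof -
  obtain x where x: "x \<in> U" "p = \<psi> x" using assms by auto
  obtain V \<theta> where V: "(V, \<theta>) \<in> A" "x \<in> V" using chart_at[of x] by (metis prod.collapse)
  show ?thesis by (rule chart_form_local(2)[OF V(1)]) (use x V in auto)
qed

end

end

section \<open>Plaques of the characteristic foliation\<close>

text \<open>In the ball the submanifold is the subspace \<open>E\<close>, and at points of
  \<open>E\<close> the frame spans the characteristic distribution. \<open>P\<close> is the
  coordinate along plaques: the frame depends on its parameter through \<open>P\<close> only, so
  \<open>range P\<close> is the effective parameter space.\<close>

locale fibre_box = symplectic A \<omega> + commuting_frame F "ball p0 r" p0 R K L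
  for A :: "('p::topological_space, 'e::euclidean_space) chart set" and \<omega> :: "'p \<Rightarrow> 'e \<Rightarrow> 'e \<Rightarrow> real"
    and F :: "'e \<Rightarrow> 'e \<Rightarrow> 'e" and p0 :: 'e and r R K L :: real +
  fixes M :: "'p set" and U :: "'p set" and \<psi> :: "'p \<Rightarrow> 'e" and E :: "'e set" and P :: "'e \<Rightarrow> 'e"
  assumes chart: "compatible_chart A (U, \<psi>)" and E: "subspace E" "p0 \<in> E"
    and slice: "U \<inter> M = {y \<in> U. \<psi> y \<in> E}"
    and ball_U: "ball p0 r \<subseteq> \<psi> ` U"
    and P: "linear P" "\<And>x. P (P x) = P x" "\<And>x. norm (P x) \<le> norm x"
    and F_E: "\<And>p v. p \<in> ball p0 r \<Longrightarrow> F p v \<in> E"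
    and P_F: "\<And>p v. p \<in> ball p0 r \<Longrightarrow> P (F p v) = P v"
    and F_P: "\<And>p v. p \<in> ball p0 r \<Longrightarrow> F p (P v) = F p v"
    and range_F: "\<And>p. p \<in> ball p0 r \<Longrightarrow> p \<in> E \<Longrightarrow> range (F p) = {u. \<forall>v\<in>E. chart_form A \<omega> U \<psi> p u v = 0}"
begin

abbreviation "D \<equiv> ker_pullback A \<omega> M"
abbreviation "\<phi> \<equiv> inv_into U \<psi>"

lemma ball_R: "ball p0 R \<subseteq> ball p0 r"
  using S(2) by auto

lemma coord_U: "p \<in> ball p0 r \<Longrightarrow> \<phi> p \<in> U" "p \<in> ball p0 r \<Longrightarrow> \<psi> (\<phi> p) = p"
  using ball_U inv_into_into[of p \<psi> U] f_inv_into_f[of p \<psi> U] by auto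

lemma coord_M: "p \<in> ball p0 r \<Longrightarrow> \<phi> p \<in> M \<longleftrightarrow> p \<in> E"
proof -
  assume p: "p \<in> ball p0 r"
  have "\<phi> p \<in> U \<inter> M \<longleftrightarrow> \<phi> p \<in> {y \<in> U. \<psi> y \<in> E}" using slice by simp
  then show ?thesis using coord_U[OF p] by simp
qed

lemma ker_pullback_coord:
  assumes x: "x \<in> U" "x \<in> M" "\<psi> x \<in> ball p0 r"
  shows "D x = {v. tangent_coord A \<psi> x v \<in> range (F (\<psi> x))}"
proof -
  have TM: "tangent_space A M x = {v. tangent_coord A \<psi> x v \<in> E}"
    by (rule tangent_space_slice[OF chart x(1,2) E(1) slice])
  have xE: "\<psi> x \<in> E" using x slice by blast
  note rF = range_F[OF x(3) xE]
  show ?thesis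
  proof (intro set_eqI iffI)
    fix v assume v: "v \<in> D x"
    have "chart_form A \<omega> U \<psi> (\<psi> x) (tangent_coord A \<psi> x v) w = 0" if "w \<in> E" for w
    proof -
      have "coord_tangent A U \<psi> x w \<in> tangent_space A M x"
        using that unfolding TM by (simp add: tangent_coord_inverse[OF chart x(1)])
      then have "\<omega> x v (coord_tangent A U \<psi> x w) = 0" using v by (simp add: ker_pullback_def)
      then show ?thesis
        unfolding chart_form_eq[OF chart x(1)] tangent_coord_inverse[OF chart x(1)] .
    qed
    then show "v \<in> {v. tangent_coord A \<psi> x v \<in> range (F (\<psi> x))}" unfolding rF by blast
  next
    fix v assume "v \<in> {v. tangent_coord A \<psi> x v \<in> range (F (\<psi> x))}"
    then have v: "tangent_coord A \<psi> x v \<in> range (F (\<psi> x))" by simp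
    then have "tangent_coord A \<psi> x v \<in> E" using F_E[OF x(3)] by auto
    moreover have "\<omega> x v w = 0" if "w \<in> tangent_space A M x" for w
      using v that unfolding rF TM form_eq_chart_form[OF chart x(1), of _ v w] by blast
    ultimately show "v \<in> D x" unfolding ker_pullback_def TM by blast
  qed
qed

text \<open>The relations between \<open>P\<close> and \<open>F\<close> give
  \<open>F p (F p v) = F p (P v) = F p v\<close>: each \<open>F p\<close> is a projection with the
  same kernel as \<open>P\<close>.\<close>

lemma F_fixes_range: "p \<in> ball p0 r \<Longrightarrow> w \<in> range (F p) \<longleftrightarrow> F p w = w"
  using P_F F_P by (metis rangeE rangeI)

lemma plaque_map_P:
  assumes "admissible a d"
  shows "P (plaque_map a d) = P a + P d"
  by (rule plaque_map_linear_invariant[OF assms P(1)]) (use P_F S(2) in auto)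

lemma plaque_map_E:
  assumes "admissible a d" "a \<in> E"
  shows "plaque_map a d \<in> E"
proof -
  obtain \<pi> where \<pi>: "linear \<pi>" "\<And>x. \<pi> x \<in> E" "\<And>x. x \<in> E \<Longrightarrow> \<pi> x = x"
    using ex_orthogonal_projection[OF E(1)] by metis
  have "plaque_map a d - \<pi> (plaque_map a d) = (a - \<pi> a) + 0"
    by (rule plaque_map_linear_invariant[OF assms(1), of "\<lambda>x. x - \<pi> x"])
      (use \<pi> F_E S(2) in \<open>auto intro!: linear_compose_sub linear_ident\<close>)
  then show ?thesis using \<pi>(2)[of "plaque_map a d"] \<pi>(3)[OF assms(2)] by simp
qed

definition plaque_coords :: "'e \<Rightarrow> real \<Rightarrow> 'e set" where
  "plaque_coords c \<rho> = plaque_map c ` (range P \<inter> ball 0 \<rho>)"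

definition plaque :: "'e \<Rightarrow> real \<Rightarrow> 'p set" where "plaque c \<rho> = \<phi> ` plaque_coords c \<rho>"

text \<open>With \<open>P\<close> the projection to the plaque directions, \<open>plaque_map c (P (p - c))\<close> is the point of the
  plaque through \<open>c\<close> over \<open>p\<close>; replacing it by \<open>P (p - c)\<close> flattens that plaque to \<open>range P\<close>.\<close>

definition straighten :: "'e \<Rightarrow> 'e \<Rightarrow> 'e" where
  "straighten c p = p - plaque_map c (P (p - c)) + P (p - c)"

definition unstraighten :: "'e \<Rightarrow> 'e \<Rightarrow> 'e" where
  "unstraighten c q = q + plaque_map c (P q) - P q"

definition box_at :: "'e \<Rightarrow> real \<Rightarrow> 'e set" where
  "box_at c \<rho> = {p \<in> ball p0 R. norm (P (p - c)) < \<rho>}"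

lemma P_range: "x \<in> range P \<longleftrightarrow> P x = x" using P(2) by (metis rangeE rangeI)

lemma subspace_range_P: "subspace (range P)"
  using linear_subspace_image[OF P(1) subspace_UNIV] .

lemmas P_simps = linear_add[OF P(1)] linear_diff[OF P(1)] linear_0[OF P(1)] P(2)

context
  fixes c :: 'e and \<rho> :: real
  assumes adm: "\<And>d. norm d < \<rho> \<Longrightarrow> strictly_admissible c d"
begin

lemma adm': "norm d < \<rho> \<Longrightarrow> admissible c d"
  using adm strictly_admissible_imp by blast

lemma plaque_map_in_ball: "norm d < \<rho> \<Longrightarrow> plaque_map c d \<in> ball p0 R"
proof -
  assume d: "norm d < \<rho>"
  have "norm (plaque_map c d - p0) \<le> norm (plaque_map c d - c) + norm (c - p0)"
    using norm_triangle_ineq[of "plaque_map c d - c" "c - p0"] by simp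
  then show ?thesis using plaque_map_near[OF adm'[OF d]] adm[OF d]
    by (simp add: strictly_admissible_def dist_norm norm_minus_commute)
qed

lemma P_straighten: "p \<in> box_at c \<rho> \<Longrightarrow> P (straighten c p) = P (p - c)"
  using plaque_map_P[OF adm', of "P (p - c)"] by (simp add: straighten_def box_at_def P_simps)

lemma unstraighten_straighten: "p \<in> box_at c \<rho> \<Longrightarrow> unstraighten c (straighten c p) = p"
  using P_straighten by (simp add: unstraighten_def) (simp add: straighten_def)

lemma straighten_unstraighten:
  assumes "norm (P q) < \<rho>"
  shows "P (unstraighten c q - c) = P q" "straighten c (unstraighten c q) = q"
proof -
  show *: "P (unstraighten c q - c) = P q"
    using plaque_map_P[OF adm'[OF assms]] by (simp add: unstraighten_def P_simps)
  show "straighten c (unstraighten c q) = q"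
    unfolding straighten_def * by (simp add: unstraighten_def)
qed

lemma straighten_image: "straighten c ` box_at c \<rho> = {q. norm (P q) < \<rho> \<and> unstraighten c q \<in> ball p0 R}"
proof (intro set_eqI iffI)
  fix q assume "q \<in> straighten c ` box_at c \<rho>"
  then obtain p where p: "p \<in> box_at c \<rho>" "q = straighten c p" by auto
  then show "q \<in> {q. norm (P q) < \<rho> \<and> unstraighten c q \<in> ball p0 R}"
    using P_straighten[OF p(1)] unstraighten_straighten[OF p(1)] by (simp add: box_at_def)
next
  fix q assume "q \<in> {q. norm (P q) < \<rho> \<and> unstraighten c q \<in> ball p0 R}"
  then show "q \<in> straighten c ` box_at c \<rho>"
    using straighten_unstraighten[of q] by (auto simp: box_at_def intro!: image_eqI[of _ _ "unstraighten c q"])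
qed

lemma bounded_linear_P: "bounded_linear P" using P(1) by (simp add: linear_conv_bounded_linear)

lemma open_box_at: "open (box_at c \<rho>)"
proof -
  have "box_at c \<rho> = ball p0 R \<inter> {p. norm (P (p - c)) < \<rho>}" by (auto simp: box_at_def)
  moreover have "open {p. norm (P (p - c)) < \<rho>}"
    by (intro open_Collect_less continuous_intros bounded_linear.continuous_on[OF bounded_linear_P])
  ultimately show ?thesis by auto
qed

lemma open_norm_P: "open {q. norm (P q) < \<rho>}"
  by (intro open_Collect_less continuous_intros bounded_linear.continuous_on[OF bounded_linear_P])

lemma plaque_map_P_smooth: "smooth_on {q. norm (P q) < \<rho>} (\<lambda>q. plaque_map c (P q))"
  by (rule smooth_on_compose[OF open_norm_P open_strictly_admissible
      smooth_on_bounded_linear[OF open_norm_P bounded_linear_P] plaque_map_smooth]) (use adm in auto)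

lemma unstraighten_smooth: "smooth_on {q. norm (P q) < \<rho>} (unstraighten c)"
  unfolding unstraighten_def
  by (intro smooth_on_diff smooth_on_add open_norm_P smooth_on_ident plaque_map_P_smooth
      smooth_on_bounded_linear bounded_linear_P)

lemma straighten_smooth: "smooth_on (box_at c \<rho>) (straighten c)"
proof -
  have s: "smooth_on (box_at c \<rho>) (\<lambda>p. p - c)"
    by (intro smooth_on_diff open_box_at smooth_on_ident smooth_on_const)
  have 1: "smooth_on (box_at c \<rho>) (\<lambda>p. P (p - c))"
    by (rule smooth_on_bounded_linear_comp[OF open_box_at bounded_linear_P s])
  have 2: "smooth_on (box_at c \<rho>) (\<lambda>p. plaque_map c (P (p - c)))"
    by (rule smooth_on_compose[OF open_box_at open_norm_P s plaque_map_P_smooth]) (auto simp: box_at_def)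
  show ?thesis unfolding straighten_def
    by (intro smooth_on_diff smooth_on_add open_box_at smooth_on_ident 1 2)
qed

lemma open_straighten_image: "open (straighten c ` box_at c \<rho>)"
proof -
  have "straighten c ` box_at c \<rho> = {q. norm (P q) < \<rho>} \<inter> unstraighten c -` ball p0 R"
    unfolding straighten_image by auto
  then show ?thesis
    using continuous_on_open_vimage[OF open_norm_P] smooth_on_continuous_on[OF unstraighten_smooth]
    by (metis Int_commute open_ball)
qed

lemma box_at_U: "box_at c \<rho> \<subseteq> \<psi> ` U"
  using ball_R ball_U by (auto simp: box_at_def)

definition leaf_dom where "leaf_dom = U \<inter> \<psi> -` box_at c \<rho>"
definition leaf_coord where "leaf_coord = straighten c \<circ> \<psi>"

lemma leaf_chart_compatible: "compatible_chart A (leaf_dom, leaf_coord)"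
  and inv_leaf_coord: "q \<in> straighten c ` box_at c \<rho> \<Longrightarrow> inv_into leaf_dom leaf_coord q = \<phi> (unstraighten c q)"
proof -
  have "smooth_on (straighten c ` box_at c \<rho>) (unstraighten c)"
    by (rule smooth_on_subset[OF unstraighten_smooth]) (auto simp: straighten_image)
  note cc = compatible_chart_compose[OF chart open_box_at box_at_U open_straighten_image straighten_smooth this
      unstraighten_straighten, folded leaf_dom_def leaf_coord_def]
  show "compatible_chart A (leaf_dom, leaf_coord)" using cc(1) by blast
  show "q \<in> straighten c ` box_at c \<rho> \<Longrightarrow> inv_into leaf_dom leaf_coord q = \<phi> (unstraighten c q)"
    using cc(2) by blast
qed

lemma straighten_plaque_map:
  assumes "P x = x" "norm x < \<rho>"
  shows "P (plaque_map c x - c) = x" "plaque_map c x \<in> box_at c \<rho>" "straighten c (plaque_map c x) = x"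
    "unstraighten c x = plaque_map c x"
proof -
  show 1: "P (plaque_map c x - c) = x" using plaque_map_P[OF adm'[OF assms(2)]] assms(1) by (simp add: P_simps)
  show "plaque_map c x \<in> box_at c \<rho>" unfolding box_at_def using 1 assms plaque_map_in_ball by simp
  show "straighten c (plaque_map c x) = x" unfolding straighten_def 1 by simp
  show "unstraighten c x = plaque_map c x" unfolding unstraighten_def assms(1) by simp
qed

lemma plaque_coords_eq: "plaque_coords c \<rho> = {p \<in> box_at c \<rho>. straighten c p \<in> range P}"
proof (intro set_eqI iffI)
  fix p assume "p \<in> plaque_coords c \<rho>"
  then show "p \<in> {p \<in> box_at c \<rho>. straighten c p \<in> range P}"
    using straighten_plaque_map P(2) by (auto simp: plaque_coords_def)
next
  fix p assume "p \<in> {p \<in> box_at c \<rho>. straighten c p \<in> range P}"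
  then have p: "p \<in> box_at c \<rho>" "P (straighten c p) = straighten c p" using P_range by auto
  have "p = unstraighten c (straighten c p)" using unstraighten_straighten[OF p(1)] by simp
  also have "\<dots> = plaque_map c (straighten c p)" by (simp add: unstraighten_def p(2))
  finally have "p = plaque_map c (straighten c p)" .
  moreover have "norm (straighten c p) < \<rho>" using P_straighten[OF p(1)] p by (simp add: box_at_def)
  moreover have "straighten c p \<in> range P" using p P_range by blast
  ultimately show "p \<in> plaque_coords c \<rho>" unfolding plaque_coords_def by (intro image_eqI) auto
qed

lemma plaque_eq: "plaque c \<rho> = {x \<in> leaf_dom. leaf_coord x \<in> range P}"
proof (intro set_eqI iffI)
  fix x assume "x \<in> plaque c \<rho>"
  then obtain p where p: "p \<in> plaque_coords c \<rho>" "x = \<phi> p" by (auto simp: plaque_def)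
  then have "p \<in> ball p0 r" using ball_R by (auto simp: plaque_coords_eq box_at_def)
  then show "x \<in> {x \<in> leaf_dom. leaf_coord x \<in> range P}"
    using p coord_U by (auto simp: plaque_coords_eq leaf_dom_def leaf_coord_def)
next
  fix x assume x: "x \<in> {x \<in> leaf_dom. leaf_coord x \<in> range P}"
  then have "\<psi> x \<in> plaque_coords c \<rho>" "x = \<phi> (\<psi> x)"
    using inv_chart[OF chart] by (auto simp: plaque_coords_eq leaf_dom_def leaf_coord_def)
  then show "x \<in> plaque c \<rho>" unfolding plaque_def by blast
qed

text \<open>The derivative of \<open>plaque_map\<close> in its parameter is the frame, and
  \<open>P (p - c)\<close> is the parameter of \<open>p\<close>; hence straightening replaces the
  frame component \<open>F p w\<close> by \<open>P w\<close>.\<close>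

lemma leaf_coord_transition:
  assumes x: "P x = x" "norm x < \<rho>"
  defines "p \<equiv> plaque_map c x"
  shows "chart_transition U \<psi> leaf_coord (\<phi> p) w = w - F p w + P w"
proof -
  have pb: "p \<in> ball p0 R" unfolding p_def by (rule plaque_map_in_ball[OF x(2)])
  then have pr: "p \<in> ball p0 r" using ball_R by blast
  have Pc: "P (p - c) = x" unfolding p_def by (rule straighten_plaque_map(1)[OF x])
  have dP: "((\<lambda>q. P (q - c)) has_derivative P) (at p)"
    by (rule has_derivative_eq_rhs[OF bounded_linear.has_derivative[OF bounded_linear_P]])
      (auto intro!: derivative_eq_intros)
  have du: "((\<lambda>q. plaque_map c (P (q - c))) has_derivative (\<lambda>w. F p (P w))) (at p)"
    by (rule has_derivative_compose[OF dP])
      (use plaque_map_has_derivative[OF adm[OF x(2)]] in \<open>simp only: Pc p_def[symmetric]\<close>)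
  have "(straighten c has_derivative (\<lambda>w. w - F p (P w) + P w)) (at p)"
    unfolding straighten_def by (intro has_derivative_add has_derivative_diff has_derivative_ident du dP)
  then have "((leaf_coord \<circ> \<phi>) has_derivative (\<lambda>w. w - F p (P w) + P w)) (at p)"
    by (rule has_derivative_transform_within_open[OF _ open_ball pr])
      (simp add: leaf_coord_def coord_U)
  then have "chart_transition U \<psi> leaf_coord (\<phi> p) = (\<lambda>w. w - F p (P w) + P w)"
    unfolding chart_transition_def coord_U(2)[OF pr] by (rule frechet_derivative_at[symmetric])
  then show ?thesis using F_P[OF pr] by simp
qed

context
  assumes cE: "c \<in> E"
begin

text \<open>In the straightened chart the plaque is the slice \<open>range P\<close>. A vector
  \<open>w\<close> goes to \<open>w - F p w + P w\<close>, whose \<open>P\<close>-part is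
  \<open>P w\<close>; it therefore lies in \<open>range P\<close> exactly when
  \<open>F p w = w\<close>, that is, when \<open>w\<close> belongs to the range of the
  frame.\<close>

lemma plaque_integral_manifold: "integral_manifold A M D (plaque c \<rho>)"
  unfolding integral_manifold_def
proof (intro conjI ballI)
  have pts: "\<exists>p x. y = \<phi> p \<and> p = plaque_map c x \<and> P x = x \<and> norm x < \<rho>" if y: "y \<in> plaque c \<rho>" for y
  proof -
    obtain x where "x \<in> range P \<inter> ball 0 \<rho>" "y = \<phi> (plaque_map c x)"
      using y unfolding plaque_def plaque_coords_def by blast
    then show ?thesis using P_range[of x] by (intro exI[of _ "plaque_map c x"] exI[of _ x]) simp
  qed
  have pE: "plaque_map c x \<in> E" "plaque_map c x \<in> ball p0 r" if "norm x < \<rho>" for x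
    using plaque_map_E[OF adm'[OF that] cE] plaque_map_in_ball[OF that] ball_R by auto
  show sub: "plaque c \<rho> \<subseteq> M"
    using pts pE coord_M by blast
  have sl: "leaf_dom \<inter> plaque c \<rho> = {y \<in> leaf_dom. leaf_coord y \<in> range P}"
    unfolding plaque_eq by auto
  show "embedded_submanifold A (plaque c \<rho>)"
    unfolding embedded_submanifold_def
  proof
    fix x assume "x \<in> plaque c \<rho>"
    then have "x \<in> leaf_dom" using plaque_eq by blast
    then show "\<exists>U \<psi> E. compatible_chart A (U, \<psi>) \<and> x \<in> U \<and> subspace E \<and> U \<inter> plaque c \<rho> = {y \<in> U. \<psi> y \<in> E}"
      using leaf_chart_compatible subspace_range_P sl by blast
  qed
  fix y assume y: "y \<in> plaque c \<rho>"
  obtain p x where p: "y = \<phi> p" "p = plaque_map c x" "P x = x" "norm x < \<rho>" using pts[OF y] by blast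
  have pr: "p \<in> ball p0 r" and pE': "p \<in> E" using pE p by auto
  have yU: "y \<in> U" "\<psi> y = p" using coord_U[OF pr] p by auto
  have yl: "y \<in> leaf_dom" using y plaque_eq by blast
  have "tangent_space A (plaque c \<rho>) y = {v. tangent_coord A leaf_coord y v \<in> range P}"
    by (rule tangent_space_slice[OF leaf_chart_compatible yl y subspace_range_P sl])
  also have "\<dots> = {v. tangent_coord A \<psi> y v \<in> range (F p)}"
  proof (intro Collect_cong)
    fix v
    define w where "w = tangent_coord A \<psi> y v"
    have "tangent_coord A leaf_coord y v = w - F p w + P w"
      unfolding tangent_coord_transition(1)[OF chart leaf_chart_compatible yU(1) yl] w_def[symmetric]
      using leaf_coord_transition[OF p(3,4)] p by simp
    moreover have "w - F p w + P w \<in> range P \<longleftrightarrow> F p w = w"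
    proof -
      have "P (w - F p w + P w) = P w" using P_F[OF pr, of w] by (simp add: P_simps)
      then show ?thesis unfolding P_range by auto
    qed
    ultimately show "tangent_coord A leaf_coord y v \<in> range P \<longleftrightarrow> tangent_coord A \<psi> y v \<in> range (F p)"
      unfolding F_fixes_range[OF pr] w_def by simp
  qed
  also have "\<dots> = D y" using ker_pullback_coord[OF yU(1)] sub y yU pr by auto
  finally show "tangent_space A (plaque c \<rho>) y = D y" .
qed

text \<open>Through this chart critical points and Hessians along the fibre can be read off on the
  fixed linear space \<open>range P\<close>.\<close>

lemma plaque_leaf_chart:
  assumes "P x = x" "norm x < \<rho>"
  shows "leaf_chart A M D (\<phi> (plaque_map c x)) leaf_dom leaf_coord (range P)"
proof -
  have "plaque_map c x \<in> plaque_coords c \<rho>"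
    unfolding plaque_coords_def using assms P_range by auto
  then have "\<phi> (plaque_map c x) \<in> plaque c \<rho>" unfolding plaque_def by blast
  then show ?thesis
    unfolding leaf_chart_def
    using leaf_chart_compatible subspace_range_P plaque_integral_manifold plaque_eq by auto
qed

end

end

end

section \<open>Plaques and the leaf topology\<close>

context fibre_box begin

text \<open>The part of a plaque inside an integral manifold is open, because the component of the
  plaque transversal to the integral manifold satisfies a linear differential inequality.\<close>

lemma integral_manifold_open_in_plaque:
  assumes adm: "\<And>d. norm d < \<rho> \<Longrightarrow> strictly_admissible c d"
    and N: "integral_manifold A M D N" and x1: "norm x1 < \<rho>" "\<phi> (plaque_map c x1) \<in> N"
  shows "\<exists>\<delta>>0. \<forall>x. norm (x - x1) < \<delta> \<longrightarrow> \<phi> (plaque_map c x) \<in> N"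
proof -
  define p1 where "p1 = plaque_map c x1"
  obtain W \<eta> E' where W: "compatible_chart A (W, \<eta>)" "\<phi> p1 \<in> W" "subspace E'" "W \<inter> N = {y \<in> W. \<eta> y \<in> E'}"
    using N x1(2) unfolding integral_manifold_def embedded_submanifold_def p1_def by blast
  obtain \<pi> where \<pi>: "linear \<pi>" "\<And>x. \<pi> x \<in> E'" "\<And>x. x \<in> E' \<Longrightarrow> \<pi> x = x" "\<And>x. norm (\<pi> x) \<le> norm x"
    using ex_orthogonal_projection[OF W(3)] by metis
  have bl\<pi>: "bounded_linear \<pi>" using \<pi>(1) by (simp add: linear_conv_bounded_linear)
  \<comment> \<open>\<open>Q\<close> extracts the component transversal to \<open>E'\<close>: in the
    slice chart \<open>\<eta>\<close> of \<open>N\<close>, a point of \<open>W\<close> belongs to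
    \<open>N\<close> exactly when this component of its coordinates vanishes.\<close>
  define Q where "Q x = x - \<pi> x" for x
  have blQ: "bounded_linear Q" unfolding Q_def by (intro bounded_linear_sub bounded_linear_ident bl\<pi>)
  have linQ: "linear Q" using blQ by (simp add: linear_conv_bounded_linear)
  have Q0: "Q x = 0 \<longleftrightarrow> x \<in> E'" for x using \<pi>(2,3) by (metis Q_def right_minus_eq)
  define O' where "O' = ball p0 r \<inter> \<psi> ` (U \<inter> W)"
  have oO: "open O'" unfolding O'_def by (intro open_Int open_ball open_chart_image chart compatible_chartD(1)[OF W(1)])
  define \<kappa> where "\<kappa> = \<eta> \<circ> \<phi>"
  define lam where "lam = \<psi> \<circ> inv_into W \<eta>"
  have O'W: "\<phi> p \<in> W" "\<phi> p \<in> U" "p \<in> ball p0 r" if "p \<in> O'" for p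
    using that inv_chart[OF chart] by (auto simp: O'_def)
  have sm\<kappa>: "smooth_on O' \<kappa>"
    unfolding \<kappa>_def by (rule smooth_on_subset[OF transition_smooth[OF chart W(1)]]) (auto simp: O'_def)
  have lam_\<kappa>: "lam (\<kappa> p) = p" if "p \<in> O'" for p
    using O'W[OF that] inv_chart[OF W(1)] coord_U(2) by (simp add: \<kappa>_def lam_def)
  define B where "B = \<kappa> ` O'"
  have B: "B = \<eta> ` (W \<inter> U) \<inter> lam -` ball p0 r"
  proof (intro set_eqI iffI)
    fix q assume "q \<in> B"
    then obtain p where p: "p \<in> O'" "q = \<kappa> p" by (auto simp: B_def)
    then show "q \<in> \<eta> ` (W \<inter> U) \<inter> lam -` ball p0 r"
      using O'W[OF p(1)] lam_\<kappa>[OF p(1)] by (auto simp: \<kappa>_def)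
  next
    fix q assume "q \<in> \<eta> ` (W \<inter> U) \<inter> lam -` ball p0 r"
    then obtain x where x: "x \<in> W" "x \<in> U" "q = \<eta> x" "\<psi> x \<in> ball p0 r"
      using inv_chart[OF W(1)] by (auto simp: lam_def)
    then show "q \<in> B" unfolding B_def
      by (intro image_eqI[of _ _ "\<psi> x"]) (auto simp: \<kappa>_def O'_def inv_chart[OF chart])
  qed
  have smlam0: "smooth_on (\<eta> ` (W \<inter> U)) lam" unfolding lam_def by (rule transition_smooth[OF W(1) chart])
  have oB: "open B" unfolding B
    using continuous_on_open_vimage[OF open_chart_image[OF W(1) compatible_chartD(1)[OF chart]]]
      smooth_on_continuous_on[OF smlam0] by (metis Int_commute open_ball)
  have smlam: "smooth_on B lam" by (rule smooth_on_subset[OF smlam0]) (auto simp: B)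
  have lamB: "lam ` B \<subseteq> O'" using lam_\<kappa> by (auto simp: B_def)
  define D\<kappa> where "D\<kappa> p = frechet_derivative \<kappa> (at p)" for p
  have d\<kappa>: "(\<kappa> has_derivative D\<kappa> p) (at p)" if "p \<in> O'" for p
    unfolding D\<kappa>_def by (rule smooth_on_has_derivative[OF sm\<kappa> that])
  have lin\<kappa>: "linear (D\<kappa> p)" if "p \<in> O'" for p using has_derivative_linear[OF d\<kappa>[OF that]] .
  define G where "G q d = Q (D\<kappa> (lam q) (F (lam q) d))" for q d
  have smG: "smooth_on B (\<lambda>q. G q d)" for d
  proof -
    have "smooth_on O' (\<lambda>p. D\<kappa> p (F p d))"
      unfolding D\<kappa>_def
      by (rule smooth_on_frechet_derivative_field[OF oO sm\<kappa> smooth_on_subset[OF smoothF]]) (auto simp: O'_def)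
    then have "smooth_on O' (\<lambda>p. Q (D\<kappa> p (F p d)))" by (rule smooth_on_bounded_linear_comp[OF oO blQ])
    from smooth_on_compose[OF oB oO smlam this lamB] show ?thesis by (simp add: G_def)
  qed
  have linG: "linear (G q)" if "q \<in> B" for q
  proof -
    have "lam q \<in> O'" using lamB that by blast
    then have "linear (Q \<circ> (D\<kappa> (lam q) \<circ> F (lam q)))"
      by (intro linear_compose linQ lin\<kappa> linF) (auto dest: O'W)
    then show ?thesis by (simp add: G_def[abs_def] o_def)
  qed
  \<comment> \<open>At points of \<open>N\<close> the frame is tangent to \<open>N\<close>, because
    its range and the tangent space of \<open>N\<close> are both the kernel distribution. So the
    transversal rate \<open>G\<close> vanishes on \<open>E'\<close>.\<close>
  have G0: "G q d = 0" if q: "q \<in> B" "q \<in> E'" for q d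
  proof -
    define p where "p = lam q"
    have p: "p \<in> O'" "\<kappa> p = q" using q(1) lam_\<kappa> by (auto simp: B_def p_def)
    define y where "y = \<phi> p"
    have y: "y \<in> W" "y \<in> U" "\<psi> y = p" "\<eta> y = q" using O'W[OF p(1)] coord_U p by (auto simp: y_def \<kappa>_def)
    then have yN: "y \<in> N" using W(4) q by blast
    then have yM: "y \<in> M" using N by (auto simp: integral_manifold_def)
    define v where "v = coord_tangent A U \<psi> y (F p d)"
    have tv: "tangent_coord A \<psi> y v = F p d" by (simp add: v_def tangent_coord_inverse[OF chart y(2)])
    have "\<psi> y \<in> ball p0 r" using O'W(3)[OF p(1)] y(3) by simp
    then have "v \<in> D y" using ker_pullback_coord[OF y(2) yM] tv y(3) by auto
    then have "v \<in> tangent_space A N y" using N yN by (auto simp: integral_manifold_def)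
    then have "tangent_coord A \<eta> y v \<in> E'" using tangent_space_slice[OF W(1) y(1) yN W(3,4)] by simp
    moreover have "tangent_coord A \<eta> y v = D\<kappa> p (F p d)"
      unfolding tangent_coord_transition(1)[OF chart W(1) y(2,1)] tv
      by (simp add: chart_transition_def D\<kappa>_def \<kappa>_def y(3))
    ultimately show ?thesis unfolding G_def p_def[symmetric] using Q0 by simp
  qed
  have p1b: "p1 \<in> ball p0 R" unfolding p1_def by (rule plaque_map_in_ball[OF adm x1(1)])
  have p1r: "p1 \<in> ball p0 r" using p1b ball_R by blast
  have p1O: "p1 \<in> O'" unfolding O'_def
    using p1r W(2) coord_U[OF p1r] by (auto intro!: image_eqI[of _ _ "\<phi> p1"])
  define q1 where "q1 = \<kappa> p1"
  have q1: "q1 \<in> B" "q1 \<in> E'" using p1O x1(2) W(2,4) by (auto simp: q1_def B_def \<kappa>_def p1_def)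
  obtain \<epsilon> where \<epsilon>: "\<epsilon> > 0" "cball q1 \<epsilon> \<subseteq> B" using oB q1(1) open_contains_cball by blast
  obtain C where C: "C \<ge> 0" "\<And>b x y. b \<in> Basis \<Longrightarrow> x \<in> cball q1 \<epsilon> \<Longrightarrow> y \<in> cball q1 \<epsilon> \<Longrightarrow>
      norm (G x b) \<le> C \<and> norm (G x b - G y b) \<le> C * norm (x - y)"
    using common_Lipschitz_bound[of Basis B "\<lambda>b q. G q b" q1 \<epsilon>] smG \<epsilon>(2) by (metis finite_Basis)
  define n where "n = real DIM('e)"
  have n: "n \<ge> 1" by (simp add: n_def DIM_ge_Suc0)
  \<comment> \<open>Comparison with the projected point \<open>\<pi> q\<close> in \<open>E'\<close>,
    where \<open>G\<close> vanishes, bounds the transversal rate by the transversal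
    distance.\<close>
  have GQ: "norm (G q d) \<le> n * (C * norm (Q q)) * norm d" if q: "q \<in> cball q1 \<epsilon>" for q d
  proof -
    have "norm (q1 - \<pi> q) = norm (\<pi> (q1 - q))" using \<pi>(3)[OF q1(2)] by (simp add: linear_diff[OF \<pi>(1)])
    also have "\<dots> \<le> norm (q1 - q)" by (rule \<pi>(4))
    finally have \<pi>q: "\<pi> q \<in> cball q1 \<epsilon>" using q by (simp add: dist_norm)
    have qB: "q \<in> B" "\<pi> q \<in> B" using q \<pi>q \<epsilon>(2) by auto
    have "G q d = (\<Sum>b\<in>Basis. (d \<bullet> b) *\<^sub>R G q b)" by (rule linear_Basis_expansion[OF linG[OF qB(1)]])
    also have "norm \<dots> \<le> n * (C * norm (Q q)) * norm d"
      unfolding n_def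
    proof (rule norm_sum_Basis_le)
      fix b :: 'e assume "b \<in> Basis"
      then show "norm (G q b) \<le> C * norm (Q q)"
        using C(2)[OF _ q \<pi>q, of b] G0[OF qB(2) \<pi>(2), of b] by (simp add: Q_def)
    qed
    finally show ?thesis .
  qed
  have cont: "isCont (plaque_map c) x1"
    using has_derivative_continuous[OF plaque_map_has_derivative[OF adm[OF x1(1)]]] .
  have "isCont (\<lambda>x. \<kappa> (plaque_map c x)) x1"
    using has_derivative_continuous[OF d\<kappa>[OF p1O]] cont isCont_o2 unfolding p1_def by blast
  then obtain \<delta>1 where \<delta>1: "\<delta>1 > 0" "\<And>x. norm (x - x1) < \<delta>1 \<Longrightarrow> dist (\<kappa> (plaque_map c x)) q1 < \<epsilon>"
    using \<epsilon>(1) unfolding continuous_at_eps_delta dist_norm q1_def p1_def by metis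
  obtain e0 where e0: "e0 > 0" "ball p1 e0 \<subseteq> O'" using oO p1O openE by blast
  obtain \<delta>2 where \<delta>2: "\<delta>2 > 0" "\<And>x. norm (x - x1) < \<delta>2 \<Longrightarrow> dist (plaque_map c x) p1 < e0"
    using cont e0(1) unfolding continuous_at_eps_delta dist_norm p1_def by metis
  \<comment> \<open>The last entry makes the growth rate \<open>n * C * norm d\<close> at most 1/2,
    as \<open>small_gronwall\<close> requires. With zero initial value and zero constant that lemma
    forces the transversal component to vanish along the segment.\<close>
  define \<delta> where "\<delta> = Min {\<delta>1, \<delta>2, \<rho> - norm x1, 1 / (2 * n * (C + 1))}"
  have \<delta>: "\<delta> > 0" "\<delta> \<le> \<delta>1" "\<delta> \<le> \<delta>2" "\<delta> \<le> \<rho> - norm x1" "\<delta> \<le> 1 / (2 * n * (C + 1))"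
    using \<delta>1 \<delta>2 x1 n C(1) by (auto simp: \<delta>_def)
  show ?thesis
  proof (intro exI[of _ \<delta>] conjI \<delta>(1) allI impI)
    fix x assume x: "norm (x - x1) < \<delta>"
    define d where "d = x - x1"
    define l where "l t = x1 + t *\<^sub>R d" for t :: real
    have lt: "norm (l t - x1) < \<delta>" if "t \<in> {0..1}" for t
    proof -
      have "norm (l t - x1) \<le> norm d" using that by (simp add: l_def mult_left_le_one_le)
      then show ?thesis using x by (simp add: d_def)
    qed
    have l\<rho>: "norm (l t) < \<rho>" if "t \<in> {0..1}" for t
      using lt[OF that] \<delta>(4) norm_triangle_ineq[of "l t - x1" x1] by simp
    define p where "p t = plaque_map c (l t)" for t
    have pO: "p t \<in> O'" if "t \<in> {0..1}" for t
    proof -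
      have "norm (l t - x1) < \<delta>2" using lt[OF that] \<delta>(3) by simp
      from \<delta>2(2)[OF this] show ?thesis using e0(2) by (auto simp: p_def dist_commute)
    qed
    have \<kappa>c: "\<kappa> (p t) \<in> cball q1 \<epsilon>" if "t \<in> {0..1}" for t
    proof -
      have "norm (l t - x1) < \<delta>1" using lt[OF that] \<delta>(2) by simp
      from \<delta>1(2)[OF this] show ?thesis by (simp add: p_def dist_commute)
    qed
    define w where "w t = Q (\<kappa> (p t))" for t
    have "norm (w 1) \<le> 2 * (norm (w 0) + 0)"
    proof (rule small_gronwall[where r' = "\<lambda>t. G (\<kappa> (p t)) d"])
      fix t :: real assume t: "t \<in> {0..1}"
      have "(l has_derivative (\<lambda>h. h *\<^sub>R d)) (at t within {0..1})"
        unfolding l_def by (auto intro!: derivative_eq_intros)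
      from has_derivative_compose[OF this plaque_map_has_derivative[OF adm[OF l\<rho>[OF t]]]]
      have "(p has_derivative (\<lambda>h. F (p t) (h *\<^sub>R d))) (at t within {0..1})"
        unfolding p_def .
      from has_derivative_compose[OF this d\<kappa>[OF pO[OF t]]]
      have "((\<lambda>t. \<kappa> (p t)) has_derivative (\<lambda>h. D\<kappa> (p t) (F (p t) (h *\<^sub>R d)))) (at t within {0..1})" .
      from bounded_linear.has_derivative[OF blQ this]
      have "(w has_derivative (\<lambda>h. Q (D\<kappa> (p t) (F (p t) (h *\<^sub>R d))))) (at t within {0..1})"
        unfolding w_def .
      moreover have "Q (D\<kappa> (p t) (F (p t) (h *\<^sub>R d))) = h *\<^sub>R G (\<kappa> (p t)) d" for h
        unfolding G_def lam_\<kappa>[OF pO[OF t]] linear_scale[OF linF[OF O'W(3)[OF pO[OF t]]]]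
          linear_scale[OF lin\<kappa>[OF pO[OF t]]] linear_scale[OF linQ] ..
      ultimately show "(w has_vector_derivative G (\<kappa> (p t)) d) (at t within {0..1})"
        by (simp add: has_vector_derivative_def)
      have "norm (G (\<kappa> (p t)) d) \<le> (n * C * norm d) * norm (w t)"
        using GQ[OF \<kappa>c[OF t], of d] by (simp add: w_def mult_ac)
      also have "n * C * norm d \<le> n * (C + 1) * (1 / (2 * n * (C + 1)))"
        using x \<delta>(5) n C(1) by (intro mult_mono) (auto simp: d_def)
      then have "(n * C * norm d) * norm (w t) \<le> 1/2 * norm (w t)"
        using n C(1) by (intro mult_right_mono) auto
      finally show "norm (G (\<kappa> (p t)) d) \<le> norm (w t) / 2 + 0" by simp
    qed auto
    moreover have "w 0 = 0" using q1(2) Q0 by (simp add: w_def p_def l_def q1_def p1_def)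
    ultimately have "w 1 = 0" by simp
    then have "\<kappa> (p 1) \<in> E'" using Q0[of "\<kappa> (p 1)"] by (simp add: w_def)
    moreover have "p 1 = plaque_map c x" by (simp add: p_def l_def d_def)
    ultimately have "\<eta> (\<phi> (plaque_map c x)) \<in> E'" "\<phi> (plaque_map c x) \<in> W"
      using O'W(1)[OF pO[of 1]] by (simp_all add: \<kappa>_def)
    then show "\<phi> (plaque_map c x) \<in> N" using W(4) by blast
  qed
qed

text \<open>Openness is immediate, as plaques belong to the subbasis. Connectedness comes from the
  parametrisation by the convex set \<open>range P \<inter> ball 0 \<rho>\<close>, whose continuity
  into the leaf topology is tested on integral manifolds by
  \<open>integral_manifold_open_in_plaque\<close>.\<close>

lemma plaque_connected:
  assumes adm: "\<And>d. norm d < \<rho> \<Longrightarrow> strictly_admissible c d" and cE: "c \<in> E"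
  shows "connectedin (leaf_topology A M D) (plaque c \<rho>)" "openin (leaf_topology A M D) (plaque c \<rho>)"
proof -
  have int: "integral_manifold A M D (plaque c \<rho>)" by (rule plaque_integral_manifold[OF adm cE])
  then show "openin (leaf_topology A M D) (plaque c \<rho>)"
    unfolding leaf_topology_def by (simp add: topology_generated_by_Basis)
  define X where "X = range P \<inter> ball 0 \<rho>"
  define f where "f = (\<lambda>x. \<phi> (plaque_map c x))"
  have im: "f ` X = plaque c \<rho>" by (auto simp: f_def X_def plaque_def plaque_coords_def)
  have "continuous_map (top_of_set X) (leaf_topology A M D) f"
    unfolding leaf_topology_def
  proof (rule continuous_on_generated_topo)
    fix N assume "N \<in> {N. integral_manifold A M D N}"
    then have N: "integral_manifold A M D N" by simp
    show "openin (top_of_set X) (f -` N \<inter> topspace (top_of_set X))"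
      unfolding openin_contains_ball
    proof (intro conjI ballI)
      fix x1 assume "x1 \<in> f -` N \<inter> topspace (top_of_set X)"
      then have "norm x1 < \<rho>" "\<phi> (plaque_map c x1) \<in> N" by (auto simp: X_def f_def)
      from integral_manifold_open_in_plaque[OF adm N this] obtain \<delta> where
        "\<delta> > 0" "\<And>x. norm (x - x1) < \<delta> \<Longrightarrow> f x \<in> N" unfolding f_def by blast
      then show "\<exists>e>0. ball x1 e \<inter> X \<subseteq> f -` N \<inter> topspace (top_of_set X)"
        by (intro exI[of _ \<delta>]) (auto simp: dist_norm norm_minus_commute)
    qed auto
  next
    show "f ` topspace (top_of_set X) \<subseteq> \<Union> {N. integral_manifold A M D N}"
      using im int by auto
  qed
  moreover have "connected X"
    unfolding X_def by (intro convex_connected convex_Int convex_ball subspace_imp_convex subspace_range_P)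
  ultimately show "connectedin (leaf_topology A M D) (plaque c \<rho>)"
    using connectedin_continuous_map_image[of "top_of_set X" _ f X] im
    by (metis connectedin_subtopology connectedin_iff_connected order_refl)
qed

end

text \<open>A passage from a centre within \<open>s\<close> of \<open>p0\<close> along its plaque
  and back covers at most \<open>2 * K * \<rho>\<close>, so all solutions in question stay in the
  ball of radius \<open>R\<close>.\<close>

locale small_box = fibre_box +
  fixes \<rho> s :: real
  assumes \<rho>: "\<rho> > 0" "L * \<rho> < 1/2" and s: "s > 0" "s + 2 * K * \<rho> < R"
begin

text \<open>Since \<open>P\<close> advances by the \<open>P\<close>-part of the parameter, flowing
  with \<open>P (p0 - p)\<close> leads to the point of the plaque of \<open>p\<close> whose
  \<open>P\<close>-component is that of \<open>p0\<close>. This point labels the plaque.\<close>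

definition base :: "'b \<Rightarrow> 'b" where "base p = plaque_map p (P (p0 - p))"

text \<open>A region saturated by plaques: it consists of the points \<open>plaque_map c x\<close>
  with \<open>c\<close> within \<open>s\<close> of \<open>p0\<close>, \<open>P c = P p0\<close>, and
  \<open>x\<close> in \<open>range P\<close> of norm below \<open>\<rho>\<close>. Stating conditions
  on \<open>p\<close> itself makes openness a matter of continuity.\<close>

definition box :: "'b set" where
  "box = {p \<in> ball p0 (R - K * \<rho>). norm (P (p - p0)) < \<rho> \<and> norm (base p - p0) < s}"

definition transversal :: "'b set" where "transversal = {c \<in> E. norm (c - p0) < s \<and> P c = P p0}"

definition nbhd :: "'a set" where "nbhd = U \<inter> \<psi> -` box"

lemma ball_admissible:
  assumes "p \<in> ball p0 (R - K * \<rho>)" "norm d < \<rho>"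
  shows "strictly_admissible p d"
proof -
  have "L * norm d \<le> L * \<rho>" "K * norm d \<le> K * \<rho>" using assms pos by (auto intro!: mult_left_mono)
  then show ?thesis using assms \<rho> by (simp add: strictly_admissible_def dist_norm norm_minus_commute)
qed

lemma center_admissible:
  assumes "norm (c - p0) < s" "norm d < \<rho>"
  shows "strictly_admissible c d"
proof (rule ball_admissible)
  have "K * \<rho> \<ge> 0" using pos \<rho> by simp
  then show "c \<in> ball p0 (R - K * \<rho>)" using assms s by (simp add: dist_norm norm_minus_commute)
qed (rule assms)

lemma norm_P_minus: "norm (P (p0 - p)) = norm (P (p - p0))"
  by (metis norm_minus_cancel minus_diff_eq linear_neg[OF P(1)])

text \<open>Time reversal makes the passage from \<open>p\<close> to its base point invertible: the
  parameter \<open>P (p - p0)\<close> leads back.\<close>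

lemma box_decompose:
  assumes p: "p \<in> box"
  shows "norm (base p - p0) < s" "P (base p) = P p0" "p \<in> E \<Longrightarrow> base p \<in> E"
    "norm (P (p - p0)) < \<rho>" "plaque_map (base p) (P (p - p0)) = p"
proof -
  show 1: "norm (base p - p0) < s" and 2: "norm (P (p - p0)) < \<rho>" using p by (auto simp: box_def)
  have "norm (P (p0 - p)) < \<rho>" using 2 norm_P_minus by simp
  then have ad: "admissible p (P (p0 - p))"
    using p by (intro strictly_admissible_imp ball_admissible) (auto simp: box_def)
  show "P (base p) = P p0" unfolding base_def plaque_map_P[OF ad] by (simp add: P_simps)
  show "base p \<in> E" if "p \<in> E" unfolding base_def by (rule plaque_map_E[OF ad that])
  have eq: "P (p - p0) = - P (p0 - p)" by (simp add: P_simps)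
  have "admissible (base p) (- P (p0 - p))"
    unfolding eq[symmetric] by (intro strictly_admissible_imp center_admissible 1 2)
  then show "plaque_map (base p) (P (p - p0)) = p"
    unfolding eq base_def by (intro plaque_map_reverse ad) (simp add: base_def)
qed

lemma box_compose:
  assumes c: "norm (c - p0) < s" "P c = P p0" and x: "P x = x" "norm x < \<rho>"
  shows "plaque_map c x \<in> box" "base (plaque_map c x) = c" "P (plaque_map c x - p0) = x"
proof -
  define p where "p = plaque_map c x"
  have ad: "admissible c x" by (intro strictly_admissible_imp center_admissible c x)
  show P: "P (plaque_map c x - p0) = x" using plaque_map_P[OF ad] c x by (simp add: P_simps)
  have "norm (p - p0) \<le> norm (p - c) + norm (c - p0)"
    using norm_triangle_ineq[of "p - c" "c - p0"] by simp
  moreover have "norm (p - c) \<le> K * norm x" unfolding p_def by (rule plaque_map_near[OF ad])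
  moreover have "K * norm x \<le> K * \<rho>" using x pos by (auto intro!: mult_left_mono)
  ultimately have pb: "p \<in> ball p0 (R - K * \<rho>)" using c s by (simp add: dist_norm norm_minus_commute)
  have "P (p0 - p) = - P (p - p0)" by (simp add: P_simps)
  then have Pm: "P (p0 - p) = - x" using P by (simp add: p_def)
  have "plaque_map (plaque_map c x) (- x) = c"
  proof (rule plaque_map_reverse[OF ad])
    show "admissible (plaque_map c x) (- x)"
      unfolding p_def[symmetric] by (intro strictly_admissible_imp ball_admissible pb) (use x in simp)
  qed
  then show b: "base (plaque_map c x) = c" unfolding base_def using Pm by (simp add: p_def)
  show "plaque_map c x \<in> box" unfolding box_def using pb P b c x by (simp add: p_def)
qed

lemma box_ball: "box \<subseteq> ball p0 r"
proof -
  have "K * \<rho> \<ge> 0" using pos \<rho> by simp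
  then have "ball p0 (R - K * \<rho>) \<subseteq> ball p0 R" by (intro subset_ball) simp
  moreover have "box \<subseteq> ball p0 (R - K * \<rho>)" unfolding box_def by blast
  ultimately show ?thesis using ball_R by blast
qed

text \<open>\<open>base\<close> is Lipschitz where it is given by an admissible flow, by the
  dependence of solutions on initial point and parameter.\<close>

lemma open_box: "open box"
proof -
  define T where "T = ball p0 (R - K * \<rho>) \<inter> {p. norm (P (p - p0)) < \<rho>}"
  have cP: "continuous_on X (\<lambda>p. P (p - a))" for X a
    by (intro bounded_linear.continuous_on[of P] continuous_intros) (use P(1) in \<open>simp add: linear_conv_bounded_linear\<close>)
  have oT: "open T" unfolding T_def by (intro open_Int open_ball open_Collect_less continuous_on_norm cP continuous_on_const)
  have ad: "admissible p (P (p0 - p))" if "p \<in> T" for p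
    using that norm_P_minus by (intro strictly_admissible_imp ball_admissible) (auto simp: T_def)
  have "continuous_on T base"
    unfolding continuous_on_iff
  proof (intro ballI allI impI)
    fix p e :: 'b and \<epsilon> :: real assume p: "p \<in> T" and \<epsilon>: "\<epsilon> > 0"
    define C where "C = 2 * (1 + K)"
    have C: "C > 0" using pos by (simp add: C_def)
    show "\<exists>d>0. \<forall>x'\<in>T. dist x' p < d \<longrightarrow> dist (base x') (base p) < \<epsilon>"
    proof (intro exI[of _ "\<epsilon> / C"] conjI ballI impI)
      fix q assume q: "q \<in> T" "dist q p < \<epsilon> / C"
      have "norm (P (p0 - q) - P (p0 - p)) = norm (P (p - q))" by (simp add: P_simps)
      then have "norm (P (p0 - q) - P (p0 - p)) \<le> norm (q - p)" using P(3)[of "p - q"] by (simp add: norm_minus_commute)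
      then have "K * norm (P (p0 - q) - P (p0 - p)) \<le> K * norm (q - p)" using pos by (intro mult_left_mono) auto
      moreover have "norm (base q - base p) \<le> 2 * (norm (q - p) + K * norm (P (p0 - q) - P (p0 - p)))"
        unfolding base_def by (rule plaque_map_Lipschitz[OF ad[OF q(1)] ad[OF p]])
      ultimately have "norm (base q - base p) \<le> C * norm (q - p)" by (simp add: C_def algebra_simps)
      also have "\<dots> < \<epsilon>" using q(2) C by (simp add: dist_norm field_simps)
      finally show "dist (base q) (base p) < \<epsilon>" by (simp add: dist_norm)
    qed (use \<epsilon> C in simp)
  qed
  moreover have "box = T \<inter> base -` ball p0 s"
    by (auto simp: box_def T_def dist_norm norm_minus_commute)
  ultimately show ?thesis using continuous_on_open_vimage[OF oT] by (metis Int_commute open_ball)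
qed

lemma open_nbhd: "open nbhd"
  unfolding nbhd_def
  using continuous_on_open_vimage[OF compatible_chartD(1)[OF chart]] chart_continuous(1)[OF chart] open_box
  by (metis Int_commute)

lemma plaque_nbhd:
  assumes c: "c \<in> transversal"
  shows "plaque c \<rho> = {z \<in> M \<inter> nbhd. base (\<psi> z) = c}"
proof (intro set_eqI iffI)
  have c': "norm (c - p0) < s" "P c = P p0" "c \<in> E" using c by (auto simp: transversal_def)
  fix z assume "z \<in> plaque c \<rho>"
  then obtain x where "x \<in> range P \<inter> ball 0 \<rho>" "z = \<phi> (plaque_map c x)"
    unfolding plaque_def plaque_coords_def by blast
  then have x: "P x = x" "norm x < \<rho>" "z = \<phi> (plaque_map c x)" using P_range by auto
  note b = box_compose[OF c'(1,2) x(1,2)]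
  have pr: "plaque_map c x \<in> ball p0 r" using b(1) box_ball by blast
  have "plaque_map c x \<in> E"
    by (rule plaque_map_E[OF strictly_admissible_imp[OF center_admissible[OF c'(1) x(2)]] c'(3)])
  then show "z \<in> {z \<in> M \<inter> nbhd. base (\<psi> z) = c}"
    using b coord_U[OF pr] coord_M[OF pr] x(3) by (simp add: nbhd_def)
next
  fix z assume z: "z \<in> {z \<in> M \<inter> nbhd. base (\<psi> z) = c}"
  then have p: "\<psi> z \<in> box" "z \<in> U" by (auto simp: nbhd_def)
  note b = box_decompose[OF p(1)]
  have "\<psi> z = plaque_map c (P (\<psi> z - p0))" using b(5) z by simp
  then have "\<psi> z \<in> plaque_coords c \<rho>" unfolding plaque_coords_def using b(4)
    by (intro image_eqI) auto
  then show "z \<in> plaque c \<rho>" unfolding plaque_def using inv_chart[OF chart p(2)] by (metis imageI)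
qed

lemma nbhd_transversal:
  assumes "z \<in> M \<inter> nbhd"
  shows "base (\<psi> z) \<in> transversal"
proof -
  have z: "\<psi> z \<in> box" "z \<in> U" "z \<in> M" using assms by (auto simp: nbhd_def)
  then have "\<psi> z \<in> E" using slice by blast
  then show ?thesis using box_decompose[OF z(1)] by (simp add: transversal_def)
qed

lemma transversal_plaque:
  assumes "c \<in> transversal"
  shows "connectedin (leaf_topology A M D) (plaque c \<rho>)" "openin (leaf_topology A M D) (plaque c \<rho>)"
  using plaque_connected[OF center_admissible] assms by (auto simp: transversal_def)

text \<open>\<open>M \<inter> nbhd\<close> is the disjoint union of the plaques through the
  transversal, each open and connected in the leaf topology. The local leaf is connected and meets
  the plaque of \<open>z\<close>, so it cannot meet the open union \<open>V\<close> of the others;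
  connectedness of the plaque gives the other inclusion.\<close>

lemma local_leaf_eq_plaque:
  assumes z: "z \<in> M \<inter> nbhd"
  shows "local_leaf A M D nbhd z = plaque (base (\<psi> z)) \<rho>"
proof -
  define T where "T = leaf_topology A M D"
  define c where "c = base (\<psi> z)"
  have c: "c \<in> transversal" unfolding c_def by (rule nbhd_transversal[OF z])
  have zc: "z \<in> plaque c \<rho>" using plaque_nbhd[OF c] z by (simp add: c_def)
  note cp = transversal_plaque[folded T_def]
  show ?thesis unfolding c_def[symmetric]
  proof
    have "plaque c \<rho> \<subseteq> leaf A M D z"
      unfolding leaf_def T_def[symmetric] using cp(1)[OF c] zc by (rule connected_component_of_maximal)
    then have "connectedin (subtopology T (leaf A M D z \<inter> nbhd)) (plaque c \<rho>)"
      using cp(1)[OF c] plaque_nbhd[OF c] by (auto simp: connectedin_subtopology)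
    then show "plaque c \<rho> \<subseteq> local_leaf A M D nbhd z"
      unfolding local_leaf_def T_def[symmetric] using zc by (rule connected_component_of_maximal)
  next
    define C where "C = local_leaf A M D nbhd z"
    have "connectedin (subtopology T (leaf A M D z \<inter> nbhd)) C"
      unfolding C_def local_leaf_def T_def by (rule connectedin_connected_component_of)
    then have conn: "connectedin T C" and CU: "C \<subseteq> nbhd" by (auto simp: connectedin_subtopology)
    have "topspace T \<subseteq> M"
      unfolding T_def leaf_topology_def by (auto simp: integral_manifold_def)
    then have CM: "C \<subseteq> M \<inter> nbhd" using conn CU connectedin_subset_topspace by blast
    define V where "V = (\<Union>c'\<in>transversal - {c}. plaque c' \<rho>)"
    have oV: "openin T V" unfolding V_def using cp(2) by (intro openin_Union) auto
    have cover: "C \<subseteq> plaque c \<rho> \<union> V"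
    proof
      fix y assume "y \<in> C"
      then have y: "y \<in> M \<inter> nbhd" using CM by blast
      then have "y \<in> plaque (base (\<psi> y)) \<rho>" using plaque_nbhd[OF nbhd_transversal[OF y]] by blast
      then show "y \<in> plaque c \<rho> \<union> V" using nbhd_transversal[OF y] unfolding V_def by (cases "base (\<psi> y) = c") auto
    qed
    have disj: "plaque c \<rho> \<inter> V = {}" unfolding V_def using plaque_nbhd c by auto
    have zC: "z \<in> C"
    proof -
      have "z \<in> topspace T" using cp(1)[OF c] zc connectedin_subset_topspace by blast
      then have "z \<in> leaf A M D z"
        unfolding leaf_def T_def by (simp add: connected_component_of_refl)
      then show ?thesis using \<open>z \<in> topspace T\<close> z
        unfolding C_def local_leaf_def T_def by (simp add: connected_component_of_refl topspace_subtopology)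
    qed
    have "V \<inter> C = {}"
    proof (rule ccontr)
      assume "V \<inter> C \<noteq> {}"
      moreover have "plaque c \<rho> \<inter> C \<noteq> {}" using zC zc by blast
      ultimately show False
        using conn cover disj oV cp(2)[OF c] unfolding connectedin by (metis inf_bot_left)
    qed
    then show "local_leaf A M D nbhd z \<subseteq> plaque c \<rho>" using cover unfolding C_def by blast
  qed
qed

end

section \<open>Solving equations near a nondegenerate zero\<close>

text \<open>The simplified Newton map \<open>x - inv B (G x)\<close> halves distances when
  \<open>G\<close> deviates from \<open>B\<close> by at most half the lower bound of
  \<open>B\<close>. The threshold \<open>\<epsilon>\<close> is chosen before \<open>\<rho>\<close>
  and \<open>G\<close>, so it serves all plaques and step sizes at once.\<close>

lemma unique_zero_contraction:
  fixes B :: "'e::euclidean_space \<Rightarrow> 'e"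
  assumes V: "subspace V" and B: "linear B" "inj B" "\<And>x. B x \<in> V \<Longrightarrow> x \<in> V"
  shows "\<exists>\<epsilon>>0. \<forall>\<rho>>0. \<forall>G. (\<forall>x\<in>V \<inter> ball 0 \<rho>. G x \<in> V) \<and>
     (\<forall>x\<in>V \<inter> ball 0 \<rho>. \<forall>y\<in>V \<inter> ball 0 \<rho>. norm (G x - G y - B (x - y)) \<le> \<epsilon> * norm (x - y)) \<and>
     norm (G 0) \<le> \<epsilon> * \<rho> / 2 \<longrightarrow> (\<exists>!x. x \<in> V \<inter> ball 0 \<rho> \<and> G x = 0)"
proof -
  obtain k where k: "k > 0" "\<And>v. k * norm v \<le> norm (B v)"
    using linear_inj_bounded_below_pos[OF B(1,2)] by blast
  define Bi where "Bi = inv B"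
  have BBi: "B (Bi w) = w" for w
    unfolding Bi_def using linear_injective_imp_surjective[OF B(1,2)] by (simp add: surj_f_inv_f)
  have BiB: "Bi (B w) = w" for w unfolding Bi_def using B(2) by simp
  have linBi: "linear Bi" unfolding Bi_def by (rule inj_linear_imp_inv_linear[OF B(1,2)])
  have nBi: "norm (Bi w) \<le> norm w / k" for w using k(2)[of "Bi w"] k(1) by (simp add: BBi field_simps)
  have BiV: "Bi w \<in> V" if "w \<in> V" for w using B(3)[of "Bi w"] that by (simp add: BBi)
  define \<epsilon> where "\<epsilon> = k / 2"
  have \<epsilon>: "\<epsilon> > 0" using k by (simp add: \<epsilon>_def)
  have "\<exists>!x. x \<in> V \<inter> ball 0 \<rho> \<and> G x = 0"
    if \<rho>: "\<rho> > 0" and GV: "\<forall>x\<in>V \<inter> ball 0 \<rho>. G x \<in> V"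
      and GB: "\<forall>x\<in>V \<inter> ball 0 \<rho>. \<forall>y\<in>V \<inter> ball 0 \<rho>. norm (G x - G y - B (x - y)) \<le> \<epsilon> * norm (x - y)"
      and G0: "norm (G 0) \<le> \<epsilon> * \<rho> / 2" for \<rho> and G :: "'e \<Rightarrow> 'e"
  proof -
    define T where "T x = x - Bi (G x)" for x
    have T: "norm (T x - T y) \<le> norm (x - y) / 2" if "x \<in> V \<inter> ball 0 \<rho>" "y \<in> V \<inter> ball 0 \<rho>" for x y
    proof -
      have "T x - T y = Bi (- (G x - G y - B (x - y)))"
        by (simp add: T_def linear_diff[OF linBi] BiB)
      also have "norm \<dots> \<le> norm (G x - G y - B (x - y)) / k"
        using nBi[of "- (G x - G y - B (x - y))"] by (simp only: norm_minus_cancel)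
      also have "\<dots> \<le> \<epsilon> * norm (x - y) / k" using GB that k(1) by (intro divide_right_mono) auto
      also have "\<dots> = norm (x - y) / 2" using k(1) by (simp add: \<epsilon>_def)
      finally show ?thesis .
    qed
    \<comment> \<open>Existence uses the closed ball of half the radius, a complete set that the
      bound on \<open>G 0\<close> makes invariant; uniqueness in the full open ball comes directly
      from the estimate and the lower bound of \<open>B\<close>.\<close>
    define S where "S = V \<inter> cball 0 (\<rho>/2)"
    have S: "S \<subseteq> V \<inter> ball 0 \<rho>" using \<rho> by (auto simp: S_def)
    have 0: "0 \<in> S" using \<rho> subspace_0[OF V] by (simp add: S_def)
    have "\<exists>!x\<in>S. T x = x"
    proof (rule Banach_fix)
      show "complete S" unfolding S_def using closed_subspace[OF V] by (intro complete_eq_closed[THEN iffD2] closed_Int) auto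
      show "S \<noteq> {}" using 0 by blast
      show "T ` S \<subseteq> S"
      proof (intro image_subsetI)
        fix x assume x: "x \<in> S"
        have "T x \<in> V" unfolding T_def using x S GV BiV by (intro subspace_diff V) auto
        moreover have "norm (T x) \<le> norm (T x - T 0) + norm (T 0)"
          using norm_triangle_ineq[of "T x - T 0" "T 0"] by simp
        moreover have "norm (T x - T 0) \<le> norm x / 2" using T[OF subsetD[OF S x] subsetD[OF S 0]] by simp
        moreover have "norm (T 0) \<le> norm (G 0) / k" using nBi[of "G 0"] by (simp add: T_def)
        moreover have "norm (G 0) / k \<le> \<rho> / 4"
          using G0 k(1) by (simp add: \<epsilon>_def field_simps)
        moreover have "norm x \<le> \<rho> / 2" using x by (simp add: S_def)
        ultimately have "T x \<in> V" "norm (T x) \<le> \<rho> / 2" by (blast, linarith)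
        then show "T x \<in> S" by (simp add: S_def)
      qed
      show "dist (T x) (T y) \<le> 1/2 * dist x y" if "x \<in> S" "y \<in> S" for x y
        using T[OF subsetD[OF S that(1)] subsetD[OF S that(2)]] by (simp add: dist_norm)
    qed auto
    then obtain x where x: "x \<in> S" "T x = x" by blast
    then have "Bi (G x) = 0" by (simp add: T_def)
    then have Gx: "G x = 0" using BBi[of "G x"] linear_0[OF B(1)] by simp
    have uniq: "y = x" if y: "y \<in> V \<inter> ball 0 \<rho>" "G y = 0" for y
    proof -
      have "norm (G y - G x - B (y - x)) \<le> \<epsilon> * norm (y - x)" using GB y(1) x S by blast
      then have "norm (B (y - x)) \<le> \<epsilon> * norm (y - x)" using y Gx by simp
      then have "(k / 2) * norm (y - x) \<le> 0" using k(2)[of "y - x"] by (simp add: \<epsilon>_def)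
      then show ?thesis using k(1) by (simp add: mult_le_0_iff)
    qed
    show ?thesis
    proof (rule ex1I[of _ x])
      show "x \<in> V \<inter> ball 0 \<rho> \<and> G x = 0" using Gx subsetD[OF S x(1)] by (rule conjI[rotated])
      show "\<And>y. y \<in> V \<inter> ball 0 \<rho> \<and> G y = 0 \<Longrightarrow> y = x" by (elim conjE) (rule uniq)
    qed
  qed
  note key = this
  show ?thesis
  proof (intro exI[of _ \<epsilon>] conjI \<epsilon> allI impI, elim conjE)
    fix \<rho> :: real and G :: "'e \<Rightarrow> 'e"
    assume "0 < \<rho>" "\<forall>x\<in>V \<inter> ball 0 \<rho>. G x \<in> V"
      "\<forall>x\<in>V \<inter> ball 0 \<rho>. \<forall>y\<in>V \<inter> ball 0 \<rho>. norm (G x - G y - B (x - y)) \<le> \<epsilon> * norm (x - y)"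
      "norm (G 0) \<le> \<epsilon> * \<rho> / 2"
    then show "\<exists>!x. x \<in> V \<inter> ball 0 \<rho> \<and> G x = 0" by (rule key)
  qed
qed

text \<open>Step sizes of both signs occur; for negative \<open>h\<close> the mean value theorem is
  applied on the interval from \<open>h\<close> to 0.\<close>

lemma mvt_from_zero:
  fixes k :: "real \<Rightarrow> real"
  assumes "h \<noteq> 0" "k 0 = 0" "\<And>s. \<bar>s\<bar> \<le> \<bar>h\<bar> \<Longrightarrow> (k has_real_derivative k' s) (at s)"
  shows "\<exists>s. \<bar>s\<bar> \<le> \<bar>h\<bar> \<and> k h / h = k' s"
proof (cases "h > 0")
  case True
  have "\<exists>z>0. z < h \<and> k h - k 0 = (h - 0) * k' z"
    by (rule MVT2[OF True]) (use assms(3) True in auto)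
  then obtain z where z: "z > 0" "z < h" "k h - k 0 = (h - 0) * k' z" by blast
  then have "k h / h = k' z" using assms(2) True by simp
  then show ?thesis using z by (intro exI[of _ z]) auto
next
  case False
  then have h: "h < 0" using assms(1) by simp
  have "\<exists>z>h. z < 0 \<and> k 0 - k h = (0 - h) * k' z"
    by (rule MVT2[OF h]) (use assms(3) h in auto)
  then obtain z where z: "z > h" "z < 0" "k 0 - k h = (0 - h) * k' z" by blast
  then have "k h / h = k' z" using assms(2) h by (simp add: field_simps)
  then show ?thesis using z by (intro exI[of _ z]) auto
qed

lemma gradient_vector:
  fixes f :: "'e::euclidean_space \<Rightarrow> real"
  assumes "linear f"
  shows "(\<Sum>b\<in>Basis. f b *\<^sub>R b) \<bullet> v = f v"
  unfolding linear_Basis_expansion[OF assms, of v]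
  by (simp add: inner_sum_left mult.commute inner_commute[of v])

text \<open>If \<open>n b\<close> are the gradients of the \<open>g b\<close> at \<open>p0\<close> and \<open>\<pi>\<close> projects to their common kernel, the map
  \<open>p \<mapsto> (\<Sum>b. g b p *\<^sub>R n b) + \<pi> (p - p0)\<close> is a local diffeomorphism whose inverse carries
  lines in the kernel to curves in the zero set.\<close>

lemma kernel_tangent_to_zero_set:
  fixes g :: "'i \<Rightarrow> 'e::euclidean_space \<Rightarrow> real"
  assumes I: "finite I" and S: "open S" "p0 \<in> S" and sm: "\<And>b. b \<in> I \<Longrightarrow> smooth_on S (g b)"
    and g0: "\<And>b. b \<in> I \<Longrightarrow> g b p0 = 0"
    and surj: "\<And>c. \<exists>u. \<forall>b\<in>I. frechet_derivative (g b) (at p0) u = c b"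
    and E: "subspace E" "\<And>p. p \<in> S \<Longrightarrow> (\<And>b. b \<in> I \<Longrightarrow> g b p = 0) \<Longrightarrow> p \<in> E"
    and k: "\<And>b. b \<in> I \<Longrightarrow> frechet_derivative (g b) (at p0) k = 0"
  shows "k \<in> E"
proof -
  define Dg where "Dg p b = frechet_derivative (g b) (at p)" for p b
  have Dg: "(g b has_derivative Dg p b) (at p)" if "b \<in> I" "p \<in> S" for p b
    unfolding Dg_def by (rule smooth_on_has_derivative[OF sm[OF that(1)] that(2)])
  define n where "n b = (\<Sum>e\<in>Basis. Dg p0 b e *\<^sub>R e)" for b
  have n: "n b \<bullet> v = Dg p0 b v" if "b \<in> I" for b v
    unfolding n_def by (rule gradient_vector[OF has_derivative_linear[OF Dg[OF that S(2)]]])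
  define KK where "KK = {v. \<forall>b\<in>I. n b \<bullet> v = 0}"
  have subK: "subspace KK" unfolding KK_def by (auto intro!: subspaceI simp: inner_add_right)
  obtain \<pi> where \<pi>: "linear \<pi>" "\<And>x. \<pi> x \<in> KK" "\<And>x. x \<in> KK \<Longrightarrow> \<pi> x = x" "\<And>x y. \<pi> x \<bullet> y = x \<bullet> \<pi> y"
    using ex_orthogonal_projection[OF subK] by metis
  have bl\<pi>: "bounded_linear \<pi>" using \<pi>(1) by (simp add: linear_conv_bounded_linear)
  have \<pi>n: "\<pi> (n b) = 0" if "b \<in> I" for b
  proof -
    have "\<pi> (n b) \<bullet> \<pi> (n b) = n b \<bullet> \<pi> (\<pi> (n b))" by (rule \<pi>(4))
    also have "\<dots> = 0" using \<pi>(2) that by (auto simp: KK_def)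
    finally show ?thesis by simp
  qed
  \<comment> \<open>The gradients are orthogonal to their common kernel \<open>KK\<close>, so the
    sum of a combination of gradients and a vector of \<open>KK\<close> determines both
    parts.\<close>
  have split0: "(\<Sum>b\<in>I. c b *\<^sub>R n b) = 0 \<and> \<pi> v = w" if "(\<Sum>b\<in>I. c b *\<^sub>R n b) + \<pi> v = w" "w \<in> KK" for c v w
  proof -
    have "\<pi> (\<Sum>b\<in>I. c b *\<^sub>R n b) = 0"
      by (simp add: linear_sum[OF \<pi>(1)] linear_scale[OF \<pi>(1)] \<pi>n)
    moreover have "\<pi> ((\<Sum>b\<in>I. c b *\<^sub>R n b) + \<pi> v) = \<pi> w" using that(1) by simp
    ultimately have "\<pi> v = w" using \<pi>(2,3) that(2) by (simp add: linear_add[OF \<pi>(1)])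
    then show ?thesis using that(1) by simp
  qed
  \<comment> \<open>Surjectivity supplies a vector on which the differentials take the values
    \<open>c b\<close>; pairing the combination with it produces the sum of the squares of the
    coefficients.\<close>
  have coeff0: "\<forall>b\<in>I. c b = 0" if "(\<Sum>b\<in>I. c b *\<^sub>R n b) = 0" for c
  proof -
    obtain u where u: "\<forall>b\<in>I. Dg p0 b u = c b" using surj[of c] unfolding Dg_def by blast
    have "(\<Sum>b\<in>I. c b *\<^sub>R n b) \<bullet> u = (\<Sum>b\<in>I. c b * c b)"
      using n u by (simp add: inner_sum_left)
    then have "(\<Sum>b\<in>I. c b * c b) = 0" using that by simp
    then show ?thesis using I by (simp add: sum_nonneg_eq_0_iff)
  qed
  define f where "f p = (\<Sum>b\<in>I. g b p *\<^sub>R n b) + \<pi> (p - p0)" for p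
  define f' where "f' p v = (\<Sum>b\<in>I. Dg p b v *\<^sub>R n b) + \<pi> v" for p v
  have d: "(f has_derivative f' p) (at p)" if "p \<in> S" for p
    unfolding f_def f'_def
    by (intro has_derivative_add has_derivative_sum has_derivative_scaleR_left Dg that
        has_derivative_eq_rhs[OF bounded_linear.has_derivative[OF bl\<pi>]])
      (auto intro!: derivative_eq_intros)
  have bl: "bounded_linear (f' p)" if "p \<in> S" for p by (rule has_derivative_bounded_linear[OF d[OF that]])
  have lin0: "linear (f' p0)" by (rule has_derivative_linear[OF d[OF S(2)]])
  have f'K: "f' p0 v = v" if "v \<in> KK" for v
    using that n \<pi>(3) by (simp add: f'_def KK_def)
  have inj: "inj (f' p0)"
    unfolding linear_injective_0[OF lin0]
  proof (intro allI impI)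
    fix v assume "f' p0 v = 0"
    then have "(\<Sum>b\<in>I. Dg p0 b v *\<^sub>R n b) = 0 \<and> \<pi> v = 0"
      unfolding f'_def by (rule split0) (rule subspace_0[OF subK])
    moreover have "\<forall>b\<in>I. Dg p0 b v = 0" using coeff0[of "\<lambda>b. Dg p0 b v"] calculation by simp
    then have "v \<in> KK" using n by (simp add: KK_def)
    ultimately show "v = 0" using \<pi>(3) by metis
  qed
  define inv' where "inv' = Blinfun (inv (f' p0))"
  have bli: "bounded_linear (inv (f' p0))"
    using inj_linear_imp_inv_linear[OF lin0 inj] by (simp add: linear_conv_bounded_linear)
  have inv': "inv' o\<^sub>L Blinfun (f' p0) = id_blinfun"
    by (rule blinfun_eqI) (simp add: inv'_def bounded_linear_Blinfun_apply[OF bli]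
        bounded_linear_Blinfun_apply[OF bl[OF S(2)]] inv_f_f[OF inj])
  have cont: "continuous_on S (\<lambda>p. Blinfun (f' p))"
  proof (rule continuous_on_blinfun_componentwise)
    fix e :: 'e assume "e \<in> Basis"
    have "continuous_on S (\<lambda>p. f' p e)"
      unfolding f'_def Dg_def
      by (intro continuous_intros smooth_on_continuous_on[OF smooth_on_frechet_derivative[OF sm]])
    then show "continuous_on S (\<lambda>p. blinfun_apply (Blinfun (f' p)) e)"
      using bounded_linear_Blinfun_apply[OF bl] by (simp cong: continuous_on_cong)
  qed
  have d': "(f has_derivative blinfun_apply (Blinfun (f' p))) (at p)" if "p \<in> S" for p
    using d[OF that] bounded_linear_Blinfun_apply[OF bl[OF that]] by simp
  obtain U' V' h h' where ift: "open U'" "U' \<subseteq> S" "p0 \<in> U'" "open V'" "f p0 \<in> V'" "homeomorphism U' V' f h"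
    "\<And>y. y \<in> V' \<Longrightarrow> (h has_derivative h' y) (at y)"
    using inverse_function_theorem[OF S(1) d' cont S(2) inv'] by metis
  have fp0: "f p0 = 0" using g0 by (simp add: f_def linear_0[OF \<pi>(1)])
  have h0: "h 0 = p0" using ift(6,3) fp0 by (metis homeomorphism_apply1)
  have hV: "h y \<in> U'" "f (h y) = y" if "y \<in> V'" for y
    using ift(6) that by (auto simp: homeomorphism_def)
  have kK: "k \<in> KK" using k n by (simp add: KK_def Dg_def)
  have hk: "h' 0 k = k"
  proof -
    have hd: "(h has_derivative h' 0) (at 0)" using ift(5,7) fp0 by simp
    have "((\<lambda>y. f (h y)) has_derivative (\<lambda>v. f' p0 (h' 0 v))) (at 0)"
      by (rule has_derivative_compose[OF hd]) (use d[OF S(2)] h0 in simp)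
    moreover have "((\<lambda>y. f (h y)) has_derivative (\<lambda>v. v)) (at 0)"
      by (rule has_derivative_transform_within_open[OF has_derivative_ident ift(4)]) (use ift(5) fp0 hV in auto)
    ultimately have "f' p0 (h' 0 k) = k" using has_derivative_unique by metis
    then show ?thesis using f'K[OF kK] injD[OF inj] by metis
  qed
  define l where "l t = t *\<^sub>R k" for t :: real
  have "((\<lambda>t. h (l t)) has_derivative (\<lambda>t. h' 0 (t *\<^sub>R k))) (at 0)"
  proof (rule has_derivative_compose[where f = l and g = h and f' = "\<lambda>t. t *\<^sub>R k" and g' = "h' 0"])
    show "(l has_derivative (\<lambda>t. t *\<^sub>R k)) (at 0)"
      unfolding l_def[abs_def] by (auto intro!: derivative_eq_intros)
    show "(h has_derivative h' 0) (at (l 0))" using ift(5,7) fp0 by (simp add: l_def)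
  qed
  note hl = this
  \<comment> \<open>The inverse \<open>h\<close> carries the line spanned by \<open>k\<close>, as
    far as it lies in \<open>V'\<close>, into the common zero set and hence into \<open>E\<close>;
    the velocity of this curve at 0 is \<open>h' 0 k = k\<close>.\<close>
  have "(\<lambda>t. h' 0 (t *\<^sub>R k)) 1 \<in> E"
  proof (rule has_derivative_in_subspace[OF hl _ _ _ E(1)])
    show "open (l -` V')" unfolding l_def by (intro open_vimage ift(4) continuous_intros)
    show "0 \<in> l -` V'" using ift(5) fp0 by (simp add: l_def)
    fix t assume "t \<in> l -` V'"
    then have lt: "l t \<in> V'" by simp
    have hS: "h (l t) \<in> S" using hV(1)[OF lt] ift(2) by blast
    have "l t \<in> KK" unfolding l_def by (rule subspace_scale[OF subK kK])
    then have "(\<Sum>b\<in>I. g b (h (l t)) *\<^sub>R n b) = 0 \<and> \<pi> (h (l t) - p0) = l t"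
      using hV(2)[OF lt] unfolding f_def by (rule split0[rotated])
    then have "\<forall>b\<in>I. g b (h (l t)) = 0" using coeff0[of "\<lambda>b. g b (h (l t))"] by simp
    then show "h (l t) \<in> E" using E(2)[OF hS] by simp
  qed
  then show ?thesis using hk by simp
qed

section \<open>Hamiltonian vector fields of the constraints\<close>

text \<open>A basis \<open>B\<close> turns the map into the dual space into finitely many scalar
  constraints. The assumption \<open>range_P\<close> normalises the parameters at the centre, where
  the frame becomes \<open>P\<close> itself.\<close>

locale constraint_box = fibre_box A \<omega> F p0 r R K L M U \<psi> E P
  for A :: "('p::topological_space, 'e::euclidean_space) chart set" and \<omega> :: "'p \<Rightarrow> 'e \<Rightarrow> 'e \<Rightarrow> real"
    and F :: "'e \<Rightarrow> 'e \<Rightarrow> 'e" and p0 :: 'e and r R K L :: real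
    and M :: "'p set" and U :: "'p set" and \<psi> :: "'p \<Rightarrow> 'e" and E :: "'e set" and P :: "'e \<Rightarrow> 'e" +
  fixes J :: "'p \<Rightarrow> 'v::real_vector \<Rightarrow> real" and B :: "'v set"
  assumes smooth_J: "smooth_dual_map A J" and regular_J: "regular_value_dual A J (\<lambda>_. 0)"
    and M_eq: "M = J -` {\<lambda>_. 0}"
    and basis: "finite B" "independent B" "span B = UNIV"
    and range_P: "range P = range (F p0)"
begin

lemma J_linear: "linear (J z)" and J_smooth: "smooth_map A euclidean_atlas UNIV (\<lambda>z. J z v)"
  using smooth_J by (auto simp: smooth_dual_map_def)

lemma J_zero_iff: "J z = (\<lambda>_. 0) \<longleftrightarrow> (\<forall>b\<in>B. J z b = 0)"
proof
  assume "\<forall>b\<in>B. J z b = 0"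
  then have "J z v = 0" for v
    using linear_eq_0_on_span[OF J_linear, of B z v] basis(3) by auto
  then show "J z = (\<lambda>_. 0)" by auto
qed auto

lemma p0_ball: "p0 \<in> ball p0 r"
proof -
  have "p0 \<in> cball p0 R" using pos by simp
  then show ?thesis using S(2) by blast
qed

definition constraint :: "'v \<Rightarrow> 'e \<Rightarrow> real" where "constraint v = (\<lambda>z. J z v) \<circ> \<phi>"

lemma constraint_smooth: "smooth_on (ball p0 r) (constraint v)"
  unfolding constraint_def by (rule smooth_on_subset[OF smooth_map_in_chart[OF chart J_smooth] ball_U])

lemma constraint_zero_iff: "p \<in> ball p0 r \<Longrightarrow> p \<in> E \<longleftrightarrow> (\<forall>b\<in>B. constraint b p = 0)"
  using coord_M[of p] J_zero_iff[of "\<phi> p"] by (simp add: M_eq constraint_def)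

definition dconstraint :: "'v \<Rightarrow> 'e \<Rightarrow> 'e \<Rightarrow> real" where
  "dconstraint v p = frechet_derivative (constraint v) (at p)"

lemma dconstraint: "p \<in> ball p0 r \<Longrightarrow> (constraint v has_derivative dconstraint v p) (at p)"
  unfolding dconstraint_def by (rule smooth_on_has_derivative[OF constraint_smooth])

lemma dconstraint_linear: "p \<in> ball p0 r \<Longrightarrow> linear (dconstraint v p)"
  using has_derivative_linear[OF dconstraint] .

lemma dconstraint_E:
  assumes "p \<in> ball p0 r" "p \<in> E" "b \<in> B" "e \<in> E"
  shows "dconstraint b p e = 0"
  by (rule derivative_along_subspace_zero[OF dconstraint[OF assms(1)] open_ball assms(1) E(1) assms(2,4), where c = 0])
    (use assms(3) constraint_zero_iff in blast)

lemma dconstraint_surj: "\<exists>u. \<forall>b\<in>B. dconstraint b p0 u = c b"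
proof -
  obtain \<alpha> where \<alpha>: "linear \<alpha>" "\<forall>b\<in>B. \<alpha> b = c b"
    using linear_independent_extend[OF basis(2), of c] by blast
  define z where "z = \<phi> p0"
  have z: "z \<in> U" "\<psi> z = p0" using coord_U[OF p0_ball] by (auto simp: z_def)
  have "J z = (\<lambda>_. 0)" using coord_M[OF p0_ball] E(2) by (simp add: M_eq z_def)
  then obtain u where u: "\<And>v. differential A (\<lambda>y. J y v) z u = \<alpha> v"
    using regular_J \<alpha>(1) unfolding regular_value_dual_def by blast
  have "dconstraint b p0 (tangent_coord A \<psi> z u) = \<alpha> b" for b
    using u[of b] unfolding differential_in_chart[OF chart z(1) J_smooth] dconstraint_def constraint_def z(2) .
  then show ?thesis using \<alpha>(2) by (intro exI[of _ "tangent_coord A \<psi> z u"]) simp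
qed

abbreviation "om \<equiv> chart_form A \<omega> U \<psi>"

lemma om_bilinear: "p \<in> ball p0 r \<Longrightarrow> bilinear (om p)"
  by (rule chart_form_bilinear[OF chart subsetD[OF ball_U] form_bilinear])

lemma om_nondegenerate: "p \<in> ball p0 r \<Longrightarrow> (\<And>v. om p u v = 0) \<Longrightarrow> u = 0"
  by (rule chart_form_nondegenerate[OF chart subsetD[OF ball_U]])

lemma om_antisym: "p \<in> ball p0 r \<Longrightarrow> om p u v = - om p v u"
  by (rule alternating_antisym[OF om_bilinear chart_form_alternating[OF chart subsetD[OF ball_U]]])

definition flat :: "'e \<Rightarrow> 'e \<Rightarrow> 'e" where "flat p x = (\<Sum>e\<in>Basis. om p x e *\<^sub>R e)"

lemma flat_inner: "p \<in> ball p0 r \<Longrightarrow> flat p x \<bullet> v = om p x v"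
  unfolding flat_def by (rule gradient_vector[OF bilinear_linear_right[OF om_bilinear]])

lemma flat_linear: "p \<in> ball p0 r \<Longrightarrow> linear (flat p)"
  unfolding flat_def
  by (intro linear_compose_sum ballI linearI)
    (auto simp: bilinear_ladd[OF om_bilinear] bilinear_lmul[OF om_bilinear] scaleR_left_distrib)

lemma flat_inj: "p \<in> ball p0 r \<Longrightarrow> inj (flat p)"
proof -
  assume p: "p \<in> ball p0 r"
  have "x = 0" if "flat p x = 0" for x
  proof (rule om_nondegenerate[OF p])
    show "om p x v = 0" for v using flat_inner[OF p, of x v] that by simp
  qed
  then show ?thesis using linear_injective_0[OF flat_linear[OF p]] by blast
qed

definition grad :: "'v \<Rightarrow> 'e \<Rightarrow> 'e" where "grad b p = (\<Sum>e\<in>Basis. dconstraint b p e *\<^sub>R e)"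

text \<open>The Hamiltonian vector field of the constraint \<open>b\<close> in coordinates:
  \<open>flat p\<close> is the musical isomorphism of the form at \<open>p\<close>, and inverting it
  on the gradient solves \<open>om p X v = dconstraint b p v\<close> for \<open>X\<close>.\<close>

definition hfield :: "'v \<Rightarrow> 'e \<Rightarrow> 'e" where "hfield b p = inv (flat p) (grad b p)"

lemma flat_hfield: "p \<in> ball p0 r \<Longrightarrow> flat p (hfield b p) = grad b p"
  unfolding hfield_def
  using linear_injective_imp_surjective[OF flat_linear flat_inj] by (simp add: surj_f_inv_f)

lemma hfield: "p \<in> ball p0 r \<Longrightarrow> om p (hfield b p) v = dconstraint b p v"
  using flat_inner[of p "hfield b p" v] flat_hfield[of p b]
    gradient_vector[OF dconstraint_linear, of p b v] by (simp add: grad_def)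

lemma hfield_smooth: "smooth_on (ball p0 r) (hfield b)"
proof -
  have flat_sm: "smooth_on (ball p0 r) (\<lambda>p. flat p v)" for v
    unfolding flat_def
    by (intro smooth_on_sum open_ball smooth_on_bounded_linear_comp[OF _ bounded_linear_scaleR_left]
        smooth_on_subset[OF chart_form_smooth[OF chart] ball_U])
  have grad_sm: "smooth_on (ball p0 r) (grad b)"
    unfolding grad_def dconstraint_def
    by (intro smooth_on_sum open_ball smooth_on_bounded_linear_comp[OF _ bounded_linear_scaleR_left]
        smooth_on_frechet_derivative constraint_smooth)
  have "smooth_on (ball p0 r) (\<lambda>p. inv (flat p) (grad b p))"
    by (rule linear_family_smooth[OF open_ball _ smooth_linear_inverse[OF open_ball] grad_sm])
      (use inj_linear_imp_inv_linear flat_linear flat_inj flat_sm in blast)+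
  then show ?thesis by (simp add: hfield_def[abs_def])
qed

text \<open>A constraint is constant on \<open>E\<close>, so its Hamiltonian vector is
  \<open>om p\<close>-orthogonal to \<open>E\<close>.\<close>

lemma hfield_range: "p \<in> ball p0 r \<Longrightarrow> p \<in> E \<Longrightarrow> b \<in> B \<Longrightarrow> hfield b p \<in> range (F p)"
  using range_F hfield dconstraint_E by simp

text \<open>By regularity some \<open>u\<close> has \<open>dconstraint b p0 u = c b\<close> for all
  \<open>b\<close> in \<open>B\<close>; pairing the vanishing combination with it gives the sum of
  the squares of the coefficients.\<close>

lemma hfield_independent:
  assumes "(\<Sum>b\<in>B. c b *\<^sub>R hfield b p0) = 0"
  shows "\<forall>b\<in>B. c b = 0"
proof -
  note b = om_bilinear[OF p0_ball]
  obtain u where u: "\<forall>b\<in>B. dconstraint b p0 u = c b" using dconstraint_surj by blast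
  have l: "linear (\<lambda>x. om p0 x u)" by (rule bilinear_linear_left[OF b])
  have "om p0 (\<Sum>b\<in>B. c b *\<^sub>R hfield b p0) u = (\<Sum>b\<in>B. c b * c b)"
    using u by (simp add: linear_sum[OF l] linear_scale[OF l] hfield[OF p0_ball])
  then have "(\<Sum>b\<in>B. c b * c b) = 0" using assms by (simp add: linear_0[OF l])
  then show ?thesis using basis(1) by (simp add: sum_nonneg_eq_0_iff)
qed

text \<open>Duality: the part \<open>z\<close> of \<open>flat p0 w\<close> orthogonal to all
  constraint gradients is annihilated by the constraint differentials, hence tangent to the zero set
  and in \<open>E\<close>, where \<open>om p0 w\<close> vanishes. So \<open>z\<close> is orthogonal
  to itself, and \<open>flat p0 w\<close> is a combination of gradients.\<close>

lemma hfield_span: "range (F p0) \<subseteq> span ((\<lambda>b. hfield b p0) ` B)"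
proof
  fix w assume w: "w \<in> range (F p0)"
  have kerE: "k \<in> E" if "\<And>b. b \<in> B \<Longrightarrow> dconstraint b p0 k = 0" for k
  proof (rule kernel_tangent_to_zero_set[OF basis(1) open_ball p0_ball constraint_smooth])
    show "constraint b p0 = 0" if "b \<in> B" for b using that constraint_zero_iff[OF p0_ball] E(2) by blast
    show "\<exists>u. \<forall>b\<in>B. frechet_derivative (constraint b) (at p0) u = c b" for c
      using dconstraint_surj unfolding dconstraint_def .
    show "p \<in> E" if "p \<in> ball p0 r" "\<And>b. b \<in> B \<Longrightarrow> constraint b p = 0" for p
      using that constraint_zero_iff by blast
    show "frechet_derivative (constraint b) (at p0) k = 0" if "b \<in> B" for b
      using \<open>\<And>b. b \<in> B \<Longrightarrow> dconstraint b p0 k = 0\<close>[OF that] unfolding dconstraint_def .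
  qed (rule E(1))
  define V where "V = span ((\<lambda>b. grad b p0) ` B)"
  have V: "V = span ((\<lambda>b. grad b p0) ` B)" by (simp add: V_def)
  have subV: "subspace V" by (simp add: V)
  obtain \<pi> where \<pi>: "linear \<pi>" "\<And>x. \<pi> x \<in> V" "\<And>x. x \<in> V \<Longrightarrow> \<pi> x = x" "\<And>x y. \<pi> x \<bullet> y = x \<bullet> \<pi> y"
    using ex_orthogonal_projection[OF subV] by metis
  define z where "z = flat p0 w - \<pi> (flat p0 w)"
  have zV: "y \<bullet> z = 0" if "y \<in> V" for y
    using \<pi>(3)[OF that] \<pi>(4)[of "flat p0 w" y] by (simp add: z_def inner_diff_left inner_diff_right inner_commute)
  have "z \<in> E"
  proof (rule kerE)
    fix b assume "b \<in> B"
    then have "grad b p0 \<in> V" unfolding V by (intro span_base) auto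
    then have "grad b p0 \<bullet> z = 0" using zV by simp
    then show "dconstraint b p0 z = 0"
      using gradient_vector[OF dconstraint_linear[OF p0_ball], of b z] by (simp add: grad_def)
  qed
  then have "flat p0 w \<bullet> z = 0"
    using w range_F[OF p0_ball E(2)] flat_inner[OF p0_ball] by auto
  moreover have "\<pi> (flat p0 w) \<bullet> z = 0" using zV[OF \<pi>(2)] .
  ultimately have "z \<bullet> z = 0" by (subst (1) z_def) (simp add: inner_diff_left)
  then have "flat p0 w \<in> V" using \<pi>(2)[of "flat p0 w"] by (simp add: z_def)
  also have "(\<lambda>b. grad b p0) ` B = flat p0 ` (\<lambda>b. hfield b p0) ` B"
    by (simp add: image_image flat_hfield[OF p0_ball])
  then have "V = flat p0 ` span ((\<lambda>b. hfield b p0) ` B)"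
    unfolding V by (simp add: linear_span_image[OF flat_linear[OF p0_ball]])
  finally obtain x where "x \<in> span ((\<lambda>b. hfield b p0) ` B)" "flat p0 w = flat p0 x" by auto
  then show "w \<in> span ((\<lambda>b. hfield b p0) ` B)" using injD[OF flat_inj[OF p0_ball]] by metis
qed

end

section \<open>Consistent methods in coordinates\<close>

lemma smooth_on_Pair:
  assumes "open S" "smooth_on S f" "smooth_on S g"
  shows "smooth_on S (\<lambda>x. (f x, g x))"
proof -
  have 1: "bounded_linear (\<lambda>y. (y, 0))" "bounded_linear (\<lambda>y. (0, y))"
    by (auto intro!: bounded_linear_Pair bounded_linear_ident bounded_linear_zero)
  have "smooth_on S (\<lambda>x. (f x, 0) + (0, g x))"
    by (intro smooth_on_add assms smooth_on_bounded_linear_comp[OF assms(1) 1(1)]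
        smooth_on_bounded_linear_comp[OF assms(1) 1(2)])
  then show ?thesis by simp
qed

context atlas begin

text \<open>\<open>\<Omega>\<close> collects the step sizes and coordinates for which a point and
  its image lie in one chart domain; there smoothness over the product atlas becomes smoothness of a
  map between vector spaces.\<close>

lemma method_smooth_in_chart:
  fixes meth :: "real \<Rightarrow> 'p \<Rightarrow> 'p"
  assumes m: "consistent_method A X I meth" and W: "(W, \<eta>) \<in> A"
  defines "\<Omega> \<equiv> {x. fst x \<in> I \<and> snd x \<in> \<eta> ` W \<and> meth (fst x) (inv_into W \<eta> (snd x)) \<in> W}"
  shows "open \<Omega>" "smooth_on \<Omega> (\<lambda>x. \<eta> (meth (fst x) (inv_into W \<eta> (snd x))))"
proof -
  have cW: "compatible_chart A (W, \<eta>)" using atlas_compatible[OF W] .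
  define f where "f = (\<lambda>(h, z). meth h z)"
  have I: "open I" and fsm: "smooth_map (prod_atlas euclidean_atlas A) A (I \<times> UNIV) f"
    using m by (auto simp: consistent_method_def f_def)
  have cf: "continuous_on (I \<times> UNIV) f" using fsm by (simp add: smooth_map_def)
  define T where "T = I \<times> \<eta> ` W"
  have oT: "open T" unfolding T_def by (intro open_Times I compatible_chartD(2)[OF cW])
  have "continuous_on T (\<lambda>x. f (fst x, inv_into W \<eta> (snd x)))"
  proof (rule continuous_on_compose2[OF cf])
    show "continuous_on T (\<lambda>x. (fst x, inv_into W \<eta> (snd x)))"
      by (intro continuous_on_Pair continuous_on_fst continuous_on_id
          continuous_on_compose2[OF chart_continuous(2)[OF cW] continuous_on_snd[OF continuous_on_id]]) (auto simp: T_def)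
  qed (auto simp: T_def)
  moreover have "\<Omega> = T \<inter> (\<lambda>x. f (fst x, inv_into W \<eta> (snd x))) -` W" by (auto simp: \<Omega>_def T_def f_def)
  ultimately show o: "open \<Omega>"
    using continuous_on_open_vimage[OF oT] compatible_chartD(1)[OF cW] by (metis Int_commute)
  have inj: "inj_on (map_prod (\<lambda>x. x) \<eta>) (UNIV \<times> W)"
    using compatible_chartD(4)[OF cW] by (auto simp: inj_on_def)
  have inv: "inv_into (UNIV \<times> W) (map_prod (\<lambda>x. x) \<eta>) x = (fst x, inv_into W \<eta> (snd x))" if "snd x \<in> \<eta> ` W" for x :: "real \<times> 'e"
  proof (rule inv_into_f_eq[OF inj])
    show "(fst x, inv_into W \<eta> (snd x)) \<in> UNIV \<times> W" using inv_into_into[OF that] by simp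
    show "map_prod (\<lambda>x. x) \<eta> (fst x, inv_into W \<eta> (snd x)) = x" using f_inv_into_f[OF that] by simp
  qed
  have im: "\<Omega> = map_prod (\<lambda>x. x) \<eta> ` ((UNIV \<times> W) \<inter> (I \<times> UNIV) \<inter> f -` W)"
  proof (intro set_eqI iffI)
    fix x assume x: "x \<in> \<Omega>"
    then have "(fst x, inv_into W \<eta> (snd x)) \<in> (UNIV \<times> W) \<inter> (I \<times> UNIV) \<inter> f -` W"
      using inv_into_into[of "snd x" \<eta> W] by (simp add: \<Omega>_def f_def)
    moreover have "map_prod (\<lambda>x. x) \<eta> (fst x, inv_into W \<eta> (snd x)) = x"
      using x f_inv_into_f[of "snd x" \<eta> W] by (simp add: \<Omega>_def)
    ultimately show "x \<in> map_prod (\<lambda>x. x) \<eta> ` ((UNIV \<times> W) \<inter> (I \<times> UNIV) \<inter> f -` W)" by (metis imageI)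
  next
    fix x assume "x \<in> map_prod (\<lambda>x. x) \<eta> ` ((UNIV \<times> W) \<inter> (I \<times> UNIV) \<inter> f -` W)"
    then obtain h z where "h \<in> I" "z \<in> W" "meth h z \<in> W" "x = (h, \<eta> z)" by (auto simp: f_def)
    then show "x \<in> \<Omega>" using inv_chart[OF cW] by (simp add: \<Omega>_def)
  qed
  have "(UNIV \<times> W, map_prod (\<lambda>x. x) \<eta>) \<in> prod_atlas euclidean_atlas A"
    using W by (auto simp: prod_atlas_def euclidean_atlas_def)
  then have "smooth_on \<Omega> (\<eta> \<circ> f \<circ> inv_into (UNIV \<times> W) (map_prod (\<lambda>x. x) \<eta>))"
    using fsm W unfolding smooth_map_def im by blast
  then show "smooth_on \<Omega> (\<lambda>x. \<eta> (meth (fst x) (inv_into W \<eta> (snd x))))"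
    by (rule smooth_on_cong[OF o, rotated]) (simp add: \<Omega>_def f_def inv)
qed

lemma method_curve:
  assumes m: "consistent_method A X I meth"
  shows "continuous_on I (\<lambda>h. meth h z)" "(snd (chart_at A z) \<circ> (\<lambda>h. meth h z)) differentiable (at 0)"
proof -
  have "continuous_on (I \<times> UNIV) (\<lambda>(h, z). meth h z)"
    using m by (simp add: consistent_method_def smooth_map_def)
  then have "continuous_on I (\<lambda>h. (\<lambda>(h, z). meth h z) (h, z))"
    by (rule continuous_on_compose2) (auto intro!: continuous_intros)
  then show "continuous_on I (\<lambda>h. meth h z)" by simp
  define W where "W = fst (chart_at A z)"
  define \<eta> where "\<eta> = snd (chart_at A z)"
  have W: "(W, \<eta>) \<in> A" "z \<in> W" using chart_at by (auto simp: W_def \<eta>_def)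
  have cW: "compatible_chart A (W, \<eta>)" using atlas_compatible[OF W(1)] .
  define f where "f = (\<lambda>x. \<eta> (meth (fst x) (inv_into W \<eta> (snd x))))"
  have "f differentiable (at (0, \<eta> z))"
    unfolding f_def
    by (rule smooth_on_differentiable[OF method_smooth_in_chart(2)[OF m W(1)]])
      (use m W inv_chart[OF cW] in \<open>auto simp: consistent_method_def\<close>)
  then have "(f has_derivative frechet_derivative f (at (0, \<eta> z))) (at (0, \<eta> z))"
    by (simp add: frechet_derivative_works)
  then have "((\<lambda>h. f (h, \<eta> z)) has_derivative (\<lambda>h. frechet_derivative f (at (0, \<eta> z)) (h, 0))) (at 0)"
    by (intro has_derivative_compose[where f = "\<lambda>h. (h, \<eta> z)" and f' = "\<lambda>h. (h, 0)" and g = f])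
      (auto intro!: derivative_eq_intros)
  moreover have "(\<lambda>h. f (h, \<eta> z)) = \<eta> \<circ> (\<lambda>h. meth h z)"
    using inv_chart[OF cW W(2)] by (auto simp: f_def)
  ultimately show "(snd (chart_at A z) \<circ> (\<lambda>h. meth h z)) differentiable (at 0)"
    unfolding differentiable_def \<eta>_def by metis
qed

end

locale method_box = constraint_box A \<omega> F p0 r R K L M U \<psi> E P J B
  for A :: "('p::topological_space, 'e::euclidean_space) chart set" and \<omega> :: "'p \<Rightarrow> 'e \<Rightarrow> 'e \<Rightarrow> real"
    and F :: "'e \<Rightarrow> 'e \<Rightarrow> 'e" and p0 :: 'e and r R K L :: real
    and M :: "'p set" and U :: "'p set" and \<psi> :: "'p \<Rightarrow> 'e" and E :: "'e set" and P :: "'e \<Rightarrow> 'e"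
    and J :: "'p \<Rightarrow> 'v::real_vector \<Rightarrow> real" and B :: "'v set" +
  fixes H :: "'p \<Rightarrow> real" and meth :: "real \<Rightarrow> 'p \<Rightarrow> 'p" and I :: "real set"
  assumes smooth_H: "smooth_map A euclidean_atlas UNIV H"
    and consistent: "consistent_method A (hamiltonian_vector_field A \<omega> H) I meth"
begin

definition Hc :: "'e \<Rightarrow> real" where "Hc = H \<circ> \<phi>"

definition evol :: "'v \<Rightarrow> real \<times> 'e \<Rightarrow> real" where "evol b x = J (meth (fst x) (\<phi> (snd x))) b"

text \<open>For \<open>b\<close> in \<open>B\<close> the function \<open>evol b\<close> vanishes at
  step size 0 on \<open>E\<close>, so this rate at step size 0 is there the limit of the equation
  divided by \<open>h\<close>.\<close>

definition evol_rate :: "'v \<Rightarrow> real \<times> 'e \<Rightarrow> real" where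
  "evol_rate b x = frechet_derivative (evol b) (at x) (1, 0)"

text \<open>The vectors \<open>F p d\<close> are the velocities of the plaque parametrisation; at
  step size 0 this is the linearisation of the divided equation along the plaque.\<close>

definition evol_slope :: "'v \<Rightarrow> real \<times> 'e \<Rightarrow> 'e \<Rightarrow> real" where
  "evol_slope b x d = frechet_derivative (evol_rate b) (at x) (0, F (snd x) d)"

lemma Hc_smooth: "smooth_on (ball p0 r) Hc"
  unfolding Hc_def by (rule smooth_on_subset[OF smooth_map_in_chart[OF chart smooth_H] ball_U])

lemma evol_0: "evol b (0, p) = constraint b p"
  using consistent by (simp add: evol_def constraint_def consistent_method_def)

text \<open>Smoothness of the method is available in charts of \<open>A\<close>, so the coordinates
  \<open>\<psi>\<close> are routed through the chart chosen at the centre. The method is the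
  identity at step size 0, hence images stay in its domain near \<open>(0, p0)\<close>, and one
  \<open>\<Omega>\<close> serves all \<open>b\<close>.\<close>

lemma evol_smooth:
  obtains \<Omega> where "open \<Omega>" "(0, p0) \<in> \<Omega>" "\<Omega> \<subseteq> I \<times> ball p0 r" "\<And>b. smooth_on \<Omega> (evol b)"
proof -
  define z0 where "z0 = \<phi> p0"
  define V where "V = fst (chart_at A z0)"
  define \<theta> where "\<theta> = snd (chart_at A z0)"
  have V: "(V, \<theta>) \<in> A" "z0 \<in> V" using chart_at by (auto simp: V_def \<theta>_def)
  have cV: "compatible_chart A (V, \<theta>)" using atlas_compatible[OF V(1)] .
  define \<Omega>0 where "\<Omega>0 = {x. fst x \<in> I \<and> snd x \<in> \<theta> ` V \<and> meth (fst x) (inv_into V \<theta> (snd x)) \<in> V}"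
  define f where "f x = \<theta> (meth (fst x) (inv_into V \<theta> (snd x)))" for x
  have O0: "open \<Omega>0" and fsm: "smooth_on \<Omega>0 f"
    unfolding \<Omega>0_def f_def by (rule method_smooth_in_chart[OF consistent V(1)])+
  define \<sigma> where "\<sigma> = \<theta> \<circ> \<phi>"
  define T where "T = \<psi> ` (U \<inter> V) \<inter> ball p0 r"
  have oT: "open T" unfolding T_def by (intro open_Int open_ball open_chart_image chart compatible_chartD(1)[OF cV])
  have \<sigma>sm: "smooth_on T \<sigma>" unfolding \<sigma>_def by (rule smooth_on_subset[OF transition_smooth[OF chart cV]]) (auto simp: T_def)
  have oUT: "open (UNIV \<times> T :: (real \<times> 'e) set)" by (intro open_Times open_UNIV oT)
  have sm_snd: "smooth_on X snd" if "open X" for X :: "(real \<times> 'e) set"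
    by (rule smooth_on_bounded_linear[OF that bounded_linear_snd])
  have sm_fst: "smooth_on X fst" if "open X" for X :: "(real \<times> 'e) set"
    by (rule smooth_on_bounded_linear[OF that bounded_linear_fst])
  define s where "s x = (fst x, \<sigma> (snd x))" for x :: "real \<times> 'e"
  have ssm: "smooth_on (UNIV \<times> T) s"
    unfolding s_def
    by (intro smooth_on_Pair oUT sm_fst smooth_on_compose[OF oUT oT sm_snd[OF oUT] \<sigma>sm]) auto
  define \<Omega> where "\<Omega> = (UNIV \<times> T) \<inter> s -` \<Omega>0"
  have oO: "open \<Omega>" unfolding \<Omega>_def
    using continuous_on_open_vimage[OF oUT] smooth_on_continuous_on[OF ssm] O0 by (metis Int_commute)
  have TV: "\<phi> p \<in> V" "inv_into V \<theta> (\<sigma> p) = \<phi> p" if "p \<in> T" for p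
    using that inv_chart[OF chart] inv_chart[OF cV] by (auto simp: T_def \<sigma>_def)
  show thesis
  proof (rule that[OF oO])
    have p0T: "p0 \<in> T" unfolding T_def
      using V(2) coord_U[OF p0_ball] p0_ball by (auto simp: z0_def intro!: image_eqI[of _ _ "\<phi> p0"])
    have "0 \<in> I" "meth 0 z = z" for z using consistent by (auto simp: consistent_method_def)
    then have "s (0, p0) \<in> \<Omega>0"
      using TV[OF p0T] by (auto simp: \<Omega>0_def s_def \<sigma>_def)
    then show "(0, p0) \<in> \<Omega>" using p0T by (simp add: \<Omega>_def)
    show "\<Omega> \<subseteq> I \<times> ball p0 r" by (auto simp: \<Omega>_def \<Omega>0_def s_def T_def)
    fix b
    define j where "j = (\<lambda>z. J z b) \<circ> inv_into V \<theta>"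
    have jsm: "smooth_on (\<theta> ` V) j" unfolding j_def by (rule smooth_map_in_chart[OF cV J_smooth])
    have ss: "smooth_on \<Omega> s" by (rule smooth_on_subset[OF ssm]) (auto simp: \<Omega>_def)
    have "smooth_on \<Omega> (\<lambda>x. f (s x))"
      by (rule smooth_on_compose[OF oO O0 ss fsm]) (auto simp: \<Omega>_def)
    then have "smooth_on \<Omega> (\<lambda>x. j (f (s x)))"
      by (rule smooth_on_compose[OF oO compatible_chartD(2)[OF cV] _ jsm]) (auto simp: \<Omega>_def \<Omega>0_def f_def)
    then show "smooth_on \<Omega> (evol b)"
    proof (rule smooth_on_cong[OF oO, rotated])
      fix x assume x: "x \<in> \<Omega>"
      then have "snd x \<in> T" "meth (fst x) (\<phi> (snd x)) \<in> V" using TV by (auto simp: \<Omega>_def \<Omega>0_def s_def)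
      then show "j (f (s x)) = evol b x"
        using TV(2) inv_chart[OF cV] by (simp add: j_def f_def s_def evol_def)
    qed
  qed
qed

text \<open>By consistency the rate is the differential of the constraint on \<open>X_H\<close>,
  which is the form evaluated on the constraint's Hamiltonian vector and \<open>X_H\<close>;
  antisymmetry turns it into minus \<open>dH\<close> on that vector.\<close>

lemma evol_rate_0:
  assumes O: "(0, p) \<in> \<Omega>" "\<Omega> \<subseteq> I \<times> ball p0 r" "smooth_on \<Omega> (evol b)"
  shows "evol_rate b (0, p) = - frechet_derivative Hc (at p) (hfield b p)"
proof -
  have p: "p \<in> ball p0 r" using O by auto
  define z where "z = \<phi> p"
  have z: "z \<in> U" "\<psi> z = p" using coord_U[OF p] by (auto simp: z_def)
  define \<gamma> where "\<gamma> h = meth h z" for h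
  have I: "open I" "0 \<in> I" and \<gamma>0: "\<gamma> 0 = z" and vel: "velocity A \<gamma> = hamiltonian_vector_field A \<omega> H z"
    using consistent unfolding consistent_method_def \<gamma>_def[abs_def] by blast+
  have c\<gamma>: "continuous_on I \<gamma>" unfolding \<gamma>_def by (rule method_curve(1)[OF consistent])
  have d\<gamma>: "(snd (chart_at A (\<gamma> 0)) \<circ> \<gamma>) differentiable (at 0)"
    unfolding \<gamma>0 using method_curve(2)[OF consistent, of z] unfolding \<gamma>_def .
  define v where "v = tangent_coord A \<psi> z (hamiltonian_vector_field A \<omega> H z)"
  have "((\<psi> \<circ> \<gamma>) has_derivative (\<lambda>t. t *\<^sub>R v)) (at 0)"
    using velocity_in_chart[OF chart _ I c\<gamma> d\<gamma>] z unfolding \<gamma>0 vel v_def by blast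
  moreover have "(constraint b has_derivative dconstraint b p) (at ((\<psi> \<circ> \<gamma>) 0))"
    using dconstraint[OF p] by (simp add: \<gamma>0 z)
  ultimately have "((\<lambda>h. constraint b ((\<psi> \<circ> \<gamma>) h)) has_derivative (\<lambda>t. dconstraint b p (t *\<^sub>R v))) (at 0)"
    by (rule has_derivative_compose)
  then have "((\<lambda>h. J (\<gamma> h) b) has_derivative (\<lambda>t. dconstraint b p (t *\<^sub>R v))) (at 0)"
  proof (rule has_derivative_transform_within_open)
    show "open (I \<inter> \<gamma> -` U)"
      using c\<gamma> compatible_chartD(1)[OF chart] continuous_on_open_vimage[OF I(1)] by (metis Int_commute)
    show "0 \<in> I \<inter> \<gamma> -` U" using I z \<gamma>0 by simp
    show "constraint b ((\<psi> \<circ> \<gamma>) h) = J (\<gamma> h) b" if "h \<in> I \<inter> \<gamma> -` U" for h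
      using that inv_chart[OF chart] by (simp add: constraint_def)
  qed
  moreover have "((\<lambda>h. evol b (h, p)) has_derivative (\<lambda>t. frechet_derivative (evol b) (at (0, p)) (t, 0))) (at 0)"
    using smooth_on_has_derivative[OF O(3,1)]
    by (intro has_derivative_compose[where f = "\<lambda>h. (h, p)" and f' = "\<lambda>t. (t, 0)" and g = "evol b"])
      (auto intro!: derivative_eq_intros)
  moreover have "(\<lambda>h. J (\<gamma> h) b) = (\<lambda>h. evol b (h, p))" by (simp add: \<gamma>_def z_def evol_def)
  ultimately have "(\<lambda>t. dconstraint b p (t *\<^sub>R v)) = (\<lambda>t. frechet_derivative (evol b) (at (0, p)) (t, 0))"
    using has_derivative_unique by metis
  from fun_cong[OF this, of 1] have "evol_rate b (0, p) = dconstraint b p v"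
    by (simp add: evol_rate_def)
  also have "\<dots> = - om p v (hfield b p)" using hfield[OF p, of b v] om_antisym[OF p, of v] by simp
  also have "om p v (hfield b p) = \<omega> z (hamiltonian_vector_field A \<omega> H z) (coord_tangent A U \<psi> z (hfield b p))"
    unfolding form_eq_chart_form[OF chart z(1), of \<omega>] tangent_coord_inverse[OF chart z(1)] z(2) v_def ..
  also have "\<dots> = frechet_derivative Hc (at p) (hfield b p)"
    unfolding hamiltonian_vector_field[OF smooth_H] differential_in_chart[OF chart z(1) smooth_H]
      tangent_coord_inverse[OF chart z(1)] z(2) Hc_def ..
  finally show ?thesis .
qed

end

section \<open>The linearised equation is the Hessian along the fibre\<close>

context method_box begin

context
  fixes \<rho> :: real and \<Omega> :: "(real \<times> 'e) set"
  assumes \<rho>: "\<rho> > 0" and adm: "\<And>d. norm d < \<rho> \<Longrightarrow> strictly_admissible p0 d"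
    and \<Omega>: "open \<Omega>" "(0, p0) \<in> \<Omega>" "\<Omega> \<subseteq> I \<times> ball p0 r" "\<And>b. smooth_on \<Omega> (evol b)"
    and critical: "\<And>w. w \<in> range P \<Longrightarrow> frechet_derivative Hc (at p0) w = 0"
begin

text \<open>\<open>H\<close> in the straightened chart at \<open>p0\<close>. Its restriction to
  \<open>range P\<close> is \<open>H\<close> on the plaque, so its Hessian on \<open>range P\<close>
  at the critical point is the Hessian along the fibre.\<close>

definition leaf_H :: "'e \<Rightarrow> real" where "leaf_H = H \<circ> inv_into (leaf_dom p0 \<rho>) (leaf_coord p0)"

definition leaf_dH :: "'e \<Rightarrow> 'e \<Rightarrow> real" where "leaf_dH v w = frechet_derivative leaf_H (at w) v"

abbreviation "u \<equiv> plaque_map p0"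
abbreviation "\<Theta> \<equiv> straighten p0 ` box_at p0 \<rho>"

lemma u_ball: "norm x < \<rho> \<Longrightarrow> u x \<in> ball p0 r"
  using plaque_map_in_ball[OF adm] ball_R by blast

lemma u_0: "u 0 = p0"
  using plaque_map_0[of p0] strictly_admissible_imp[OF adm[of 0]] \<rho> by simp

lemma range_P_in_Theta:
  assumes "P x = x" "norm x < \<rho>"
  shows "x \<in> \<Theta>" "unstraighten p0 x = u x"
  using straighten_plaque_map[OF adm assms] by (auto intro: image_eqI[of _ _ "u x"])

lemma leaf_H_eq: "q \<in> \<Theta> \<Longrightarrow> leaf_H q = Hc (unstraighten p0 q)"
  using inv_leaf_coord[OF adm, of \<rho> q] by (simp add: leaf_H_def Hc_def)

lemma open_Theta: "open \<Theta>"
  by (rule open_straighten_image) (rule adm)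

lemma leaf_H_smooth: "smooth_on \<Theta> leaf_H"
proof -
  note oT = open_Theta
  have sub: "\<Theta> \<subseteq> {q. norm (P q) < \<rho>}" "unstraighten p0 ` \<Theta> \<subseteq> ball p0 r"
    using straighten_image[OF adm, of \<rho>] ball_R by auto
  have "smooth_on \<Theta> (\<lambda>q. Hc (unstraighten p0 q))"
    by (rule smooth_on_compose[OF oT open_ball smooth_on_subset[OF unstraighten_smooth[OF adm] sub(1)] Hc_smooth sub(2)])
  from smooth_on_cong[OF oT _ this] show ?thesis using leaf_H_eq by simp
qed

lemma leaf_dH_smooth: "smooth_on \<Theta> (leaf_dH v)"
  unfolding leaf_dH_def by (rule smooth_on_frechet_derivative[OF leaf_H_smooth])

lemma zero_Theta: "0 \<in> \<Theta>"
  using range_P_in_Theta(1)[of 0] \<rho> linear_0[OF P(1)] by simp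

text \<open>At a point of \<open>range P\<close> and in a direction of \<open>range P\<close>, the
  identity and \<open>P\<close> cancel in the derivative of \<open>unstraighten\<close>, which
  leaves the frame vector.\<close>

lemma leaf_dH_eq:
  assumes x: "P x = x" "norm x < \<rho>" and v: "P v = v"
  shows "leaf_dH v x = frechet_derivative Hc (at (u x)) (F (u x) v)"
proof -
  have blP: "bounded_linear P" using P(1) by (simp add: linear_conv_bounded_linear)
  have "((\<lambda>q. plaque_map p0 (P q)) has_derivative (\<lambda>w. F (u x) (P w))) (at x)"
    using plaque_map_has_derivative[OF adm[OF x(2)]] x(1)
    by (intro has_derivative_compose[where f = P and f' = P and g = u])
      (auto intro: bounded_linear_imp_has_derivative[OF blP])
  then have "(unstraighten p0 has_derivative (\<lambda>w. w + F (u x) (P w) - P w)) (at x)"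
    unfolding unstraighten_def
    by (intro has_derivative_diff has_derivative_add has_derivative_ident bounded_linear_imp_has_derivative[OF blP])
  moreover have "(Hc has_derivative frechet_derivative Hc (at (u x))) (at (unstraighten p0 x))"
    unfolding range_P_in_Theta(2)[OF x] by (rule smooth_on_has_derivative[OF Hc_smooth u_ball[OF x(2)]])
  ultimately have "((\<lambda>q. Hc (unstraighten p0 q)) has_derivative
      (\<lambda>w. frechet_derivative Hc (at (u x)) (w + F (u x) (P w) - P w))) (at x)"
    by (rule has_derivative_compose)
  then have "(leaf_H has_derivative (\<lambda>w. frechet_derivative Hc (at (u x)) (w + F (u x) (P w) - P w))) (at x)"
    by (rule has_derivative_transform_within_open[OF _ open_Theta range_P_in_Theta(1)[OF x]])
      (rule leaf_H_eq[symmetric])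
  from fun_cong[OF frechet_derivative_at[OF this], of v] show ?thesis using v by (simp add: leaf_dH_def)
qed

lemma F_p0: "F p0 v = P v"
proof -
  have "P (F p0 v) = F p0 v" using range_P P_range by blast
  then show ?thesis using P_F[OF p0_ball, of v] by simp
qed

lemma leaf_dH_0: "P v = v \<Longrightarrow> leaf_dH v 0 = 0"
  using leaf_dH_eq[of 0 v] \<rho> linear_0[OF P(1)] critical[of v] P_range[of v] by (simp add: u_0 F_p0)

lemma hessian_eq: "hessian leaf_H 0 w v = frechet_derivative (leaf_dH v) (at 0) w"
  by (simp add: hessian_def leaf_dH_def[abs_def])

lemma leaf_dH_has_derivative: "(leaf_dH v has_derivative (\<lambda>w. hessian leaf_H 0 w v)) (at 0)"
  unfolding hessian_eq using smooth_on_has_derivative[OF leaf_dH_smooth zero_Theta] .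

lemma evol_rate_smooth: "smooth_on \<Omega> (evol_rate b)"
  unfolding evol_rate_def by (rule smooth_on_frechet_derivative[OF \<Omega>(4)])

text \<open>On the plaque the rate at step size 0 is minus the derivative of \<open>H\<close> along
  the constraint field, which is expanded in frame vectors with coefficients \<open>a e\<close>. At
  the critical point the derivatives of \<open>H\<close> along the frame vanish, so the product rule
  leaves the coefficients undifferentiated and only the Hessian remains.\<close>

lemma evol_slope_eq_hessian:
  assumes b: "b \<in> B"
  shows "evol_slope b (0, p0) v = - (\<Sum>e\<in>Basis. (P (hfield b p0) \<bullet> e) * hessian leaf_H 0 (P v) (P e))"
proof -
  have blP: "bounded_linear P" using P(1) by (simp add: linear_conv_bounded_linear)
  have P0: "P 0 = 0" by (rule linear_0[OF P(1)])
  \<comment> \<open>Precomposition with \<open>P\<close> lets the plaque be parametrised by a full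
    neighbourhood of 0, where derivatives are unique and two expressions for \<open>k\<close> can be
    compared.\<close>
  define y where "y x = u (P x)" for x
  have dy: "(y has_derivative (\<lambda>w. F p0 (P w))) (at 0)"
    unfolding y_def using plaque_map_has_derivative[OF adm[of 0]] \<rho>
    by (intro has_derivative_compose[where f = P and f' = P and g = u])
      (auto intro: bounded_linear_imp_has_derivative[OF blP] simp: P0 u_0)
  have y0: "y 0 = p0" by (simp add: y_def P0 u_0)
  define k where "k x = evol_rate b (0, y x)" for x
  have dk: "(k has_derivative (\<lambda>w. frechet_derivative (evol_rate b) (at (0, p0)) (0, F p0 (P w)))) (at 0)"
    unfolding k_def
    using smooth_on_has_derivative[OF evol_rate_smooth \<Omega>(2), of b] dy
    by (intro has_derivative_compose[where f = "\<lambda>x. (0, y x)" and f' = "\<lambda>w. (0, F p0 (P w))" and g = "evol_rate b"])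
      (auto intro!: has_derivative_Pair simp: y0)
  define a where "a e x = P (hfield b (y x)) \<bullet> e" for e x
  have cy: "isCont y 0" using has_derivative_continuous[OF dy] .
  have ca: "isCont (a e) 0" for e
  proof -
    have "isCont (hfield b) (y 0)" unfolding y0
      using smooth_on_continuous_on[OF hfield_smooth] p0_ball continuous_on_eq_continuous_at[OF open_ball] by blast
    then have "isCont (\<lambda>x. hfield b (y x)) 0" using cy by (rule isCont_o2[rotated])
    then show ?thesis unfolding a_def
      by (intro isCont_inner continuous_const bounded_linear.isCont[OF blP])
  qed
  have dm: "((\<lambda>x. a e x *\<^sub>R leaf_dH (P e) (P x)) has_derivative
      (\<lambda>w. a e 0 *\<^sub>R hessian leaf_H 0 (P w) (P e))) (at 0)" for e
  proof (rule has_derivative_scaleR_vanishing[OF ca])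
    show "((\<lambda>x. leaf_dH (P e) (P x)) has_derivative (\<lambda>w. hessian leaf_H 0 (P w) (P e))) (at 0)"
      using leaf_dH_has_derivative[of "P e"]
      by (intro has_derivative_compose[where f = P and f' = P and g = "leaf_dH (P e)"])
        (auto intro: bounded_linear_imp_has_derivative[OF blP] simp: P0)
    show "leaf_dH (P e) (P 0) = 0" unfolding P0 by (rule leaf_dH_0) (rule P(2))
  qed
  define N where "N = ball 0 \<rho> \<inter> (\<lambda>x. (0, y x)) -` \<Omega>"
  have "isCont (\<lambda>x. (0::real, y x)) 0" using cy by (intro continuous_Pair continuous_const)
  then have "(\<lambda>x. (0::real, y x)) \<midarrow>0\<rightarrow> (0, p0)" by (simp add: isCont_def y0)
  then have "eventually (\<lambda>x. (0, y x) \<in> \<Omega>) (at 0)" using \<Omega>(1,2) by (rule topological_tendstoD)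
  then obtain \<delta>1 where \<delta>1: "\<delta>1 > 0" "\<And>x. x \<noteq> 0 \<Longrightarrow> dist x 0 < \<delta>1 \<Longrightarrow> (0, y x) \<in> \<Omega>"
    unfolding eventually_at by blast
  define \<delta> where "\<delta> = min \<rho> \<delta>1"
  have \<delta>: "\<delta> > 0" using \<rho> \<delta>1 by (simp add: \<delta>_def)
  have k_eq: "k x = - (\<Sum>e\<in>Basis. a e x *\<^sub>R leaf_dH (P e) (P x))" if x: "x \<in> ball 0 \<delta>" for x
  proof -
    have xr: "norm x < \<rho>" and "norm x < \<delta>1" using x by (auto simp: \<delta>_def)
    then have yO: "(0, y x) \<in> \<Omega>" using \<delta>1(2)[of x] \<Omega>(2) y0 by (cases "x = 0") auto
    have Px: "norm (P x) < \<rho>" using xr P(3)[of x] by simp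
    have yb: "y x \<in> ball p0 r" unfolding y_def by (rule u_ball[OF Px])
    have yE: "y x \<in> E" unfolding y_def by (rule plaque_map_E[OF strictly_admissible_imp[OF adm[OF Px]] E(2)])
    interpret FL: linear "F (y x)" by (rule linF[OF yb])
    interpret HL: linear "frechet_derivative Hc (at (y x))"
      by (rule linear_frechet_derivative[OF smooth_on_differentiable[OF Hc_smooth yb]])
    have "hfield b (y x) = F (y x) (P (hfield b (y x)))"
      using hfield_range[OF yb yE b] F_fixes_range[OF yb] F_P[OF yb] by simp
    also have "\<dots> = (\<Sum>e\<in>Basis. a e x *\<^sub>R F (y x) e)"
      unfolding a_def by (rule linear_Basis_expansion[OF linF[OF yb]])
    also have "\<dots> = (\<Sum>e\<in>Basis. a e x *\<^sub>R F (y x) (P e))" by (simp add: F_P[OF yb])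
    finally have "frechet_derivative Hc (at (y x)) (hfield b (y x)) =
        (\<Sum>e\<in>Basis. a e x *\<^sub>R frechet_derivative Hc (at (y x)) (F (y x) (P e)))"
      by (simp add: HL.sum HL.scale)
    also have "\<dots> = (\<Sum>e\<in>Basis. a e x *\<^sub>R leaf_dH (P e) (P x))"
      using leaf_dH_eq[OF P(2) Px P(2)] by (simp add: y_def)
    finally show ?thesis unfolding k_def evol_rate_0[OF yO \<Omega>(3,4)] by simp
  qed
  have "((\<lambda>x. - (\<Sum>e\<in>Basis. a e x *\<^sub>R leaf_dH (P e) (P x))) has_derivative
      (\<lambda>w. - (\<Sum>e\<in>Basis. a e 0 *\<^sub>R hessian leaf_H 0 (P w) (P e)))) (at 0)"
    by (intro has_derivative_minus has_derivative_sum dm)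
  then have "(k has_derivative (\<lambda>w. - (\<Sum>e\<in>Basis. a e 0 *\<^sub>R hessian leaf_H 0 (P w) (P e)))) (at 0)"
    by (rule has_derivative_transform_within_open[OF _ open_ball[of 0 \<delta>]]) (use \<delta> k_eq in auto)
  from fun_cong[OF has_derivative_unique[OF dk this], of v]
  show ?thesis unfolding evol_slope_def using F_P[OF p0_ball, of v] by (simp add: a_def y0)
qed

text \<open>The second argument of \<open>hessian\<close> is the direction of the inner derivative.
  Linearity in it holds at all points near 0 and survives the outer differentiation.\<close>

lemma hessian_linear_right:
  assumes w: "P w = w"
  shows "hessian leaf_H 0 v w = (\<Sum>e\<in>Basis. (w \<bullet> e) * hessian leaf_H 0 v (P e))"
proof -
  have eq: "leaf_dH w q = (\<Sum>e\<in>Basis. (w \<bullet> e) *\<^sub>R leaf_dH (P e) q)" if q: "q \<in> \<Theta>" for q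
  proof -
    interpret HL: linear "frechet_derivative leaf_H (at q)"
      by (rule linear_frechet_derivative[OF smooth_on_differentiable[OF leaf_H_smooth q]])
    have "w = (\<Sum>e\<in>Basis. (w \<bullet> e) *\<^sub>R P e)"
      using linear_Basis_expansion[OF P(1), of w] w by simp
    then have "leaf_dH w q = frechet_derivative leaf_H (at q) (\<Sum>e\<in>Basis. (w \<bullet> e) *\<^sub>R P e)"
      unfolding leaf_dH_def by (rule arg_cong)
    then show ?thesis by (simp add: HL.sum HL.scale leaf_dH_def)
  qed
  have d: "((\<lambda>q. \<Sum>e\<in>Basis. (w \<bullet> e) *\<^sub>R leaf_dH (P e) q) has_derivative
      (\<lambda>v. \<Sum>e\<in>Basis. (w \<bullet> e) *\<^sub>R hessian leaf_H 0 v (P e))) (at 0)"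
    by (intro has_derivative_sum has_derivative_scaleR_right leaf_dH_has_derivative)
  have "(leaf_dH w has_derivative (\<lambda>v. \<Sum>e\<in>Basis. (w \<bullet> e) *\<^sub>R hessian leaf_H 0 v (P e))) (at 0)"
    by (rule has_derivative_transform_within_open[OF d open_Theta zero_Theta]) (rule eq[symmetric])
  from fun_cong[OF has_derivative_unique[OF leaf_dH_has_derivative this], of v] show ?thesis by simp
qed

text \<open>The constraint fields at \<open>p0\<close> span \<open>range P\<close>, so a vector of
  \<open>range P\<close> killed by all slopes lies in the kernel of the Hessian along the
  fibre.\<close>

lemma evol_slope_injective:
  assumes nondegenerate: "\<And>u. u \<in> range P \<Longrightarrow> (\<And>v. v \<in> range P \<Longrightarrow> hessian leaf_H 0 u v = 0) \<Longrightarrow> u = 0"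
    and v: "P v = v" "\<And>b. b \<in> B \<Longrightarrow> evol_slope b (0, p0) v = 0"
  shows "v = 0"
proof (rule nondegenerate)
  show "v \<in> range P" using v(1) P_range by blast
  fix w assume "w \<in> range P"
  then have w: "P w = w" "w \<in> span ((\<lambda>b. hfield b p0) ` B)"
    using P_range range_P hfield_span by auto
  define \<Lambda> where "\<Lambda> w = (\<Sum>e\<in>Basis. (w \<bullet> e) * hessian leaf_H 0 v (P e))" for w
  have lin: "linear \<Lambda>"
    unfolding \<Lambda>_def by (intro linear_compose_sum ballI linearI) (auto simp: inner_add_left algebra_simps)
  have "\<Lambda> y = 0" if y: "y \<in> (\<lambda>b. hfield b p0) ` B" for y
  proof -
    obtain b where b: "b \<in> B" "y = hfield b p0" using y by blast
    have "P y = y" using hfield_range[OF p0_ball E(2) b(1)] b(2) range_P P_range by simp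
    then show ?thesis using v(2)[OF b(1)] evol_slope_eq_hessian[OF b(1), of v] b(2) v(1) by (simp add: \<Lambda>_def)
  qed
  then have "\<Lambda> w = 0" using linear_eq_0_on_span[OF lin] w(2) by blast
  then show "hessian leaf_H 0 v w = 0" using hessian_linear_right[OF w(1)] by (simp add: \<Lambda>_def)
qed

end

end

section \<open>Local solvability\<close>

text \<open>With \<open>K + 1\<close> in the denominator, radii can be prescribed also when the
  constant \<open>K\<close> is zero.\<close>

lemma mult_le_of_le_divide:
  fixes K a n x :: real
  assumes "0 \<le> K" "0 < n" "0 \<le> x" "x \<le> a / (n * (K + 1))"
  shows "K * x \<le> a / n"
proof -
  have "x * (n * (K + 1)) \<le> a" using assms by (simp add: pos_le_divide_eq)
  then have "(K * x) * n + x * n \<le> a" by (simp add: algebra_simps)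
  moreover have "x * n \<ge> 0" using assms by simp
  ultimately have "(K * x) * n \<le> a" by linarith
  then show ?thesis using assms(2) by (simp add: pos_le_divide_eq)
qed

context method_box begin

lemma evol_slope_family:
  assumes O: "open \<Omega>" "\<Omega> \<subseteq> I \<times> ball p0 r" "smooth_on \<Omega> (evol b)"
  shows "x \<in> \<Omega> \<Longrightarrow> linear (evol_slope b x)" "smooth_on \<Omega> (\<lambda>x. evol_slope b x d)"
    "smooth_on \<Omega> (evol_rate b)"
proof -
  show rate: "smooth_on \<Omega> (evol_rate b)"
    unfolding evol_rate_def by (rule smooth_on_frechet_derivative[OF O(3)])
  show "linear (evol_slope b x)" if x: "x \<in> \<Omega>"
  proof -
    have l: "linear (frechet_derivative (evol_rate b) (at x))"
      by (rule linear_frechet_derivative[OF smooth_on_differentiable[OF rate x]])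
    have lF: "linear (F (snd x))" using x O(2) by (intro linF) auto
    have "linear (\<lambda>d. (0::real, F (snd x) d))"
      by (rule linearI) (simp_all add: linear_add[OF lF] linear_scale[OF lF])
    from linear_compose[OF this l] show ?thesis by (simp add: evol_slope_def[abs_def] o_def)
  qed
  have "smooth_on \<Omega> (\<lambda>x. F (snd x) d)"
    by (rule smooth_on_compose[OF O(1) open_ball smooth_on_bounded_linear[OF O(1) bounded_linear_snd] smoothF])
      (use O(2) in auto)
  then have "smooth_on \<Omega> (\<lambda>x. (0::real, F (snd x) d))"
    by (intro smooth_on_Pair O(1) smooth_on_const)
  from smooth_on_frechet_derivative_field[OF O(1) rate this]
  show "smooth_on \<Omega> (\<lambda>x. evol_slope b x d)" unfolding evol_slope_def .
qed

text \<open>All radii come from estimates at \<open>p0\<close>: near \<open>(0, p0)\<close> the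
  slopes differ little from those at the centre and the rates are small. Every plaque through the
  transversal stays in that region, so the same constants give exactly one solution on each of
  them.\<close>

lemma local_solvability:
  assumes critical: "\<And>w. w \<in> range P \<Longrightarrow> frechet_derivative Hc (at p0) w = 0"
    and nondegenerate: "\<And>\<rho> u. \<rho> > 0 \<Longrightarrow> (\<And>d. norm d < \<rho> \<Longrightarrow> strictly_admissible p0 d) \<Longrightarrow>
      u \<in> range P \<Longrightarrow> (\<And>v. v \<in> range P \<Longrightarrow> hessian (leaf_H \<rho>) 0 u v = 0) \<Longrightarrow> u = 0"
    and N: "open N" "\<phi> p0 \<in> N"
  shows "\<exists>\<rho> s h0. small_box A \<omega> F p0 r R K L M U \<psi> E P \<rho> s \<and>
    small_box.nbhd F p0 R K U \<psi> P \<rho> s \<subseteq> N \<and> 0 < h0 \<and> {-h0<..<h0} \<subseteq> I \<and>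
    (\<forall>h c. 0 < \<bar>h\<bar> \<and> \<bar>h\<bar> < h0 \<and> c \<in> small_box.transversal p0 E P s \<longrightarrow>
      (\<exists>!z'. z' \<in> plaque c \<rho> \<and> J (meth h z') = (\<lambda>_. 0)))"
proof -
  obtain \<Omega> where \<Omega>: "open \<Omega>" "(0, p0) \<in> \<Omega>" "\<Omega> \<subseteq> I \<times> ball p0 r" "\<And>b. smooth_on \<Omega> (evol b)"
    using evol_smooth by blast
  define X where "X b = hfield b p0" for b
  have PX: "P (X b) = X b" if "b \<in> B" for b
    using hfield_range[OF p0_ball E(2) that] range_P P_range by (simp add: X_def)
  note slope_lin = evol_slope_family(1)[OF \<Omega>(1,3,4)]
  define \<beta> where "\<beta> b = evol_slope b (0, p0)" for b
  have \<beta>lin: "linear (\<beta> b)" for b unfolding \<beta>_def by (rule slope_lin[OF \<Omega>(2)])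
  have \<beta>P: "\<beta> b (P v) = \<beta> b v" for b v unfolding \<beta>_def evol_slope_def using F_P[OF p0_ball] by simp
  define \<rho>0 where "\<rho>0 = min (1 / (4 * (L + 1))) (R / (2 * (K + 1)))"
  have \<rho>0: "\<rho>0 > 0" using pos by (simp add: \<rho>0_def)
  have adm0: "strictly_admissible p0 d" if "norm d < \<rho>0" for d
  proof -
    have "L * norm d \<le> 1 / 4" by (rule mult_le_of_le_divide) (use that pos in \<open>auto simp: \<rho>0_def\<close>)
    moreover have "K * norm d \<le> R / 2" by (rule mult_le_of_le_divide) (use that pos in \<open>auto simp: \<rho>0_def\<close>)
    ultimately show ?thesis using pos by (simp add: strictly_admissible_def)
  qed
  have \<beta>inj: "v = 0" if "P v = v" "\<And>b. b \<in> B \<Longrightarrow> \<beta> b v = 0" for v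
    by (rule evol_slope_injective[OF \<rho>0 adm0 \<Omega> critical nondegenerate[OF \<rho>0 adm0] that(1)])
      (use that(2) in \<open>simp_all add: \<beta>_def\<close>)
  \<comment> \<open>Using the slopes as coefficients of the independent vectors \<open>X b\<close>
    merges the scalar equations into one equation in \<open>range P\<close>. The term
    \<open>x - P x\<close> completes the map to an isomorphism of the whole space that preserves
    \<open>range P\<close>.\<close>
  define Bm where "Bm x = (\<Sum>b\<in>B. \<beta> b x *\<^sub>R X b) + (x - P x)" for x
  have PBm: "P (Bm x) = (\<Sum>b\<in>B. \<beta> b x *\<^sub>R X b)" for x
    by (simp add: Bm_def P_simps linear_sum[OF P(1)] linear_scale[OF P(1)] PX)
  have Bmlin: "linear Bm"
    unfolding Bm_def
    by (intro linear_compose_add linear_compose_sum linear_compose_sub linear_ident P(1) ballI linearI)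
      (simp_all add: linear_add[OF \<beta>lin] linear_scale[OF \<beta>lin] scaleR_left_distrib)
  have Bminj: "inj Bm"
    unfolding linear_injective_0[OF Bmlin]
  proof (intro allI impI)
    fix v assume v: "Bm v = 0"
    then have s: "(\<Sum>b\<in>B. \<beta> b v *\<^sub>R X b) = 0" using PBm[of v] by (simp add: linear_0[OF P(1)])
    then have "P v = v" using v by (simp add: Bm_def)
    moreover have "\<beta> b v = 0" if "b \<in> B" for b
      using hfield_independent[of "\<lambda>b. \<beta> b v"] s that by (simp add: X_def)
    ultimately show "v = 0" by (rule \<beta>inj)
  qed
  have BmV: "x \<in> range P" if "Bm x \<in> range P" for x
  proof -
    have "P (Bm x) = Bm x" using that P_range by blast
    then have "P x = x" using PBm[of x] by (simp add: Bm_def)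
    then show ?thesis using P_range by blast
  qed
  obtain \<epsilon> where \<epsilon>: "\<epsilon> > 0" and solve: "\<forall>\<rho>>0. \<forall>G. (\<forall>x\<in>range P \<inter> ball 0 \<rho>. G x \<in> range P) \<and>
     (\<forall>x\<in>range P \<inter> ball 0 \<rho>. \<forall>y\<in>range P \<inter> ball 0 \<rho>. norm (G x - G y - Bm (x - y)) \<le> \<epsilon> * norm (x - y)) \<and>
     norm (G 0) \<le> \<epsilon> * \<rho> / 2 \<longrightarrow> (\<exists>!x. x \<in> range P \<inter> ball 0 \<rho> \<and> G x = 0)"
    using unique_zero_contraction[OF subspace_range_P Bmlin Bminj BmV] by blast
  define C where "C = 1 + (\<Sum>b\<in>B. norm (X b))"
  have C: "C > 0" unfolding C_def by (smt (verit) norm_ge_zero sum_nonneg)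
  \<comment> \<open>Recombining scalar errors with the vectors \<open>X b\<close> costs at most the
    factor \<open>C\<close>.\<close>
  define \<epsilon>' where "\<epsilon>' = \<epsilon> / C"
  have \<epsilon>': "\<epsilon>' > 0" using \<epsilon> C by (simp add: \<epsilon>'_def)
  have sumX: "norm (\<Sum>b\<in>B. a b *\<^sub>R X b) \<le> e * C" if "\<And>b. b \<in> B \<Longrightarrow> \<bar>a b\<bar> \<le> e" "e \<ge> 0" for a e
  proof -
    have "norm (\<Sum>b\<in>B. a b *\<^sub>R X b) \<le> (\<Sum>b\<in>B. e * norm (X b))"
      using that by (intro order_trans[OF norm_sum] sum_mono) (auto intro: mult_right_mono)
    also have "\<dots> \<le> e * C" using that(2) by (simp add: C_def sum_distrib_left[symmetric] mult_left_mono)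
    finally show ?thesis .
  qed
  have "\<exists>d>0. ball (0, p0) d \<subseteq> \<Omega> \<and> (\<forall>q v. q \<in> ball (0, p0) d \<longrightarrow> norm (evol_slope b q v - \<beta> b v) \<le> \<epsilon>' * norm v)" for b
  proof -
    have "isCont (\<lambda>q. evol_slope b q v) (0, p0)" for v
      using smooth_on_continuous_on[OF evol_slope_family(2)[OF \<Omega>(1,3,4)]] \<Omega>(1,2) continuous_on_eq_continuous_at by blast
    from linear_family_continuous_bound[OF \<Omega>(1,2) slope_lin this \<epsilon>'] show ?thesis unfolding \<beta>_def by metis
  qed
  then obtain df where df: "\<And>b. df b > 0" "\<And>b. ball (0, p0) (df b) \<subseteq> \<Omega>"
    "\<And>b q v. q \<in> ball (0, p0) (df b) \<Longrightarrow> norm (evol_slope b q v - \<beta> b v) \<le> \<epsilon>' * norm v" by metis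
  have "open (\<psi> ` (U \<inter> N))" by (rule open_chart_image[OF chart N(1)])
  moreover have "p0 \<in> \<psi> ` (U \<inter> N)" using N(2) coord_U[OF p0_ball] by (auto intro!: image_eqI[of _ _ "\<phi> p0"])
  ultimately obtain dN where dN: "dN > 0" "ball p0 dN \<subseteq> \<psi> ` (U \<inter> N)" using openE by blast
  obtain dO where dO: "dO > 0" "ball (0, p0) dO \<subseteq> \<Omega>" using openE[OF \<Omega>(1,2)] by blast
  define \<delta> where "\<delta> = Min (insert dN (insert dO (df ` B)))"
  have fin: "finite (insert dN (insert dO (df ` B)))" using basis(1) by simp
  have \<delta>: "\<delta> > 0" "\<delta> \<le> dN" "\<delta> \<le> dO" "\<And>b. b \<in> B \<Longrightarrow> \<delta> \<le> df b"
  proof -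
    show "\<delta> > 0" unfolding \<delta>_def using fin dN(1) dO(1) df(1) by (subst Min_gr_iff) auto
    show "\<delta> \<le> dN" "\<delta> \<le> dO" "\<And>b. b \<in> B \<Longrightarrow> \<delta> \<le> df b"
      unfolding \<delta>_def by (rule Min_le[OF fin], simp)+
  qed
  \<comment> \<open>The constants are fixed in the order \<open>\<delta>\<close>,
    \<open>\<rho>\<close>, \<open>e0\<close>, \<open>\<delta>2\<close>, and last \<open>s\<close>
    and \<open>h0\<close>: closeness of the slopes limits the plaque size, which determines how
    small the rates must be at the plaque centres. The eighths leave room for the offset
    \<open>s\<close> within both the radius \<open>R\<close> and the distance
    \<open>\<delta> / 2\<close>.\<close>
  define \<rho> where "\<rho> = min (1 / (4 * (L + 1))) (min (R / (8 * (K + 1))) (\<delta> / (8 * (K + 1))))"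
  have \<rho>: "\<rho> > 0" using pos \<delta> by (simp add: \<rho>_def)
  have "L * \<rho> \<le> 1 / 4" by (rule mult_le_of_le_divide) (use \<rho> pos in \<open>auto simp: \<rho>_def\<close>)
  then have L\<rho>: "L * \<rho> < 1/2" by simp
  have K\<rho>: "K * \<rho> \<le> R / 8" "K * \<rho> \<le> \<delta> / 8"
    by (rule mult_le_of_le_divide; use \<rho> pos in \<open>auto simp: \<rho>_def\<close>)+
  \<comment> \<open>Chosen so that \<open>e0 * C\<close> is the bound
    \<open>\<epsilon> * \<rho> / 2\<close> on \<open>G 0\<close> demanded by the contraction
    lemma.\<close>
  define e0 where "e0 = \<epsilon> * \<rho> / (2 * C)"
  have e0: "e0 > 0" using \<epsilon> \<rho> C by (simp add: e0_def)
  have "\<exists>d>0. \<forall>q. dist q (0, p0) < d \<longrightarrow> \<bar>evol_rate b q\<bar> < e0" if b: "b \<in> B" for b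
  proof -
    have "isCont (evol_rate b) (0, p0)"
      using smooth_on_continuous_on[OF evol_slope_family(3)[OF \<Omega>(1,3,4)]] \<Omega>(1,2) continuous_on_eq_continuous_at by blast
    moreover have "evol_rate b (0, p0) = 0"
      unfolding evol_rate_0[OF \<Omega>(2,3,4)]
      using critical[of "hfield b p0"] hfield_range[OF p0_ball E(2) b] range_P by simp
    ultimately show ?thesis using e0 unfolding continuous_at_eps_delta by (metis dist_norm diff_zero real_norm_def)
  qed
  then obtain dr where dr: "\<And>b. b \<in> B \<Longrightarrow> dr b > 0"
    "\<And>b q. b \<in> B \<Longrightarrow> dist q (0, p0) < dr b \<Longrightarrow> \<bar>evol_rate b q\<bar> < e0" by metis
  define \<delta>2 where "\<delta>2 = Min (insert 1 (dr ` B))"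
  have fin2: "finite (insert 1 (dr ` B))" using basis(1) by simp
  have \<delta>2: "\<delta>2 > 0" "\<And>b. b \<in> B \<Longrightarrow> \<delta>2 \<le> dr b"
  proof -
    show "\<delta>2 > 0" unfolding \<delta>2_def using fin2 dr(1) by (subst Min_gr_iff) auto
    show "\<And>b. b \<in> B \<Longrightarrow> \<delta>2 \<le> dr b" unfolding \<delta>2_def by (rule Min_le[OF fin2]) simp
  qed
  define s where "s = min (R / 4) (min (\<delta> / 4) (\<delta>2 / 2))"
  define h0 where "h0 = min (\<delta> / 2) (\<delta>2 / 2)"
  have s: "s > 0" "s \<le> R / 4" "s \<le> \<delta> / 4" "s \<le> \<delta>2 / 2" using pos \<delta>(1) \<delta>2(1) by (auto simp: s_def)
  have h0: "h0 > 0" "h0 \<le> \<delta> / 2" "h0 \<le> \<delta>2 / 2" using \<delta>(1) \<delta>2(1) by (auto simp: h0_def)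
  have sb: "small_box A \<omega> F p0 r R K L M U \<psi> E P \<rho> s"
    by unfold_locales (use \<rho> L\<rho> s K\<rho> pos in auto)
  interpret sb: small_box A \<omega> F p0 r R K L M U \<psi> E P \<rho> s by (rule sb)
  have dist_pair: "dist (t, p) (0, p0) \<le> \<bar>t\<bar> + norm (p - p0)" for t p
    using norm_Pair_le[of t "p - p0"] by (simp add: dist_norm)
  have near: "norm (plaque_map c x - p0) < \<delta> / 2" if c: "norm (c - p0) < s" and x: "norm x < \<rho>" for c x
  proof -
    have "norm (plaque_map c x - c) \<le> K * norm x"
      by (rule plaque_map_near[OF strictly_admissible_imp[OF sb.center_admissible[OF c x]]])
    also have "\<dots> \<le> K * \<rho>" using x pos by (intro mult_left_mono) auto
    finally show ?thesis
      using norm_triangle_ineq[of "plaque_map c x - c" "c - p0"] c s(3) K\<rho>(2) \<delta>(1) by simp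
  qed
  have "sb.nbhd \<subseteq> N"
  proof
    fix z assume "z \<in> sb.nbhd"
    then have z: "z \<in> U" "\<psi> z \<in> sb.box" by (auto simp: sb.nbhd_def)
    note b = sb.box_decompose[OF z(2)]
    have "norm (\<psi> z - p0) < \<delta> / 2" using near[OF b(1,4)] b(5) by simp
    then have "\<psi> z \<in> ball p0 dN" using \<delta>(1,2) by (simp add: dist_norm norm_minus_commute)
    then obtain y where "y \<in> U" "y \<in> N" "\<psi> z = \<psi> y" using dN(2) by blast
    then show "z \<in> N" using z(1) compatible_chartD(4)[OF chart] by (metis inj_onD)
  qed
  moreover have "{-h0<..<h0} \<subseteq> I"
  proof
    fix h assume "h \<in> {-h0<..<h0}"
    then have "\<bar>h\<bar> < h0" by auto
    then have "dist (h, p0) (0, p0) < dO" using dist_pair[of h p0] h0(2) \<delta>(1,3) by simp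
    then have "(h, p0) \<in> \<Omega>" using dO(2) by (auto simp: dist_commute)
    then show "h \<in> I" using \<Omega>(3) by blast
  qed
  moreover have "\<exists>!z'. z' \<in> plaque c \<rho> \<and> J (meth h z') = (\<lambda>_. 0)"
    if h: "0 < \<bar>h\<bar>" "\<bar>h\<bar> < h0" and c: "c \<in> sb.transversal" for h c
  proof -
    have cs: "norm (c - p0) < s" "c \<in> E" using c by (auto simp: sb.transversal_def)
    have adm: "strictly_admissible c x" if "norm x < \<rho>" for x by (rule sb.center_admissible[OF cs(1) that])
    define y where "y = plaque_map c"
    have y0: "y 0 = c" unfolding y_def by (rule plaque_map_0[OF strictly_admissible_imp[OF adm]]) (use \<rho> in simp)
    have dist_y: "dist (t, y x) (0, p0) < \<delta>" if "\<bar>t\<bar> \<le> \<bar>h\<bar>" "norm x < \<rho>" for t x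
      using dist_pair[of t "y x"] near[OF cs(1) that(2)] that(1) h(2) h0(2) by (simp add: y_def)
    have inO: "(t, y x) \<in> \<Omega>" if "\<bar>t\<bar> \<le> \<bar>h\<bar>" "norm x < \<rho>" for t x
      using dist_y[OF that] dO(2) \<delta>(3) by (auto simp: dist_commute)
    have dt: "((\<lambda>t. evol b (t, p)) has_real_derivative evol_rate b (t, p)) (at t)" if "(t, p) \<in> \<Omega>" for b t p
    proof -
      have "((\<lambda>t. evol b (t, p)) has_derivative (\<lambda>h. frechet_derivative (evol b) (at (t, p)) (h, 0))) (at t)"
        using smooth_on_has_derivative[OF \<Omega>(4) that, of b]
        by (intro has_derivative_compose[where f = "\<lambda>t. (t, p)" and f' = "\<lambda>h. (h, 0)" and g = "evol b"])
          (auto intro!: derivative_eq_intros)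
      moreover have "frechet_derivative (evol b) (at (t, p)) (h, 0) = h * evol_rate b (t, p)" for h
        using linear_scale[OF linear_frechet_derivative[OF smooth_on_differentiable[OF \<Omega>(4) that, of b]], of h "(1, 0)"]
        by (simp add: evol_rate_def)
      ultimately show ?thesis by (simp add: has_field_derivative_def mult_commute_abs)
    qed
    have ev0: "evol b (0, y x) = 0" if "b \<in> B" "norm x < \<rho>" for b x
    proof -
      have "y x \<in> E" unfolding y_def
        by (rule plaque_map_E[OF strictly_admissible_imp[OF adm[OF that(2)]] cs(2)])
      moreover have "y x \<in> ball p0 r" using inO[of 0 x] that(2) \<Omega>(3) by auto
      ultimately show ?thesis using constraint_zero_iff[of "y x"] that(1) by (simp add: evol_0)
    qed
    have est: "\<bar>evol b (h, y x) / h - evol b (h, y x') / h - \<beta> b (x - x')\<bar> \<le> \<epsilon>' * norm (x - x')"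
      if b: "b \<in> B" and x: "norm x < \<rho>" and x': "norm x' < \<rho>" for b x x'
    proof -
      \<comment> \<open>The mean value theorem is applied to the difference of the two points, so
        that one intermediate time \<open>t\<close> serves both and the rates can be compared along
        a segment of plaque parameters.\<close>
      have "\<exists>t. \<bar>t\<bar> \<le> \<bar>h\<bar> \<and> (evol b (h, y x) - evol b (h, y x')) / h = evol_rate b (t, y x) - evol_rate b (t, y x')"
        by (rule mvt_from_zero[of h "\<lambda>t. evol b (t, y x) - evol b (t, y x')"])
          (use h ev0[OF b x] ev0[OF b x'] in \<open>auto intro!: DERIV_diff dt inO x x'\<close>)
      then obtain t where t: "\<bar>t\<bar> \<le> \<bar>h\<bar>"
        "(evol b (h, y x) - evol b (h, y x')) / h = evol_rate b (t, y x) - evol_rate b (t, y x')" by blast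
      define l where "l \<xi> = x' + \<xi> *\<^sub>R (x - x')" for \<xi> :: real
      have l: "norm (l \<xi>) < \<rho>" if "0 \<le> \<xi>" "\<xi> \<le> 1" for \<xi>
      proof -
        have "l \<xi> = (1 - \<xi>) *\<^sub>R x' + \<xi> *\<^sub>R x" by (simp add: l_def algebra_simps)
        then show ?thesis using convexD[OF convex_ball[of 0 \<rho>], of x' x "1 - \<xi>" \<xi>] x x' that by simp
      qed
      have "((\<lambda>\<xi>. evol_rate b (t, y (l \<xi>))) has_derivative (\<lambda>a. evol_slope b (t, y (l \<xi>)) (a *\<^sub>R (x - x'))))
          (at \<xi> within {0..1})" if "0 \<le> \<xi>" "\<xi> \<le> 1" for \<xi>
      proof -
        have "(l has_derivative (\<lambda>a. a *\<^sub>R (x - x'))) (at \<xi> within {0..1})"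
          unfolding l_def[abs_def] by (auto intro!: derivative_eq_intros)
        from has_derivative_compose[OF this plaque_map_has_derivative[OF adm[OF l[OF that]]], folded y_def]
        have "((\<lambda>\<xi>. (t, y (l \<xi>))) has_derivative (\<lambda>a. (0, F (y (l \<xi>)) (a *\<^sub>R (x - x'))))) (at \<xi> within {0..1})"
          by (intro has_derivative_Pair has_derivative_const)
        from has_derivative_compose[OF this smooth_on_has_derivative[OF evol_slope_family(3)[OF \<Omega>(1,3,4)] inO[OF t(1) l[OF that]]]]
        show ?thesis by (simp add: evol_slope_def)
      qed
      from mvt_simple[OF zero_less_one this] obtain \<xi> where \<xi>: "0 < \<xi>" "\<xi> < 1"
        "evol_rate b (t, y (l 1)) - evol_rate b (t, y (l 0)) = evol_slope b (t, y (l \<xi>)) ((1 - 0) *\<^sub>R (x - x'))" by auto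
      have "(t, y (l \<xi>)) \<in> ball (0, p0) (df b)"
        using dist_y[OF t(1) l[of \<xi>]] \<xi>(1,2) \<delta>(4)[OF b] by (simp add: dist_commute)
      from df(3)[OF this, of "x - x'"] show ?thesis
        using t(2) \<xi>(3) by (simp add: l_def diff_divide_distrib)
    qed
    \<comment> \<open>Dividing by \<open>h\<close> and weighting with independent vectors keeps the
      zeros: \<open>G x = 0\<close> holds exactly when \<open>J\<close> vanishes at the image of the
      plaque point under the method.\<close>
    define G where "G x = (\<Sum>b\<in>B. (evol b (h, y x) / h) *\<^sub>R X b)" for x
    have ex1: "\<exists>!x. x \<in> range P \<inter> ball 0 \<rho> \<and> G x = 0"
    proof (rule solve[rule_format, OF \<rho>], intro conjI ballI)
      fix x x' assume x: "x \<in> range P \<inter> ball 0 \<rho>" and x': "x' \<in> range P \<inter> ball 0 \<rho>"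
      then have xx: "P x = x" "P x' = x'" "norm x < \<rho>" "norm x' < \<rho>" using P_range by auto
      have "Bm (x - x') = (\<Sum>b\<in>B. \<beta> b (x - x') *\<^sub>R X b)" using xx by (simp add: Bm_def P_simps)
      then have "G x - G x' - Bm (x - x') =
          (\<Sum>b\<in>B. (evol b (h, y x) / h - evol b (h, y x') / h - \<beta> b (x - x')) *\<^sub>R X b)"
        by (simp add: G_def scaleR_diff_left sum_subtractf)
      also have "norm \<dots> \<le> (\<epsilon>' * norm (x - x')) * C"
        by (rule sumX) (use est xx \<epsilon>' in auto)
      also have "\<dots> = \<epsilon> * norm (x - x')" using C by (simp add: \<epsilon>'_def)
      finally show "norm (G x - G x' - Bm (x - x')) \<le> \<epsilon> * norm (x - x')" .
    next
      fix x
      have "P (G x) = G x" by (simp add: G_def linear_sum[OF P(1)] linear_scale[OF P(1)] PX)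
      then show "G x \<in> range P" using P_range by blast
    next
      have "\<bar>evol b (h, c) / h\<bar> \<le> e0" if b: "b \<in> B" for b
      proof -
        have "\<exists>t. \<bar>t\<bar> \<le> \<bar>h\<bar> \<and> evol b (h, c) / h = evol_rate b (t, c)"
          by (rule mvt_from_zero[of h "\<lambda>t. evol b (t, c)"])
            (use h ev0[OF b, of 0] \<rho> inO[of _ 0] y0 in \<open>auto intro!: dt\<close>)
        then obtain t where t: "\<bar>t\<bar> \<le> \<bar>h\<bar>" "evol b (h, c) / h = evol_rate b (t, c)" by blast
        have "dist (t, c) (0, p0) < dr b"
          using dist_pair[of t c] t(1) h(2) h0(3) cs(1) s(4) \<delta>2(2)[OF b] by simp
        from dr(2)[OF b this] show ?thesis using t(2) by simp
      qed
      then have "norm (G 0) \<le> e0 * C" unfolding G_def y0 using e0 by (intro sumX) auto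
      then show "norm (G 0) \<le> \<epsilon> * \<rho> / 2" using C by (simp add: e0_def)
    qed
    have G_iff: "J (meth h (\<phi> (y x))) = (\<lambda>_. 0) \<longleftrightarrow> G x = 0" for x
    proof -
      have "G x = 0 \<longleftrightarrow> (\<forall>b\<in>B. evol b (h, y x) / h = 0)"
        using hfield_independent[of "\<lambda>b. evol b (h, y x) / h"] by (auto simp: G_def X_def)
      then show ?thesis using h J_zero_iff[of "meth h (\<phi> (y x))"] by (simp add: evol_def)
    qed
    have pl: "plaque c \<rho> = (\<lambda>x. \<phi> (y x)) ` (range P \<inter> ball 0 \<rho>)"
      by (auto simp: plaque_def plaque_coords_def y_def)
    from ex1 obtain x where x: "x \<in> range P \<inter> ball 0 \<rho>" "G x = 0"
      "\<And>x'. x' \<in> range P \<inter> ball 0 \<rho> \<Longrightarrow> G x' = 0 \<Longrightarrow> x' = x" by (elim ex1E conjE) blast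
    show ?thesis
    proof (rule ex1I[of _ "\<phi> (y x)"])
      show "\<phi> (y x) \<in> plaque c \<rho> \<and> J (meth h (\<phi> (y x))) = (\<lambda>_. 0)"
        unfolding G_iff pl using x(1,2) by blast
      fix z' assume z': "z' \<in> plaque c \<rho> \<and> J (meth h z') = (\<lambda>_. 0)"
      then obtain x' where x': "x' \<in> range P \<inter> ball 0 \<rho>" "z' = \<phi> (y x')" unfolding pl by blast
      then have "G x' = 0" using z' G_iff by simp
      then show "z' = \<phi> (y x)" using x(3)[OF x'(1)] x'(2) by simp
    qed
  qed
  ultimately show ?thesis using sb h0(1) by (intro exI[of _ \<rho>] exI[of _ s] exI[of _ h0]) blast
qed

end

section \<open>Reduction to a box around a point of the hidden constraint set\<close>

theorem theorem4p1:
  fixes A :: "('p::{t2_space, second_countable_topology}, 'e::euclidean_space) chart set"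
    and \<omega> :: "'p \<Rightarrow> 'e \<Rightarrow> 'e \<Rightarrow> real"
    and H :: "'p \<Rightarrow> real"
    and J :: "'p \<Rightarrow> 'v::real_vector \<Rightarrow> real"
    and m :: nat
    and M :: "'p set"
    and I :: "real set"
    and \<phi> :: "real \<Rightarrow> 'p \<Rightarrow> 'p"
  assumes "symplectic_manifold A \<omega>"
    and "smooth_map A euclidean_atlas UNIV H"
    and "\<exists>B::'v set. finite B \<and> independent B \<and> span B = UNIV \<and> card B = m"
    and "smooth_dual_map A J"
    and "regular_value_dual A J (\<lambda>_. 0)"
    and "M = J -` {\<lambda>_. 0}"
    and "coisotropic_submanifold A \<omega> M"
    and "nondegeneracy_assumption A \<omega> M H"
    and "consistent_method A (hamiltonian_vector_field A \<omega> H) I \<phi>"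
  shows "\<forall>z\<^sub>0 \<in> hidden_constraint_set A \<omega> M H. \<forall>N. open N \<and> z\<^sub>0 \<in> N \<longrightarrow>
           (\<exists>U h\<^sub>0. open U \<and> z\<^sub>0 \<in> U \<and> U \<subseteq> N \<and> 0 < h\<^sub>0 \<and> {-h\<^sub>0<..<h\<^sub>0} \<subseteq> I \<and>
              (\<forall>h z. 0 < \<bar>h\<bar> \<and> \<bar>h\<bar> < h\<^sub>0 \<and> z \<in> M \<inter> U \<longrightarrow>
                 (\<exists>!z'. z' \<in> local_fibre A \<omega> M U z \<and> J (\<phi> h z') = (\<lambda>_. 0))))"
proof (intro ballI allI impI, elim conjE)
  fix z0 N assume hidden: "z0 \<in> hidden_constraint_set A \<omega> M H" and N: "open N" "z0 \<in> N"
  interpret symplectic A \<omega>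
    by unfold_locales (use assms(1) in \<open>auto simp: symplectic_manifold_def\<close>)
  obtain B :: "'v set" where B: "finite B" "independent B" "span B = UNIV" using assms(3) by blast
  obtain u0 where z0M: "z0 \<in> M" and u0: "u0 \<in> tangent_space A M z0"
    "\<And>v. v \<in> tangent_space A M z0 \<Longrightarrow> differential A H z0 v = \<omega> z0 u0 v"
    using hidden unfolding hidden_constraint_set_def by blast
  obtain U \<psi> E where U: "compatible_chart A (U, \<psi>)" "z0 \<in> U" "subspace E" "U \<inter> M = {y \<in> U. \<psi> y \<in> E}"
    using assms(7) z0M unfolding coisotropic_submanifold_def embedded_submanifold_def by blast
  have TM: "tangent_space A M x = {v. tangent_coord A \<psi> x v \<in> E}" if "x \<in> U" "x \<in> M" for x
    by (rule tangent_space_slice[OF U(1) that U(3,4)])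
  define p0 where "p0 = \<psi> z0"
  define om where "om = chart_form A \<omega> U \<psi>"
  have p0: "p0 \<in> \<psi> ` U" "p0 \<in> E" using U(2,4) z0M by (auto simp: p0_def)
  \<comment> \<open>Coisotropy is given for tangent vectors in the reference charts; the slice
    description of the tangent space of \<open>M\<close> translates it into a statement about
    \<open>E\<close>.\<close>
  have cois: "w \<in> E" if p: "p \<in> \<psi> ` U" "p \<in> E" and w: "\<And>v. v \<in> E \<Longrightarrow> om p w v = 0" for p w
  proof -
    obtain x where x: "x \<in> U" "p = \<psi> x" using p(1) by blast
    then have xM: "x \<in> M" using p(2) U(4) by blast
    define w' where "w' = coord_tangent A U \<psi> x w"
    have "\<omega> x w' v = 0" if "v \<in> tangent_space A M x" for v
      using w[of "tangent_coord A \<psi> x v"] that TM[OF x(1) xM]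
      by (simp add: form_eq_chart_form[OF U(1) x(1)] w'_def tangent_coord_inverse[OF U(1) x(1)] om_def x(2))
    then have "w' \<in> tangent_space A M x"
      using assms(7) xM unfolding coisotropic_submanifold_def symplectic_complement_def by blast
    then show ?thesis using TM[OF x(1) xM] by (simp add: w'_def tangent_coord_inverse[OF U(1) x(1)])
  qed
  have bil: "bilinear (om p)" and alt: "om p u u = 0" if "p \<in> \<psi> ` U" for p u
    unfolding om_def using chart_form_bilinear[OF U(1) that form_bilinear] chart_form_alternating[OF U(1) that] by auto
  have nd: "u = 0" if "p \<in> \<psi> ` U" "\<And>v. om p u v = 0" for p u
    by (rule chart_form_nondegenerate[OF U(1) that(1)]) (use that(2) in \<open>simp add: om_def\<close>)
  have sm: "smooth_on (\<psi> ` U) (\<lambda>p. om p u v)" for u v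
    unfolding om_def by (rule chart_form_smooth[OF U(1)])
  have closed: "frechet_derivative (\<lambda>p. om p v w) (at p) u + frechet_derivative (\<lambda>p. om p w u) (at p) v +
      frechet_derivative (\<lambda>p. om p u v) (at p) w = 0" if "p \<in> \<psi> ` U" for p u v w
    unfolding om_def by (rule chart_form_closed[OF U(1) that])
  obtain F P r where F: "r > 0" "ball p0 r \<subseteq> \<psi> ` U" "linear P"
    "\<And>x v. v \<in> E \<Longrightarrow> om p0 (P x) v = 0" "\<And>x. (\<And>v. v \<in> E \<Longrightarrow> om p0 x v = 0) \<Longrightarrow> P x = x"
    "\<And>x. norm (P x) \<le> norm x"
    "\<And>p. p \<in> ball p0 r \<Longrightarrow> linear (F p)" "\<And>p v. p \<in> ball p0 r \<Longrightarrow> F p v \<in> E"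
    "\<And>p v. p \<in> ball p0 r \<Longrightarrow> P (F p v) = P v" "\<And>p v. p \<in> ball p0 r \<Longrightarrow> F p (P v) = F p v"
    "\<And>v. smooth_on (ball p0 r) (\<lambda>p. F p v)"
    "\<And>p v w. p \<in> ball p0 r \<Longrightarrow>
       frechet_derivative (\<lambda>p. F p w) (at p) (F p v) = frechet_derivative (\<lambda>p. F p v) (at p) (F p w)"
    "\<And>p. p \<in> ball p0 r \<Longrightarrow> p \<in> E \<Longrightarrow> range (F p) = {u. \<forall>v\<in>E. om p u v = 0}"
  proof (rule coisotropic_frame[OF compatible_chartD(2)[OF U(1)] p0(1) U(3) p0(2) bil alt nd sm closed cois], assumption+, goal_cases)
    case (1 F P r)
    show ?case by (rule 1(1)) (fact 1)+
  qed
  have p0r: "p0 \<in> ball p0 r" using F(1) by simp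
  have rF: "range (F p0) = {u. \<forall>v\<in>E. om p0 u v = 0}" by (rule F(13)[OF p0r p0(2)])
  have rP: "range P = range (F p0)" unfolding rF using F(4) F(5)
    by (intro set_eqI iffI) (auto, metis rangeI)
  have PP: "P (P x) = P x" for x by (rule F(5)) (rule F(4))
  \<comment> \<open>Halving the radius leaves a closed ball inside the open one, so that the frame
    has uniform constants there by compactness.\<close>
  have sub: "cball p0 (r / 2) \<subseteq> ball p0 r" using F(1) by auto
  have "\<exists>K L. commuting_frame F (ball p0 r) p0 (r / 2) K L"
  proof (rule commuting_frame_constants[OF open_ball sub])
    show "0 < r / 2" using F(1) by simp
    show "frechet_derivative (\<lambda>p. F p w) (at p) (F p v) = frechet_derivative (\<lambda>p. F p v) (at p) (F p w)"
      if "p \<in> cball p0 (r / 2)" for p v w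
      by (rule F(12)[OF subsetD[OF sub that]])
  qed (fact F(7) F(11))+
  then obtain K L where KL: "commuting_frame F (ball p0 r) p0 (r / 2) K L" by blast
  interpret mb: method_box A \<omega> F p0 r "r / 2" K L M U \<psi> E P J B H \<phi> I
    by (intro method_box.intro constraint_box.intro fibre_box.intro symplectic_axioms KL
        fibre_box_axioms.intro constraint_box_axioms.intro method_box_axioms.intro)
      (fact U(1) U(3) p0(2) U(4) F(2) F(3) PP F(6) F(8) F(9) F(10) F(13)[unfolded om_def]
        assms(4) assms(5) assms(6) B rP assms(2) assms(9))+
  have z0: "inv_into U \<psi> p0 = z0" unfolding p0_def by (rule inv_chart[OF U(1,2)])
  \<comment> \<open>Here the hidden constraint enters: on vectors tangent to \<open>M\<close> at
    \<open>z0\<close>, \<open>dH\<close> is the pairing with a tangent vector \<open>u0\<close>.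
    Kernel vectors pair to zero with \<open>u0\<close>, so \<open>H\<close> is critical along the
    fibre.\<close>
  have critical: "frechet_derivative mb.Hc (at p0) w = 0" if "w \<in> range P" for w
  proof -
    define w' where "w' = coord_tangent A U \<psi> z0 w"
    have tw: "tangent_coord A \<psi> z0 w' = w" by (simp add: w'_def tangent_coord_inverse[OF U(1,2)])
    have wE: "w \<in> E" using that rP F(8)[OF p0r] by auto
    have "frechet_derivative mb.Hc (at p0) w = differential A H z0 w'"
      unfolding differential_in_chart[OF U(1,2) assms(2)] tw mb.Hc_def p0_def ..
    also have "\<dots> = \<omega> z0 u0 w'" by (rule u0(2)) (simp add: TM[OF U(2) z0M] tw wE)
    also have "\<dots> = - \<omega> z0 w' u0" by (rule form_antisym)
    also have "\<omega> z0 w' u0 = om p0 w (tangent_coord A \<psi> z0 u0)"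
      unfolding form_eq_chart_form[OF U(1,2)] tw om_def p0_def ..
    also have "\<dots> = 0" using that u0(1) TM[OF U(2) z0M] unfolding rP rF by blast
    finally show ?thesis by simp
  qed
  \<comment> \<open>The straightened chart is a leaf chart in which \<open>z0\<close> has coordinate
    0, so the nondegeneracy assumption becomes a statement about \<open>leaf_H\<close> on
    \<open>range P\<close>. It concerns critical points on the leaf, hence the check that
    \<open>z0\<close> is in its own leaf: it lies in a plaque and so in the space underlying the
    leaf topology.\<close>
  have nondegenerate: "u = 0"
    if \<rho>: "\<rho> > 0" and adm: "\<And>d. norm d < \<rho> \<Longrightarrow> mb.strictly_admissible p0 d" and u: "u \<in> range P"
      and hess: "\<And>v. v \<in> range P \<Longrightarrow> hessian (mb.leaf_H \<rho>) 0 u v = 0" for \<rho> u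
  proof -
    obtain \<Omega> where \<Omega>: "open \<Omega>" "(0, p0) \<in> \<Omega>" "\<Omega> \<subseteq> I \<times> ball p0 r" "\<And>b. smooth_on \<Omega> (mb.evol b)"
      using mb.evol_smooth by blast
    have u0': "mb.plaque_map p0 0 = p0"
      by (rule mb.plaque_map_0[OF mb.strictly_admissible_imp[OF adm]]) (use \<rho> in simp)
    have lc: "leaf_chart A M mb.D z0 (mb.leaf_dom p0 \<rho>) (mb.leaf_coord p0) (range P)"
      using mb.plaque_leaf_chart[OF adm p0(2), of \<rho> 0] \<rho> linear_0[OF F(3)] by (simp add: u0' z0)
    have "mb.leaf_coord p0 z0 = mb.straighten p0 p0"
      using fun_cong[OF mb.leaf_coord_def[OF adm], of \<rho> z0] by (simp add: p0_def[symmetric])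
    then have coord0: "mb.leaf_coord p0 z0 = 0"
      using linear_0[OF F(3)] by (simp add: mb.straighten_def u0')
    have leaf_H: "mb.leaf_H \<rho> = H \<circ> inv_into (mb.leaf_dom p0 \<rho>) (mb.leaf_coord p0)"
      by (rule mb.leaf_H_def[OF \<rho> adm \<Omega> critical])
    have leaf_dH: "mb.leaf_dH \<rho> v w = frechet_derivative (mb.leaf_H \<rho>) (at w) v" for v w
      by (rule mb.leaf_dH_def[OF \<rho> adm \<Omega> critical])
    have "z0 \<in> mb.plaque p0 \<rho>"
      unfolding mb.plaque_def mb.plaque_coords_def using \<rho> linear_0[OF F(3)] u0' z0
      by (intro image_eqI[of _ _ p0] image_eqI[of _ _ 0]) auto
    then have "z0 \<in> topspace (leaf_topology A M mb.D)"
      using openin_subset[OF mb.plaque_connected(2)[OF adm p0(2), of \<rho>]] by blast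
    then have "z0 \<in> leaf A M mb.D z0" unfolding leaf_def by (simp add: connected_component_of_refl)
    moreover have "frechet_derivative (H \<circ> inv_into (mb.leaf_dom p0 \<rho>) (mb.leaf_coord p0)) (at (mb.leaf_coord p0 z0)) v = 0"
      if "v \<in> range P" for v
    proof -
      have "mb.leaf_dH \<rho> v 0 = 0"
        by (rule mb.leaf_dH_0[OF \<rho> adm \<Omega> critical]) (use that mb.P_range in auto)
      then show ?thesis unfolding leaf_dH leaf_H coord0 .
    qed
    ultimately have "leaf_critical_point A M mb.D H z0 z0"
      unfolding leaf_critical_point_def using lc by blast
    then have "leaf_hessian_nonsingular A M mb.D H z0"
      using assms(8) z0M unfolding nondegeneracy_assumption_def by blast
    then have "\<forall>u\<in>range P. (\<forall>v\<in>range P. hessian (mb.leaf_H \<rho>) (mb.leaf_coord p0 z0) u v = 0) \<longrightarrow> u = 0"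
      using lc unfolding leaf_hessian_nonsingular_def leaf_H by blast
    then show ?thesis using u hess unfolding coord0 by blast
  qed
  have zN: "inv_into U \<psi> p0 \<in> N" using z0 N(2) by simp
  have "\<exists>\<rho> s h0. small_box A \<omega> F p0 r (r / 2) K L M U \<psi> E P \<rho> s \<and>
    small_box.nbhd F p0 (r / 2) K U \<psi> P \<rho> s \<subseteq> N \<and> 0 < h0 \<and> {-h0<..<h0} \<subseteq> I \<and>
    (\<forall>h c. 0 < \<bar>h\<bar> \<and> \<bar>h\<bar> < h0 \<and> c \<in> small_box.transversal p0 E P s \<longrightarrow>
      (\<exists>!z'. z' \<in> mb.plaque c \<rho> \<and> J (\<phi> h z') = (\<lambda>_. 0)))"
    by (rule mb.local_solvability[OF critical nondegenerate N(1) zN])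
  then obtain \<rho> s h0 where box: "small_box A \<omega> F p0 r (r / 2) K L M U \<psi> E P \<rho> s"
    "small_box.nbhd F p0 (r / 2) K U \<psi> P \<rho> s \<subseteq> N" "0 < h0" "{-h0<..<h0} \<subseteq> I"
    "\<forall>h c. 0 < \<bar>h\<bar> \<and> \<bar>h\<bar> < h0 \<and> c \<in> small_box.transversal p0 E P s \<longrightarrow>
      (\<exists>!z'. z' \<in> mb.plaque c \<rho> \<and> J (\<phi> h z') = (\<lambda>_. 0))"
    by (elim exE conjE) (rule that)
  interpret sb: small_box A \<omega> F p0 r "r / 2" K L M U \<psi> E P \<rho> s by (rule box(1))
  have p0box: "p0 \<in> sb.box"
    using sb.box_compose(1)[of p0 0] sb.\<rho>(1) sb.s(1) linear_0[OF F(3)]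
      mb.plaque_map_0[OF mb.strictly_admissible_imp[OF sb.center_admissible[of p0 0]]] by simp
  show "\<exists>U h\<^sub>0. open U \<and> z0 \<in> U \<and> U \<subseteq> N \<and> 0 < h\<^sub>0 \<and> {-h\<^sub>0<..<h\<^sub>0} \<subseteq> I \<and>
     (\<forall>h z. 0 < \<bar>h\<bar> \<and> \<bar>h\<bar> < h\<^sub>0 \<and> z \<in> M \<inter> U \<longrightarrow>
        (\<exists>!z'. z' \<in> local_fibre A \<omega> M U z \<and> J (\<phi> h z') = (\<lambda>_. 0)))"
  proof (intro exI conjI allI impI)
    show "open sb.nbhd" by (rule sb.open_nbhd)
    have "\<psi> z0 = p0" by (simp add: p0_def)
    then show "z0 \<in> sb.nbhd" unfolding sb.nbhd_def using U(2) p0box by simp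
    show "sb.nbhd \<subseteq> N" "0 < h0" "{-h0<..<h0} \<subseteq> I" by (fact box)+
    fix h z assume hz: "0 < \<bar>h\<bar> \<and> \<bar>h\<bar> < h0 \<and> z \<in> M \<inter> sb.nbhd"
    then have z: "z \<in> M \<inter> sb.nbhd" by blast
    show "\<exists>!z'. z' \<in> local_fibre A \<omega> M sb.nbhd z \<and> J (\<phi> h z') = (\<lambda>_. 0)"
      unfolding sb.local_leaf_eq_plaque[OF z]
      by (rule box(5)[rule_format]) (intro conjI sb.nbhd_transversal[OF z]; use hz in blast)
  qed
qed

end
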